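(* Let $\eta$ be a nilpotent endomorphism of Jordan type $\lambda$ of an $n$-dimensional vector space $V$ over an infinite field. For all standard Young tableaux $T\in\mathcal T_\lambda$ one has $\overline{\mathcal F_{\eta,T}}=\overline{\mathcal F^*_{\eta,S(T)}}$, the closures being taken in the variety $\mathcal F_\eta$ of $\eta$-stable complete flags in $V$.
   Context: Varieties carry the Zariski topology. A complete flag $f$ in $V$ is a chain $0=f_0\subset f_1\subset\cdots\subset f_n=V$ with $\dim f_i=i$; it is $\eta$-stable if $\eta(f_i)\subset f_i$ for all $i$; $\mathcal F_\eta$ is the variety of these. For an $\eta$-stable subspace $V'$, $\eta|_{V'}$ and $\eta_{/V'}$ are the endomorphisms of $V'$ and $V/V'$ induced by $\eta$. $J(\xi)$ denotes the Jordan type of a nilpotent $\xi$ (the partition formed by the sizes of its Jordan blocks). A partition $\lambda$ is a weakly decreasing sequence $\lambda_0\ge\lambda_1\ge\cdots$ of natural numbers with finite sum $|\lambda|$, with Young diagram $Y(\lambda)=\{(i,j)\in\mathbb N^2:j<\lambda_i\}$ (row $i$, column $j$). A Young tableau of shape $\lambda$ is an injective map $T:Y(\lambda)\to\mathbb N$ increasing along rows and columns; $\operatorname{sh}T=\lambda$; $\operatorname{ch}T$ is the saturated decreasing chain of partitions from $\lambda$ to $(0)$ obtained by recording the shapes as squares are removed in order of decreasing entries. $\mathcal T_\lambda$ is the set of tableaux of shape $\lambda$ with entries $0,1,\dots,|\lambda|-1$. For $f\in\mathcal F_\eta$ the tableaux $r_\eta(f),q_\eta(f)\in\mathcal T_\lambda$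 are defined by $\operatorname{ch}r_\eta(f)=(J(\eta),J(\eta|_{f_{n-1}}),J(\eta|_{f_{n-2}}),\dots,(0))$ and $\operatorname{ch}q_\eta(f)=(J(\eta),J(\eta_{/f_1}),J(\eta_{/f_2}),\dots,(0))$. For $T\in\mathcal T_\lambda$, $\mathcal F_{\eta,T}=\{f\in\mathcal F_\eta: r_\eta(f)=T\}$ and $\mathcal F^*_{\eta,T}=\{f\in\mathcal F_\eta: q_\eta(f)=T\}$. Schützenberger (evacuation) algorithm: for a non-empty tableau $T$, the deflated tableau $T^{\downarrow}$ is obtained by removing the smallest entry (in square $(0,0)$), then repeatedly moving into the empty square the smaller of the entries to its right and below it, until the empty square is a corner of the diagram, and then deleting that square. $S(T)\in\mathcal T_\lambda$ is the tableau with $\operatorname{ch}S(T)=(\operatorname{sh}T,\operatorname{sh}T^{\downarrow},\operatorname{sh}T^{\downarrow\downarrow},\dots,(0))$. *)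

theory Defs
  imports
    "HOL-Analysis.Abstract_Topology"
    "HOL-Library.Poly_Mapping"
    "HOL-Library.While_Combinator"
    "Jordan_Normal_Form.Jordan_Normal_Form"
begin

definition is_partition :: "(nat \<Rightarrow> nat) \<Rightarrow> bool" where
  "is_partition lam \<longleftrightarrow> antimono lam \<and> finite {i. lam i \<noteq> 0}"

definition partition_size :: "(nat \<Rightarrow> nat) \<Rightarrow> nat" where
  "partition_size lam = (\<Sum>i | lam i \<noteq> 0. lam i)"

definition young_diagram :: "(nat \<Rightarrow> nat) \<Rightarrow> (nat \<times> nat) set" where
  "young_diagram lam = {(i, j). j < lam i}"

text \<open>Tableaux are partial functions on squares (row, column) whose domain is the diagram.\<close>

type_synonym tableau = "nat \<times> nat \<Rightarrow> nat option"

definition is_tableau :: "(nat \<Rightarrow> nat) \<Rightarrow> tableau \<Rightarrow> bool" where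
  "is_tableau lam T \<longleftrightarrow>
     is_partition lam \<and> dom T = young_diagram lam \<and> inj_on T (dom T) \<and>
     (\<forall>i j. (i, Suc j) \<in> dom T \<longrightarrow> the (T (i, j)) < the (T (i, Suc j))) \<and>
     (\<forall>i j. (Suc i, j) \<in> dom T \<longrightarrow> the (T (i, j)) < the (T (Suc i, j)))"

definition standard_tableaux :: "(nat \<Rightarrow> nat) \<Rightarrow> tableau set" where
  "standard_tableaux lam = {T. is_tableau lam T \<and> ran T = {..<partition_size lam}}"

definition shape :: "tableau \<Rightarrow> nat \<Rightarrow> nat" where
  "shape T = (\<lambda>i. card {j. (i, j) \<in> dom T})"

definition remove_largest :: "tableau \<Rightarrow> tableau" where
  "remove_largest T = T |` {s. T s \<noteq> Some (Max (ran T))}"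

definition shape_chain :: "tableau \<Rightarrow> (nat \<Rightarrow> nat) list" where
  "shape_chain T = map (\<lambda>k. shape ((remove_largest ^^ k) T)) [0..<Suc (card (dom T))]"

text \<open>A state consists of the tableau, undefined on the empty square, and that square.\<close>

definition slide_step :: "tableau \<times> (nat \<times> nat) \<Rightarrow> tableau \<times> (nat \<times> nat)" where
  "slide_step = (\<lambda>(T, (i, j)).
     let s = (if (i, Suc j) \<in> dom T \<and>
                 ((Suc i, j) \<in> dom T \<longrightarrow> the (T (i, Suc j)) < the (T (Suc i, j)))
              then (i, Suc j) else (Suc i, j))
     in (T((i, j) := T s, s := None), s))"

definition deflate :: "tableau \<Rightarrow> tableau" where
  "deflate T = fst (while (\<lambda>(T, (i, j)). (i, Suc j) \<in> dom T \<or> (Suc i, j) \<in> dom T)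
                      slide_step (T((0, 0) := None), (0, 0)))"

definition evacuation :: "tableau \<Rightarrow> tableau" where
  "evacuation T = (THE T'. T' \<in> standard_tableaux (shape T) \<and>
     shape_chain T' = map (\<lambda>k. shape ((deflate ^^ k) T)) [0..<Suc (card (dom T))])"

context finite_dimensional_vector_space
begin

text \<open>For subspaces \<open>U \<subseteq> W\<close>: the classes of \<open>ws\<close> modulo \<open>U\<close> form a basis of \<open>W / U\<close>.\<close>

definition quotient_basis :: "'b set \<Rightarrow> 'b set \<Rightarrow> 'b list \<Rightarrow> bool" where
  "quotient_basis U W ws \<longleftrightarrow>
     span (U \<union> set ws) = W \<and>
     (\<forall>c. (\<Sum>i<length ws. scale (c i) (ws ! i)) \<in> U \<longrightarrow> (\<forall>i<length ws. c i = 0))"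

text \<open>\<open>A\<close> is the matrix, in that basis, of the endomorphism of \<open>W / U\<close> induced by \<open>\<eta>\<close>.\<close>

definition quotient_matrix :: "('b \<Rightarrow> 'b) \<Rightarrow> 'b set \<Rightarrow> 'b list \<Rightarrow> 'a mat \<Rightarrow> bool" where
  "quotient_matrix \<eta> U ws A \<longleftrightarrow>
     A \<in> carrier_mat (length ws) (length ws) \<and>
     (\<forall>j<length ws. \<eta> (ws ! j) - (\<Sum>i<length ws. scale (A $$ (i, j)) (ws ! i)) \<in> U)"

text \<open>
  The Jordan type of the nilpotent endomorphism induced by \<open>\<eta>\<close> on \<open>W / U\<close>, for \<open>\<eta>\<close>-stable
  \<open>U \<subseteq> W\<close>. Thus \<open>jordan_type \<eta> {0} UNIV\<close>, \<open>jordan_type \<eta> {0} W\<close> and \<open>jordan_type \<eta> U UNIV\<close>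
  are the Jordan types of \<open>\<eta>\<close>, of its restriction to \<open>W\<close> and of the endomorphism of \<open>V / U\<close>.
\<close>

definition jordan_type :: "('b \<Rightarrow> 'b) \<Rightarrow> 'b set \<Rightarrow> 'b set \<Rightarrow> nat \<Rightarrow> nat" where
  "jordan_type \<eta> U W = (THE lam. is_partition lam \<and>
     (\<exists>ws A. quotient_basis U W ws \<and> quotient_matrix \<eta> U ws A \<and>
        jordan_nf A (map (\<lambda>i. (lam i, 0)) [0..<card {i. lam i \<noteq> 0}])))"

end

text \<open>
  Polynomials with variables in \<open>'x\<close> are finitely supported functions from monomials to
  coefficients.
\<close>

definition eval_poly :: "(('x \<Rightarrow>\<^sub>0 nat) \<Rightarrow>\<^sub>0 'a::comm_semiring_1) \<Rightarrow> ('x \<Rightarrow> 'a) \<Rightarrow> 'a" where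
  "eval_poly p x =
     (\<Sum>m\<in>Poly_Mapping.keys p. Poly_Mapping.lookup p m *
        (\<Prod>v\<in>Poly_Mapping.keys m. x v ^ Poly_Mapping.lookup m v))"

context finite_dimensional_vector_space
begin

definition complete_flags :: "'b set list set" where
  "complete_flags = {f. length f = Suc dimension \<and> f ! 0 = {0} \<and> f ! dimension = UNIV \<and>
     (\<forall>i\<le>dimension. subspace (f ! i) \<and> dim (f ! i) = i) \<and>
     (\<forall>i<dimension. f ! i \<subset> f ! Suc i)}"

definition adapted_basis :: "'b set list \<Rightarrow> 'b list \<Rightarrow> bool" where
  "adapted_basis f vs \<longleftrightarrow>
     length vs = dimension \<and> (\<forall>i\<le>dimension. span (set (take i vs)) = f ! i)"

text \<open>
  The Pluecker coordinates of the \<open>i\<close>-dimensional member of a flag with adapted basis \<open>vs\<close> are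
  the maximal minors of the coordinates of the first \<open>i\<close> vectors of \<open>vs\<close>. They are indexed by
  duplicate-free lists \<open>bs\<close> of \<open>i\<close> basis vectors; reordering \<open>bs\<close> only changes the sign.
\<close>

definition pluecker_coord :: "'b list \<Rightarrow> 'b list \<Rightarrow> 'a" where
  "pluecker_coord vs bs =
     det (mat (length bs) (length bs) (\<lambda>(k, l). representation Basis (vs ! l) (bs ! k)))"

text \<open>
  Polynomials in the Pluecker coordinates that are, for every \<open>i\<close>, homogeneous in the
  coordinates of the \<open>i\<close>-dimensional member: the vanishing of such a polynomial at a flag does not
  depend on the adapted basis.
\<close>

definition multihomogeneous :: "(('b list \<Rightarrow>\<^sub>0 nat) \<Rightarrow>\<^sub>0 'a) \<Rightarrow> bool" where
  "multihomogeneous p \<longleftrightarrow>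
     (\<forall>m\<in>Poly_Mapping.keys p. \<forall>bs\<in>Poly_Mapping.keys m. distinct bs \<and> set bs \<subseteq> Basis) \<and>
     (\<forall>i. \<exists>d. \<forall>m\<in>Poly_Mapping.keys p.
        (\<Sum>bs | bs \<in> Poly_Mapping.keys m \<and> length bs = i. Poly_Mapping.lookup m bs) = d)"

definition zero_locus :: "(('b list \<Rightarrow>\<^sub>0 nat) \<Rightarrow>\<^sub>0 'a) \<Rightarrow> 'b set list set" where
  "zero_locus p = {f \<in> complete_flags.
     \<forall>vs. adapted_basis f vs \<longrightarrow> eval_poly p (pluecker_coord vs) = 0}"

text \<open>
  The variety of complete flags as a subvariety of the product of the projective spaces of the
  exterior powers of \<open>V\<close>: the closed sets are the common zero loci of sets of multihomogeneous
  polynomials.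
\<close>

definition flag_variety :: "'b set list topology" where
  "flag_variety = topology_generated_by {complete_flags - zero_locus p | p. multihomogeneous p}"

definition stable_flags :: "('b \<Rightarrow> 'b) \<Rightarrow> 'b set list set" where
  "stable_flags \<eta> = {f \<in> complete_flags. \<forall>i\<le>dimension. \<eta> ` (f ! i) \<subseteq> f ! i}"

definition stable_flag_variety :: "('b \<Rightarrow> 'b) \<Rightarrow> 'b set list topology" where
  "stable_flag_variety \<eta> = subtopology flag_variety (stable_flags \<eta>)"

definition r_tableau :: "('b \<Rightarrow> 'b) \<Rightarrow> 'b set list \<Rightarrow> tableau" where
  "r_tableau \<eta> f = (THE T. T \<in> standard_tableaux (jordan_type \<eta> {0} UNIV) \<and>
     shape_chain T = map (\<lambda>i. jordan_type \<eta> {0} (f ! (dimension - i))) [0..<Suc dimension])"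

definition q_tableau :: "('b \<Rightarrow> 'b) \<Rightarrow> 'b set list \<Rightarrow> tableau" where
  "q_tableau \<eta> f = (THE T. T \<in> standard_tableaux (jordan_type \<eta> {0} UNIV) \<and>
     shape_chain T = map (\<lambda>i. jordan_type \<eta> (f ! i) UNIV) [0..<Suc dimension])"

definition flags_with_r :: "('b \<Rightarrow> 'b) \<Rightarrow> tableau \<Rightarrow> 'b set list set" where
  "flags_with_r \<eta> T = {f \<in> stable_flags \<eta>. r_tableau \<eta> f = T}"

definition flags_with_q :: "('b \<Rightarrow> 'b) \<Rightarrow> tableau \<Rightarrow> 'b set list set" where
  "flags_with_q \<eta> T = {f \<in> stable_flags \<eta>. q_tableau \<eta> f = T}"

end

end

theory Submission
  imports Defs
begin

text \<open>
  For a stable flag \<open>f\<close> let \<open>J(i, j)\<close> be the Jordan type of \<open>\<eta>\<close> on \<open>f\<^sub>j / f\<^sub>i\<close>; then \<open>r\<close> records the row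
  \<open>J(0, \<cdot>)\<close> and \<open>q\<close> the column \<open>J(\<cdot>, n)\<close>. Evacuation is governed by the array \<open>D(i, j)\<close> of the shapes of
  the entries \<open>< j\<close> in the \<open>i\<close>-fold deflation of \<open>T\<close>, in which \<open>D(i, j)\<close> and \<open>D(i+1, j+1)\<close> differ
  whenever there are two partitions between \<open>D(i+1, j)\<close> and \<open>D(i, j+1)\<close>.

  A flag with \<open>J = D\<close> in row \<open>0\<close> is a limit of flags with \<open>J = D\<close> in column \<open>n\<close>: the cells of the array
  are corrected one at a time. If \<open>J(i, j)\<close>, \<open>J(i, j+1)\<close> and \<open>J(i+1, j)\<close> are right but \<open>J(i+1, j+1)\<close> is
  not, then it equals \<open>J(i, j)\<close>, and there is an endomorphism \<open>n\<close> of \<open>f\<^sub>j / f\<^sub>i\<close> commuting with \<open>\<eta>\<close> such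
  that \<open>(1 + t n) f\<close> has the right type there for almost all \<open>t\<close>. Pluecker coordinates of \<open>(1 + t n) f\<close>
  are polynomials in \<open>t\<close>, so \<open>f\<close> is in the closure of these flags because the field is infinite. The
  other inclusion corrects the cells \<open>(i, j)\<close> in the opposite order, with an endomorphism of
  \<open>f\<^sub>j\<^sub>+\<^sub>1 / f\<^sub>i\<^sub>+\<^sub>1\<close>.
\<close>

section \<open>Sliding and deflation\<close>

text \<open>D(i, j+1) and D(i+1, j) differ by two squares, so at most two partitions lie between
  them. If there is only one, the type of f_(j+1)/f_(i+1) is forced. If there are two, a flag need
  not take the one that D prescribes: \<open>r\<close> does not determine \<open>q\<close> flag by
  flag, only generically. In the bad case the line f_(i+1)/f_i lies deeper in the images of the
  powers of \<eta> on f_(j+1)/f_i than on f_j/f_i. As D(i, j+1) has a corner in the relevant column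
  d, \<eta> has a Jordan block of size exactly d+1 there, and adding a multiple of the last vector
  of that block to the line brings it back to depth d. The obstacle is to do so without spoiling
  cells that are already correct. So the change of one line is extended to an endomorphism commuting
  with \<eta>: a module map from f_j/f_i to k[\<eta>]/(\<eta>^(d+1)), followed by the map back that
  sends 1 to the head of the block. The opposite inclusion rests on the dual statement about
  hyperplanes. Every deformation is an explicit one-parameter family, which is why an infinite field
  suffices.\<close>

definition young_set :: "(nat \<times> nat) set \<Rightarrow> bool" where
  "young_set Y \<longleftrightarrow> finite Y \<and> (\<forall>i j i' j'. (i, j) \<in> Y \<longrightarrow> i' \<le> i \<longrightarrow> j' \<le> j \<longrightarrow> (i', j') \<in> Y)"

definition increasing_filling :: "tableau \<Rightarrow> bool" where
  "increasing_filling S \<longleftrightarrow> inj_on S (dom S) \<and>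
     (\<forall>i j i' j' x y. S (i, j) = Some x \<longrightarrow> S (i', j') = Some y \<longrightarrow> i \<le> i' \<longrightarrow> j \<le> j' \<longrightarrow>
        (i, j) \<noteq> (i', j') \<longrightarrow> x < y)"

text \<open>Only together with the hole do the occupied squares form a Young diagram; this is the
  invariant of sliding.\<close>

definition hole_state :: "tableau \<Rightarrow> nat \<times> nat \<Rightarrow> bool" where
  "hole_state S h \<longleftrightarrow> h \<notin> dom S \<and> young_set (insert h (dom S)) \<and> increasing_filling S"

definition slidable :: "tableau \<times> (nat \<times> nat) \<Rightarrow> bool" where
  "slidable = (\<lambda>(T, (i, j)). (i, Suc j) \<in> dom T \<or> (Suc i, j) \<in> dom T)"

definition slide :: "tableau \<times> (nat \<times> nat) \<Rightarrow> tableau \<times> (nat \<times> nat)" where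
  "slide = while slidable slide_step"

definition next_square :: "nat \<times> nat \<Rightarrow> nat \<times> nat \<Rightarrow> bool" where
  "next_square h a \<longleftrightarrow> a = (fst h, Suc (snd h)) \<or> a = (Suc (fst h), snd h)"

lemma young_setD: "young_set Y \<Longrightarrow> (i, j) \<in> Y \<Longrightarrow> i' \<le> i \<Longrightarrow> j' \<le> j \<Longrightarrow> (i', j') \<in> Y"
  unfolding young_set_def by blast

lemma increasing_fillingD:
  "increasing_filling S \<Longrightarrow> S (i, j) = Some x \<Longrightarrow> S (i', j') = Some y \<Longrightarrow> i \<le> i' \<Longrightarrow> j \<le> j' \<Longrightarrow>
    (i, j) \<noteq> (i', j') \<Longrightarrow> x < y"
  unfolding increasing_filling_def by blast

lemma increasing_filling_inj: "increasing_filling S \<Longrightarrow> S a = Some x \<Longrightarrow> S b = Some x \<Longrightarrow> a = b"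
  unfolding increasing_filling_def by (metis inj_onD domI)

lemma slide_unfold: "slide st = (if slidable st then slide (slide_step st) else st)"
  unfolding slide_def by (rule while_unfold)

lemma deflate_slide: "deflate T = fst (slide (T((0, 0) := None), (0, 0)))"
  unfolding deflate_def slide_def slidable_def ..

text \<open>The entry moved is the smaller one of the two neighbours, which bounds every entry in
  the quadrant to the lower right of the hole.\<close>

lemma slide_step_props:
  assumes hs: "hole_state S h" and sl: "slidable (S, h)"
  obtains s x where "slide_step (S, h) = (S(h := Some x, s := None), s)" "S s = Some x"
    "next_square h s" "hole_state (S(h := Some x, s := None)) s"
    "\<And>s' y. next_square h s' \<Longrightarrow> S s' = Some y \<Longrightarrow> x \<le> y"
proof -
  obtain i j where h: "h = (i, j)" by force
  define s where "s = (if (i, Suc j) \<in> dom S \<and>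
                 ((Suc i, j) \<in> dom S \<longrightarrow> the (S (i, Suc j)) < the (S (Suc i, j)))
              then (i, Suc j) else (Suc i, j))"
  have sS: "s \<in> dom S" using sl unfolding slidable_def h s_def by auto
  then obtain x where x: "S s = Some x" by auto
  have ns: "next_square h s" unfolding next_square_def h s_def by auto
  have min: "x \<le> y" if "next_square h s'" "S s' = Some y" for s' y
    using that x unfolding next_square_def h s_def by (auto split: if_splits)
  have young: "young_set (insert h (dom S))" and inc: "increasing_filling S" and hn: "h \<notin> dom S"
    using hs unfolding hole_state_def by auto
  have sh: "s \<noteq> h" using ns unfolding next_square_def h by auto
  let ?S = "S(h := Some x, s := None)"
  have dom': "insert s (dom ?S) = insert h (dom S)" using sS sh by auto
  have inj: "inj_on ?S (dom ?S)"
  proof (rule inj_onI)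
    fix p q assume "p \<in> dom ?S" "q \<in> dom ?S" "?S p = ?S q"
    then obtain z where z: "?S p = Some z" "?S q = Some z" by (metis domD)
    have ps: "p \<noteq> s" "q \<noteq> s" using z by (metis fun_upd_same option.distinct(1))+
    show "p = q"
    proof (cases "p = h \<or> q = h")
      case True
      then show ?thesis using z ps sh increasing_filling_inj[OF inc x] by (metis fun_upd_apply option.inject)
    next
      case False
      then show ?thesis using z ps increasing_filling_inj[OF inc] by (metis fun_upd_apply)
    qed
  qed
  have below: "x < y" if y: "S (i', j') = Some y" and le: "i \<le> i'" "j \<le> j'" and ne: "(i', j') \<noteq> s" for i' j' y
  proof -
    have "(i', j') \<noteq> (i, j)" using y hn h by auto
    then have "Suc i \<le> i' \<or> Suc j \<le> j'" using le by (metis le_antisym not_less_eq_eq)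
    then obtain i1 j1 where n1: "next_square h (i1, j1)" and le1: "i1 \<le> i'" "j1 \<le> j'"
      unfolding next_square_def h using le by auto
    have "(i1, j1) \<in> insert h (dom S)" using young_setD[OF young _ le1] y by auto
    then have "(i1, j1) \<in> dom S" using n1 unfolding next_square_def h by auto
    then obtain z where z: "S (i1, j1) = Some z" by auto
    have "x \<le> z" using min n1 z by blast
    moreover have "z \<le> y" using increasing_fillingD[OF inc z y le1] z y by (cases "(i1,j1) = (i',j')") auto
    moreover have "x \<noteq> y" using increasing_filling_inj[OF inc x] y ne by auto
    ultimately show ?thesis by simp
  qed
  have above: "y < x" if y: "S (i', j') = Some y" and le: "i' \<le> i" "j' \<le> j" for i' j' y
  proof -
    obtain i1 j1 where s1: "s = (i1, j1)" by force
    then have "i' \<le> i1" "j' \<le> j1" "(i', j') \<noteq> (i1, j1)" using ns le unfolding next_square_def h by auto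
    then show ?thesis using increasing_fillingD[OF inc y, of i1 j1 x] x s1 by auto
  qed
  have incr: "increasing_filling ?S" unfolding increasing_filling_def
  proof (intro conjI allI impI)
    show "inj_on ?S (dom ?S)" by (rule inj)
  next
    fix i1 j1 i2 j2 y z
    assume a: "?S (i1, j1) = Some y" "?S (i2, j2) = Some z" "i1 \<le> i2" "j1 \<le> j2" "(i1, j1) \<noteq> (i2, j2)"
    show "y < z"
    proof (cases "(i1, j1) = h")
      case True
      then show ?thesis using a below[of i2 j2 z] h sh by (auto split: if_splits)
    next
      case f1: False
      show ?thesis
      proof (cases "(i2, j2) = h")
        case True
        then show ?thesis using a above[of i1 j1 y] h sh by (auto split: if_splits)
      next
        case False
        then show ?thesis using a f1 increasing_fillingD[OF inc, of i1 j1 y i2 j2 z] by (auto split: if_splits)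
      qed
    qed
  qed
  have "hole_state ?S s" unfolding hole_state_def dom' using young incr by auto
  moreover have "slide_step (S, h) = (?S, s)" unfolding slide_step_def h Let_def split s_def[symmetric] x by (rule refl)
  ultimately show thesis using that x ns min by blast
qed

text \<open>Each step moves the hole to the next antidiagonal, so the number of entries on
  antidiagonals strictly beyond the hole decreases. The rule packages this termination argument; its
  induction hypothesis speaks of the state after one step.\<close>

lemma slide_induct [consumes 1, case_names step]:
  assumes "hole_state S h"
    and "\<And>S h. hole_state S h \<Longrightarrow>
      (\<And>S' h'. slidable (S, h) \<Longrightarrow> slide_step (S, h) = (S', h') \<Longrightarrow> P S' h') \<Longrightarrow> P S h"
  shows "P S h"
  using assms(1)
proof (induction "card {s \<in> dom S. fst s + snd s > fst h + snd h}" arbitrary: S h rule: less_induct)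
  case less
  show ?case
  proof (rule assms(2)[OF less.prems])
    fix S' h' assume sl: "slidable (S, h)" and S': "slide_step (S, h) = (S', h')"
    obtain s x where st: "slide_step (S, h) = (S(h := Some x, s := None), s)" "S s = Some x"
      "next_square h s" "hole_state (S(h := Some x, s := None)) s"
      using slide_step_props[OF less.prems sl] by metis
    let ?S = "S(h := Some x, s := None)"
    let ?A = "\<lambda>S h. {s \<in> dom S. fst s + snd s > fst h + snd h}"
    have fin: "finite (dom S)" using less.prems unfolding hole_state_def young_set_def by auto
    have sn: "fst s + snd s = Suc (fst h + snd h)" using st(3) unfolding next_square_def by auto
    have "?A ?S s \<subset> ?A S h"
    proof
      show "?A ?S s \<subseteq> ?A S h" using sn by (auto split: if_splits)
      have "s \<in> ?A S h" "s \<notin> ?A ?S s" using sn st(2) by auto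
      then show "?A ?S s \<noteq> ?A S h" by blast
    qed
    then have "card (?A ?S s) < card (?A S h)" using fin by (intro psubset_card_mono) auto
    from less.hyps[OF this st(4)] show "P S' h'" using st(1) S' by simp
  qed
qed

lemma slide_props:
  assumes "hole_state S h"
  shows "hole_state (fst (slide (S, h))) (snd (slide (S, h))) \<and>
    insert (snd (slide (S, h))) (dom (fst (slide (S, h)))) = insert h (dom S) \<and>
    ran (fst (slide (S, h))) = ran S \<and> \<not> slidable (slide (S, h))"
proof -
  have "\<exists>S' h'. slide (S, h) = (S', h') \<and> hole_state S' h' \<and>
    insert h' (dom S') = insert h (dom S) \<and> ran S' = ran S \<and> \<not> slidable (S', h')"
    (is "?P S h")
    using assms
  proof (induction S h rule: slide_induct)
    case (step S h)
    show ?case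
    proof (cases "slidable (S, h)")
      case True
      obtain s x where st: "slide_step (S, h) = (S(h := Some x, s := None), s)" "S s = Some x"
        "next_square h s" "hole_state (S(h := Some x, s := None)) s"
        using slide_step_props[OF step(1) True] by metis
      have hs: "h \<noteq> s" "h \<notin> dom S" using st(3) step(1) unfolding next_square_def hole_state_def by (cases h; auto)+
      have "insert s (dom (S(h := Some x, s := None))) = insert h (dom S)" using st(2) hs by auto
      moreover have "ran (S(h := Some x, s := None)) = ran S"
      proof -
        have "ran (S(h := Some x, s := None)) \<subseteq> ran S"
          using ranI[of S s x, OF st(2)] ranI[of S] by (auto simp: ran_def[of "S(_ := _, _ := _)"] split: if_splits)
        moreover have "ran S \<subseteq> ran (S(h := Some x, s := None))"
        proof
          fix y assume "y \<in> ran S"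
          then obtain p where p: "S p = Some y" by (auto simp: ran_def)
          show "y \<in> ran (S(h := Some x, s := None))"
          proof (cases "p = s")
            case True
            then show ?thesis using p st(2) hs ranI[of "S(h := Some x, s := None)" h x] by auto
          next
            case False
            then have "(S(h := Some x, s := None)) p = Some y" using p hs domI[of S p y, OF p] by auto
            then show ?thesis by (rule ranI)
          qed
        qed
        ultimately show ?thesis by blast
      qed
      moreover have "slide (S, h) = slide (S(h := Some x, s := None), s)"
        using True st(1) by (subst slide_unfold) simp
      ultimately show ?thesis using step(2)[OF True st(1)] by (simp only:)
    next
      case False
      then show ?thesis using step(1) by (subst slide_unfold) auto
    qed
  qed
  then show ?thesis by (elim exE conjE) simp
qed

text \<open>The largest entry loses every comparison, so it does not affect the path of the hole
  until the other entries have brought it to a halt. Then \<open>a\<close> either adjoins the hole,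
  and its entry is pulled in, or it stays as it is.\<close>

lemma slide_insert_max:
  assumes "hole_state S h" "a \<notin> insert h (dom S)" "\<forall>x\<in>ran S. x < m" "young_set (insert a (insert h (dom S)))"
  shows "slide (S(a := Some m), h) =
    (if next_square (snd (slide (S, h))) a
     then ((fst (slide (S, h)))(snd (slide (S, h)) := Some m), a)
     else ((fst (slide (S, h)))(a := Some m), snd (slide (S, h))))"
proof -
  have "a \<notin> insert h (dom S) \<longrightarrow> (\<forall>x\<in>ran S. x < m) \<longrightarrow> slide (S(a := Some m), h) =
    (if next_square (snd (slide (S, h))) a
     then ((fst (slide (S, h)))(snd (slide (S, h)) := Some m), a)
     else ((fst (slide (S, h)))(a := Some m), snd (slide (S, h))))" (is "?P S h")
    using assms(1)
  proof (induction S h rule: slide_induct)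
    case (step S h)
    show ?case
    proof (intro impI)
      assume a: "a \<notin> insert h (dom S)" and m: "\<forall>x\<in>ran S. x < m"
      obtain i j where h: "h = (i, j)" by force
      have young: "young_set (insert h (dom S))" and hn: "h \<notin> dom S"
        using step(1) unfolding hole_state_def by auto
      show "slide (S(a := Some m), h) =
        (if next_square (snd (slide (S, h))) a
         then ((fst (slide (S, h)))(snd (slide (S, h)) := Some m), a)
         else ((fst (slide (S, h)))(a := Some m), snd (slide (S, h))))"
      proof (cases "slidable (S, h)")
        case True
        obtain s x where st: "slide_step (S, h) = (S(h := Some x, s := None), s)" "S s = Some x"
          "next_square h s" "hole_state (S(h := Some x, s := None)) s"
          "\<And>s' y. next_square h s' \<Longrightarrow> S s' = Some y \<Longrightarrow> x \<le> y"
          using slide_step_props[OF step(1) True] by metis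
        have as: "a \<noteq> s" using a st(2) by auto
        have lt: "the (S p) < m" if "p \<in> dom S" for p using m that ranI[of S p] by auto
        \<comment> \<open>If \<open>a\<close> is one of the two neighbours of the hole, then
          \<open>slidable (S, h)\<close> provides an entry of \<open>S\<close> in the other one, and
          that entry is smaller than \<open>m\<close>.\<close>
        have sel: "(if (i, Suc j) \<in> dom (S(a := Some m)) \<and>
                 ((Suc i, j) \<in> dom (S(a := Some m)) \<longrightarrow>
                   the ((S(a := Some m)) (i, Suc j)) < the ((S(a := Some m)) (Suc i, j)))
              then (i, Suc j) else (Suc i, j)) = 
             (if (i, Suc j) \<in> dom S \<and> ((Suc i, j) \<in> dom S \<longrightarrow> the (S (i, Suc j)) < the (S (Suc i, j)))
              then (i, Suc j) else (Suc i, j))"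
        proof -
          consider "a = (i, Suc j)" | "a = (Suc i, j)" | "a \<noteq> (i, Suc j)" "a \<noteq> (Suc i, j)" by blast
          then show ?thesis
          proof cases
            case 1
            then have "(i, Suc j) \<notin> dom S" "(Suc i, j) \<in> dom S" using a True unfolding slidable_def h by auto
            then show ?thesis using 1 lt[of "(Suc i, j)"] by auto
          next
            case 2
            then have "(Suc i, j) \<notin> dom S" "(i, Suc j) \<in> dom S" using a True unfolding slidable_def h by auto
            then show ?thesis using 2 lt[of "(i, Suc j)"] by auto
          next
            case 3
            then show ?thesis by auto
          qed
        qed
        have seq: "s = (if (i, Suc j) \<in> dom S \<and> ((Suc i, j) \<in> dom S \<longrightarrow> the (S (i, Suc j)) < the (S (Suc i, j)))
              then (i, Suc j) else (Suc i, j))"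
          using st(1) unfolding slide_step_def h Let_def by auto
        have step': "slide_step (S(a := Some m), h) = ((S(h := Some x, s := None))(a := Some m), s)"
          unfolding slide_step_def h Let_def split sel seq[symmetric]
          using as st(2) a h by (auto simp: fun_upd_def)
        have sl': "slidable (S(a := Some m), h)" using True unfolding slidable_def h by auto
        have a': "a \<notin> insert s (dom (S(h := Some x, s := None)))" using a as by auto
        have m': "\<forall>x\<in>ran (S(h := Some x, s := None)). x < m"
          using m ranI[of S s x, OF st(2)] ranI[of S] by (auto simp: ran_def[of "S(_ := _, _ := _)"] split: if_splits)
        have "slide (S(a := Some m), h) = slide ((S(h := Some x, s := None))(a := Some m), s)"
          using sl' step' by (subst slide_unfold) simp
        moreover have "slide (S, h) = slide (S(h := Some x, s := None), s)"
          using True st(1) by (subst slide_unfold) simp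
        ultimately show ?thesis using step(2)[OF True st(1)] a' m' by (simp only: simp_thms)
      next
        case False
        then have S: "slide (S, h) = (S, h)" by (subst slide_unfold) simp
        show ?thesis
        proof (cases "next_square h a")
          case True
          have sl: "slidable (S(a := Some m), h)" using True unfolding slidable_def next_square_def h by auto
          have "slide_step (S(a := Some m), h) = (S(h := Some m), a)"
            using True False a unfolding slidable_def next_square_def slide_step_def h
            by (auto simp: fun_upd_def fun_eq_iff)
          \<comment> \<open>An entry to the right of \<open>a\<close> or below it would force
            \<open>a\<close> into the diagram \<open>insert h (dom S)\<close>.\<close>
          moreover have "\<not> slidable (S(h := Some m), a)"
          proof
            assume "slidable (S(h := Some m), a)"
            then have "(fst a, Suc (snd a)) \<in> insert h (dom S) \<or> (Suc (fst a), snd a) \<in> insert h (dom S)"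
              unfolding slidable_def by (cases a) auto
            then have "(fst a, snd a) \<in> insert h (dom S)"
              using young_setD[OF young, of "fst a" "Suc (snd a)"] young_setD[OF young, of "Suc (fst a)"] by (meson le_refl le_SucI)
            then have "a \<in> insert h (dom S)" by simp
            then show False using a by simp
          qed
          ultimately have "slide (S(a := Some m), h) = (S(h := Some m), a)"
            using sl by (subst slide_unfold, simp, subst slide_unfold, simp)
          then show ?thesis using S True by simp
        next
          case F: False
          have "\<not> slidable (S(a := Some m), h)"
            using False F unfolding slidable_def next_square_def h by auto
          then have "slide (S(a := Some m), h) = (S(a := Some m), h)" by (subst slide_unfold) simp
          then show ?thesis using S F by simp
        qed
      qed
    qed
  qed
  then show ?thesis using assms by blast
qed


section \<open>Fillings by consecutive entries and their restriction to small entries\<close>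

definition is_filling :: "tableau \<Rightarrow> bool" where
  "is_filling S \<longleftrightarrow> young_set (dom S) \<and> increasing_filling S"

definition entries_below :: "tableau \<Rightarrow> nat \<Rightarrow> tableau" where
  "entries_below S j = S |` {s. the (S s) < j}"

lemma entries_below_apply: "entries_below S j s = (case S s of None \<Rightarrow> None | Some x \<Rightarrow> if x < j then Some x else None)"
  unfolding entries_below_def restrict_map_def by (auto split: option.split)

lemma entries_below_eq_Some: "entries_below S j s = Some x \<longleftrightarrow> S s = Some x \<and> x < j"
  by (auto simp: entries_below_apply split: option.split)

lemma dom_entries_below: "dom (entries_below S j) = {s. \<exists>x<j. S s = Some x}"
  by (auto simp: dom_def entries_below_eq_Some)

lemma ran_entries_below: "ran (entries_below S j) = ran S \<inter> {..<j}"
  unfolding ran_def by (auto simp: entries_below_eq_Some)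

lemma entries_below_entries_below: "j \<le> k \<Longrightarrow> entries_below (entries_below S k) j = entries_below S j"
  by (rule ext) (auto simp: entries_below_apply split: option.split)

lemma entries_below_ident: "ran S \<subseteq> {..<j} \<Longrightarrow> entries_below S j = S"
proof (rule ext)
  fix s assume "ran S \<subseteq> {..<j}"
  then show "entries_below S j s = S s" using ranI[of S s] by (auto simp: entries_below_apply split: option.split)
qed

lemma young_setI:
  "finite Y \<Longrightarrow> (\<And>i j i' j'. (i, j) \<in> Y \<Longrightarrow> i' \<le> i \<Longrightarrow> j' \<le> j \<Longrightarrow> (i', j') \<in> Y) \<Longrightarrow> young_set Y"
  unfolding young_set_def by blast

lemma increasing_filling_restrict:
  assumes "increasing_filling S" "S' \<subseteq>\<^sub>m S"
  shows "increasing_filling S'"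
proof -
  have sub: "S s = Some x" if "S' s = Some x" for s x
    using assms(2) that unfolding map_le_def by (metis domI)
  show ?thesis unfolding increasing_filling_def
  proof (intro conjI allI impI inj_onI)
    fix p q assume "p \<in> dom S'" "q \<in> dom S'" "S' p = S' q"
    then obtain x where "S' p = Some x" "S' q = Some x" by (metis domD)
    then show "p = q" using increasing_filling_inj[OF assms(1)] sub by blast
  next
    fix i j i' j' x y assume "S' (i, j) = Some x" "S' (i', j') = Some y" "i \<le> i'" "j \<le> j'" "(i, j) \<noteq> (i', j')"
    then show "x < y" using increasing_fillingD[OF assms(1)] sub by blast
  qed
qed

lemma is_filling_entries_below:
  assumes "is_filling S"
  shows "is_filling (entries_below S j)"
proof -
  have Y: "young_set (dom S)" and inc: "increasing_filling S" using assms unfolding is_filling_def by auto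
  have "young_set (dom (entries_below S j))"
  proof (rule young_setI)
    have "dom (entries_below S j) \<subseteq> dom S" by (auto simp: dom_entries_below)
    then show "finite (dom (entries_below S j))" using Y finite_subset unfolding young_set_def by blast
  next
    fix a b a' b' assume ab: "(a, b) \<in> dom (entries_below S j)" "a' \<le> a" "b' \<le> b"
    then obtain x where x: "S (a, b) = Some x" "x < j" by (auto simp: dom_entries_below)
    then obtain y where y: "S (a', b') = Some y" using young_setD[OF Y, of a b a' b'] ab by blast
    have "y \<le> x" using increasing_fillingD[OF inc y x(1)] ab x y by (cases "(a', b') = (a, b)") auto
    then show "(a', b') \<in> dom (entries_below S j)" using x y by (auto simp: dom_entries_below)
  qed
  moreover have "entries_below S j \<subseteq>\<^sub>m S" unfolding entries_below_def map_le_def by auto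
  ultimately show ?thesis using increasing_filling_restrict[OF inc] unfolding is_filling_def by blast
qed

lemma is_filling_hole_state:
  assumes "is_filling S" "dom S \<noteq> {}"
  shows "hole_state (S((0, 0) := None)) (0, 0)" "(0, 0) \<in> dom S"
proof -
  obtain i j where "(i, j) \<in> dom S" using assms(2) by fastforce
  then show 00: "(0, 0) \<in> dom S" using assms(1) young_setD[of "dom S" i j 0 0] unfolding is_filling_def by auto
  have "S((0, 0) := None) \<subseteq>\<^sub>m S" by (auto simp: map_le_def)
  then show "hole_state (S((0, 0) := None)) (0, 0)"
    using assms increasing_filling_restrict 00 unfolding is_filling_def hole_state_def
    by (auto simp: insert_absorb)
qed

lemma filling_origin_le:
  assumes "is_filling S" "S (0, 0) = Some x" "S s = Some y"
  shows "x \<le> y"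
  using assms increasing_fillingD[of S 0 0 x "fst s" "snd s" y] unfolding is_filling_def
  by (cases "s = (0, 0)") auto

lemma filling_origin_Min:
  assumes "is_filling S" "ran S = {i..<j}" "i < j"
  shows "S (0, 0) = Some i"
proof -
  have "i \<in> ran S" using assms by auto
  then obtain s where s: "S s = Some i" by (auto simp: ran_def)
  then obtain x where x: "S (0, 0) = Some x" using is_filling_hole_state(2)[OF assms(1)] by blast
  then have "x \<le> i" using filling_origin_le[OF assms(1) x s] by simp
  moreover have "i \<le> x" using ranI[of S, OF x] assms by auto
  ultimately show ?thesis using x by simp
qed

text \<open>The hole ends in a square with no entry to its right or below, which is a corner of the
  diagram, so what remains is again a diagram. Ranges are intervals because deflation takes away the
  minimum and \<open>entries_below\<close> the largest entries.\<close>

lemma deflate_props: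
  assumes "is_filling S" "ran S = {i..<j}" "i < j"
  obtains h where "is_filling (deflate S)" "ran (deflate S) = {Suc i..<j}" "h \<in> dom S"
    "dom (deflate S) = dom S - {h}" "h = snd (slide (S((0, 0) := None), (0, 0)))"
proof -
  let ?S = "S((0, 0) := None)"
  have ne: "dom S \<noteq> {}" using filling_origin_Min[OF assms] by auto
  note hs = is_filling_hole_state[OF assms(1) ne]
  obtain S' h where sl: "slide (?S, (0, 0)) = (S', h)" by (metis surj_pair)
  note p = slide_props[OF hs(1), unfolded sl fst_conv snd_conv]
  have "insert (0, 0) (dom ?S) = dom S" using hs(2) by auto
  then have d: "insert h (dom S') = dom S" using p by simp
  have hn: "h \<notin> dom S'" using p unfolding hole_state_def by auto
  have inc: "increasing_filling S'" using p unfolding hole_state_def by auto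
  have Y: "young_set (dom S)" using assms(1) unfolding is_filling_def by auto
  have dS': "dom S' = dom S - {h}" using d hn by auto
  have corner: "(a, b) = h" if "h = (a', b')" "a' \<le> a" "b' \<le> b" "(a, b) \<in> dom S" for a b a' b'
  proof (rule ccontr)
    assume ne: "(a, b) \<noteq> h"
    then have "Suc a' \<le> a \<or> Suc b' \<le> b" using that(1-3) by auto
    then have "(Suc a', b') \<in> dom S \<or> (a', Suc b') \<in> dom S"
      using young_setD[OF Y that(4), of "Suc a'" b'] young_setD[OF Y that(4), of a' "Suc b'"] that(2,3) by satx
    then have "(Suc a', b') \<in> dom S' \<or> (a', Suc b') \<in> dom S'" using dS' that(1) by auto
    then show False using p that(1) unfolding slidable_def by auto
  qed
  have "young_set (dom S')" unfolding dS'
  proof (rule young_setI)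
    show "finite (dom S - {h})" using Y unfolding young_set_def by auto
    fix a b a' b' assume "(a, b) \<in> dom S - {h}" "a' \<le> a" "b' \<le> b"
    then show "(a', b') \<in> dom S - {h}" using young_setD[OF Y, of a b a' b'] corner[of a' b' a b] by blast
  qed
  then have fil: "is_filling S'" using inc unfolding is_filling_def by auto
  have o: "S (0, 0) = Some i" by (rule filling_origin_Min[OF assms])
  have "ran S' = ran ?S" using p by blast
  also have "\<dots> = ran S - {i}"
  proof -
    have inj: "increasing_filling S" using assms(1) unfolding is_filling_def by simp
    have "x \<in> ran ?S \<longleftrightarrow> x \<in> ran S \<and> x \<noteq> i" for x
    proof
      assume "x \<in> ran ?S"
      then obtain s where s: "?S s = Some x" by (auto simp: ran_def)
      then have "s \<noteq> (0, 0)" "S s = Some x" by (auto split: if_splits)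
      then show "x \<in> ran S \<and> x \<noteq> i" using ranI[of S s x] increasing_filling_inj[OF inj o, of s] by blast
    next
      assume x: "x \<in> ran S \<and> x \<noteq> i"
      then obtain s where s: "S s = Some x" by (auto simp: ran_def)
      then have "?S s = Some x" using o x by (cases "s = (0, 0)") auto
      then show "x \<in> ran ?S" by (rule ranI)
    qed
    then show ?thesis by blast
  qed
  also have "\<dots> = {Suc i..<j}" unfolding assms(2) by auto
  finally have "ran S' = {Suc i..<j}" .
  then show thesis using that[of h] fil dS' insertI1[of h "dom S'", unfolded d] unfolding deflate_slide sl by simp
qed

text \<open>The largest entry \<open>j\<close>, in square \<open>a\<close>, moves only if the hole left by the smaller entries
  ends next to it.\<close>

lemma deflate_entries_below:
  assumes fil: "is_filling S" and ran: "ran S = {i..<Suc j}" and ij: "i < j"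
  obtains a b where "a \<in> dom S" "dom (entries_below S j) = dom S - {a}"
    "b \<in> dom S - {a}" "dom (deflate (entries_below S j)) = dom S - {a} - {b}"
    "entries_below (deflate S) j = deflate (entries_below S j)"
    "dom (deflate S) = (if next_square b a then dom S - {a} else dom S - {b})"
proof -
  have "j \<in> ran S" using ran ij by auto
  then obtain a where a: "S a = Some j" by (auto simp: ran_def)
  let ?B = "entries_below S j"
  have filB: "is_filling ?B" by (rule is_filling_entries_below[OF fil])
  have ranB: "ran ?B = {i..<j}" unfolding ran_entries_below ran using ij by auto
  obtain b where b: "is_filling (deflate ?B)" "ran (deflate ?B) = {Suc i..<j}" "b \<in> dom ?B"
    "dom (deflate ?B) = dom ?B - {b}" "b = snd (slide (?B((0, 0) := None), (0, 0)))"
    by (rule deflate_props[OF filB ranB ij])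
  have inc: "increasing_filling S" using fil unfolding is_filling_def by auto
  have BS: "?B = S(a := None)"
  proof
    fix s show "?B s = (S(a := None)) s"
    proof (cases "S s")
      case None
      then show ?thesis by (simp add: entries_below_apply)
    next
      case (Some x)
      then have "x \<le> j" "x = j \<Longrightarrow> s = a"
        using ranI[of S s x] ran increasing_filling_inj[OF inc a, of s] by auto
      then show ?thesis using Some a by (auto simp: entries_below_apply)
    qed
  qed
  have dB: "dom ?B = dom S - {a}" unfolding BS by auto
  have SB: "S = ?B(a := Some j)" unfolding BS using a by (simp add: fun_upd_idem)
  have o: "?B (0, 0) = Some i" by (rule filling_origin_Min[OF filB ranB ij])
  have a0: "a \<noteq> (0, 0)" using o BS by auto
  let ?C = "?B((0, 0) := None)"
  have hs: "hole_state ?C (0, 0)" by (rule is_filling_hole_state(1)[OF filB]) (use o in auto)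
  have dB0: "insert (0, 0) (dom ?C) = dom S - {a}" using o dB by auto
  have young: "young_set (insert a (insert (0, 0) (dom ?C)))"
    unfolding dB0 using fil a unfolding is_filling_def by (simp add: insert_absorb domI)
  have lt: "\<forall>x\<in>ran ?C. x < j"
  proof
    fix x assume "x \<in> ran ?C"
    then obtain s where "?C s = Some x" by (auto simp: ran_def)
    then have "?B s = Some x" by (metis fun_upd_apply option.distinct(1))
    then show "x < j" using ranI[of ?B s x] ranB by auto
  qed
  have "S((0, 0) := None) = (?B(a := Some j))((0, 0) := None)" by (rule arg_cong[OF SB])
  also have "\<dots> = ?C(a := Some j)" by (rule fun_upd_twist[OF a0])
  finally have S0: "S((0, 0) := None) = ?C(a := Some j)" .
  have aC: "a \<notin> insert (0, 0) (dom ?C)" unfolding dB0 by simp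
  have sl: "slide (S((0, 0) := None), (0, 0)) = 
    (if next_square b a then ((deflate ?B)(b := Some j), a) else ((deflate ?B)(a := Some j), b))"
    unfolding S0 by (subst slide_insert_max[OF hs aC lt young]) (simp only: deflate_slide b(5))
  have defl: "deflate S = (if next_square b a then (deflate ?B)(b := Some j) else (deflate ?B)(a := Some j))"
    unfolding deflate_slide[of S] sl by simp
  have adef: "a \<notin> dom (deflate ?B)" "b \<notin> dom (deflate ?B)" using b dB by auto
  have B': "entries_below (deflate S) j = deflate ?B"
  proof
    fix s
    have "deflate ?B s = Some x \<Longrightarrow> x < j" for x using ranI[of "deflate ?B" s x] b(2) by auto
    moreover have "deflate ?B a = None" "deflate ?B b = None" using adef by (auto simp: domIff)
    ultimately show "entries_below (deflate S) j s = deflate ?B s"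
      unfolding defl by (auto simp: entries_below_apply split: option.split)
  qed
  have "a \<in> dom S" using a by auto
  moreover have ab: "b \<in> dom S - {a}" using b(3) dB by simp
  moreover have "dom (deflate S) = (if next_square b a then dom S - {a} else dom S - {b})"
    unfolding defl using b(4) dB ab \<open>a \<in> dom S\<close> by auto
  ultimately show thesis using that[of a b] dB b(4) B' by simp
qed


section \<open>Column lengths and the local rule\<close>

definition column_length :: "(nat \<times> nat) set \<Rightarrow> nat \<Rightarrow> nat" where
  "column_length Y k = card {i. (i, k) \<in> Y}"

text \<open>For the column lengths of four partitions with \<open>\<alpha>\<close> and \<open>\<beta>\<close> between \<open>\<nu>\<close> and \<open>\<mu>\<close>:
  the partitions \<open>\<alpha>\<close> and \<open>\<beta>\<close> are distinct unless there is only one partition between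
  \<open>\<nu>\<close> and \<open>\<mu>\<close>.\<close>

definition local_rule :: "(nat \<Rightarrow> nat) \<Rightarrow> (nat \<Rightarrow> nat) \<Rightarrow> (nat \<Rightarrow> nat) \<Rightarrow> (nat \<Rightarrow> nat) \<Rightarrow> bool" where
  "local_rule \<mu> \<alpha> \<beta> \<nu> \<longleftrightarrow> (\<exists>c d. (\<forall>k. \<mu> k = \<alpha> k + of_bool (k = c)) \<and> (\<forall>k. \<alpha> k = \<nu> k + of_bool (k = d)) \<and>
     (\<beta> = \<alpha> \<and> (c = d \<or> \<mu> d \<le> \<mu> (Suc d)) \<or>
      c \<noteq> d \<and> \<mu> (Suc c) < \<mu> c \<and> \<mu> (Suc d) < \<mu> d \<and> (\<forall>k. \<mu> k = \<beta> k + of_bool (k = d))))"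

lemma finite_column:
  assumes "young_set Y"
  shows "finite {i. (i, k) \<in> Y}"
proof -
  have "{i. (i, k) \<in> Y} \<subseteq> fst ` Y" by force
  then show ?thesis using assms finite_subset unfolding young_set_def by blast
qed

lemma young_set_column:
  assumes "young_set Y"
  shows "(i, k) \<in> Y \<longleftrightarrow> i < column_length Y k"
proof -
  note fin = finite_column[OF assms(1), of k]
  have "{i. (i, k) \<in> Y} = {..<column_length Y k}"
  proof (cases "{i. (i, k) \<in> Y} = {}")
    case True
    then show ?thesis unfolding column_length_def by simp
  next
    case False
    define m where "m = Max {i. (i, k) \<in> Y}"
    have "(m, k) \<in> Y" using Max_in[OF fin False] unfolding m_def by simp
    then have "i \<le> m \<Longrightarrow> (i, k) \<in> Y" for i using young_setD[OF assms] by blast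
    moreover have "(i, k) \<in> Y \<Longrightarrow> i \<le> m" for i using Max_ge[OF fin, of i] unfolding m_def by simp
    ultimately have "{i. (i, k) \<in> Y} = {..m}" by blast
    then show ?thesis unfolding column_length_def by (simp add: lessThan_Suc_atMost)
  qed
  then show ?thesis by blast
qed

lemma young_set_eqI:
  assumes "young_set Y" "young_set Z" "column_length Y = column_length Z"
  shows "Y = Z"
  using young_set_column[OF assms(1)] young_set_column[OF assms(2)] assms(3) by auto

lemma column_length_remove:
  assumes "young_set Y" "a \<in> Y"
  shows "column_length Y k = column_length (Y - {a}) k + of_bool (k = snd a)"
proof -
  note fin = finite_column[OF assms(1), of k]
  show ?thesis
  proof (cases "k = snd a")
    case True
    have e: "{i. (i, k) \<in> Y} = insert (fst a) {i. (i, k) \<in> Y - {a}}" using True assms(2) by (cases a) auto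
    have "fst a \<notin> {i. (i, k) \<in> Y - {a}}" using True by (cases a) auto
    moreover have "finite {i. (i, k) \<in> Y - {a}}" using fin by (rule rev_finite_subset) auto
    ultimately show ?thesis using True unfolding column_length_def e by simp
  next
    case False
    then have "{i. (i, k) \<in> Y - {a}} = {i. (i, k) \<in> Y}" by (cases a) auto
    then show ?thesis using False unfolding column_length_def by simp
  qed
qed

lemma column_length_corner:
  assumes "young_set Y" "(r, c) \<in> Y" "(Suc r, c) \<notin> Y"
  shows "column_length Y c = Suc r"
  using young_set_column[OF assms(1)] assms(2,3) by (metis Suc_lessI)

lemma young_set_remove_corner:
  assumes "young_set Y" "young_set (Y - {(r, c)})" "(r, c) \<in> Y"
  shows "column_length Y c = Suc r" "column_length Y (Suc c) < column_length Y c"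
proof -
  have "(Suc r, c) \<notin> Y" using young_setD[OF assms(2), of "Suc r" c r c] by auto
  then show c: "column_length Y c = Suc r" using column_length_corner assms by blast
  have "(r, Suc c) \<notin> Y" using young_setD[OF assms(2), of r "Suc c" r c] by auto
  then show "column_length Y (Suc c) < column_length Y c"
    using young_set_column[OF assms(1), of r "Suc c"] c by simp
qed

text \<open>The witnesses c and d are the columns of \<open>a\<close> and \<open>b\<close>. If
  \<open>a\<close> is below \<open>b\<close>, then c = d. If \<open>a\<close> is to the right of
  \<open>b\<close>, columns d and d + 1 of \<open>Y\<close> have equal length, so d is not the
  column of a corner. If they are not adjacent, both \<open>a\<close> and \<open>b\<close> are
  corners of \<open>Y\<close>, and distinct corners lie in distinct columns.\<close>

lemma local_rule_of_removals:
  assumes Y: "young_set Y" and a: "a \<in> Y" "young_set (Y - {a})"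
    and b: "b \<in> Y - {a}" "young_set (Y - {a} - {b})" and Z: "young_set Z"
      "Z = (if next_square b a then Y - {a} else Y - {b})"
  shows "local_rule (column_length Y) (column_length (Y - {a})) (column_length Z) (column_length (Y - {a} - {b}))"
proof -
  obtain ra ca where ac: "a = (ra, ca)" by force
  obtain rb cb where bc: "b = (rb, cb)" by force
  note colA = young_set_remove_corner[OF Y a(2)[unfolded ac] a(1)[unfolded ac]]
  have b0: "(rb, cb) \<in> Y - {a}" "young_set (Y - {a} - {(rb, cb)})" using b bc by auto
  note colB = young_set_remove_corner[OF a(2) b0(2) b0(1)]
  have eqs: "\<forall>k. column_length Y k = column_length (Y - {a}) k + of_bool (k = snd a)"
    "\<forall>k. column_length (Y - {a}) k = column_length (Y - {a} - {b}) k + of_bool (k = snd b)"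
    using column_length_remove[OF Y a(1)] column_length_remove[OF a(2) b(1)] by auto
  show ?thesis
  proof (cases "next_square b a")
    case True
    have "ca = cb \<or> column_length Y cb \<le> column_length Y (Suc cb)"
    proof (cases "ca = cb")
      case False
      then have "ra = rb" "ca = Suc cb" using True unfolding next_square_def ac bc by auto
      then have "column_length Y (Suc cb) = Suc rb" using colA by simp
      moreover have "column_length Y cb = Suc rb" using colB(1) eqs(1) ac \<open>ca = Suc cb\<close> by simp
      ultimately show ?thesis by simp
    qed simp
    then show ?thesis unfolding local_rule_def using eqs Z(2) True ac bc by (intro exI[of _ ca] exI[of _ cb]) simp
  next
    case False
    then have Zb: "Z = Y - {b}" using Z by simp
    have bY: "b \<in> Y" using b by simp
    have b1: "young_set (Y - {(rb, cb)})" "(rb, cb) \<in> Y" using Z(1) Zb bc bY by auto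
    note colB' = young_set_remove_corner[OF Y b1]
    have "ca \<noteq> cb" using colA(1) colB'(1) b(1) ac bc by auto
    then show ?thesis unfolding local_rule_def
      using eqs colA(2) colB'(2) column_length_remove[OF Y bY] ac bc unfolding Zb
      by (intro exI[of _ ca] exI[of _ cb]) simp
  qed
qed

lemma young_diagram_young_set:
  assumes "is_partition lam"
  shows "young_set (young_diagram lam)"
proof (rule young_setI)
  have "young_diagram lam \<subseteq> (SIGMA i:{i. lam i \<noteq> 0}. {..<lam i})" unfolding young_diagram_def by auto
  then show "finite (young_diagram lam)" using assms finite_subset unfolding is_partition_def by blast
next
  fix i j i' j' assume "(i, j) \<in> young_diagram lam" "i' \<le> i" "j' \<le> j"
  then show "(i', j') \<in> young_diagram lam"
    using assms unfolding young_diagram_def is_partition_def by (auto dest: antimonoD[of lam i' i])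
qed

lemma partition_size_card:
  assumes "is_partition lam"
  shows "partition_size lam = card (young_diagram lam)"
proof -
  have "young_diagram lam = (SIGMA i:{i. lam i \<noteq> 0}. {..<lam i})" unfolding young_diagram_def by auto
  then show ?thesis using assms unfolding is_partition_def partition_size_def by simp
qed

definition row_lengths :: "(nat \<times> nat) set \<Rightarrow> nat \<Rightarrow> nat" where
  "row_lengths Y i = card {j. (i, j) \<in> Y}"

lemma shape_row_lengths: "shape T = row_lengths (dom T)"
  unfolding shape_def row_lengths_def ..

lemma row_lengths_young_diagram: "row_lengths (young_diagram lam) = lam"
  unfolding row_lengths_def young_diagram_def by simp

lemma in_swap_image: "(i, k) \<in> prod.swap ` Y \<longleftrightarrow> (k, i) \<in> Y"
  by force

lemma young_set_swap:
  assumes "young_set Y"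
  shows "young_set (prod.swap ` Y)"
proof (rule young_setI)
  show "finite (prod.swap ` Y)" using assms unfolding young_set_def by simp
  show "(i', j') \<in> prod.swap ` Y" if "(i, j) \<in> prod.swap ` Y" "i' \<le> i" "j' \<le> j" for i j i' j'
    using young_setD[OF assms, of j i j' i'] that unfolding in_swap_image by blast
qed

lemma young_set_row:
  assumes "young_set Y"
  shows "(i, k) \<in> Y \<longleftrightarrow> k < row_lengths Y i"
  using young_set_column[OF young_set_swap[OF assms], of k i]
  unfolding row_lengths_def column_length_def in_swap_image .

lemma young_diagram_row_lengths:
  assumes "young_set Y"
  shows "young_diagram (row_lengths Y) = Y"
  using young_set_row[OF assms] unfolding young_diagram_def by auto

lemma is_partition_row_lengths:
  assumes "young_set Y"
  shows "is_partition (row_lengths Y)"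
  unfolding is_partition_def
proof
  show "antimono (row_lengths Y)"
  proof (rule antimonoI)
    fix i i' :: nat assume "i \<le> i'"
    show "row_lengths Y i' \<le> row_lengths Y i"
    proof (rule ccontr)
      assume "\<not> row_lengths Y i' \<le> row_lengths Y i"
      then have "(i', row_lengths Y i) \<in> Y" unfolding young_set_row[OF assms] by simp
      then have "(i, row_lengths Y i) \<in> Y" using young_setD[OF assms] \<open>i \<le> i'\<close> by blast
      then show False unfolding young_set_row[OF assms] by simp
    qed
  qed
  have "{i. row_lengths Y i \<noteq> 0} \<subseteq> fst ` Y"
  proof
    fix i assume "i \<in> {i. row_lengths Y i \<noteq> 0}"
    then have "(i, 0) \<in> Y" unfolding young_set_row[OF assms] by simp
    then show "i \<in> fst ` Y" by (rule image_eqI[rotated]) simp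
  qed
  then show "finite {i. row_lengths Y i \<noteq> 0}"
    using assms finite_subset unfolding young_set_def by blast
qed

lemma partition_eqI:
  assumes "is_partition l" "is_partition m" "\<And>k. card {i. l i > k} = card {i. m i > k}"
  shows "l = m"
proof -
  have "column_length (young_diagram l) = column_length (young_diagram m)"
    using assms(3) unfolding column_length_def young_diagram_def by auto
  then have "young_diagram l = young_diagram m"
    using young_set_eqI young_diagram_young_set assms by blast
  then show ?thesis by (metis row_lengths_young_diagram)
qed

section \<open>Standard tableaux and growth diagrams\<close>

text \<open>Two comparable squares are joined by a path down a column and then along a row, which
  stays inside the diagram.\<close>

lemma tableau_increasing_filling:
  assumes "is_tableau lam T"
  shows "increasing_filling T"
proof -
  have Y: "young_set (dom T)" using assms young_diagram_young_set unfolding is_tableau_def by simp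
  have row: "the (T (i, j)) \<le> the (T (i, j + m))" if "(i, j + m) \<in> dom T" for i j m
    using that
  proof (induction m)
    case (Suc m)
    have "(i, j + m) \<in> dom T" using young_setD[OF Y Suc.prems, of i "j + m"] by simp
    then have "the (T (i, j)) \<le> the (T (i, j + m))" by (rule Suc.IH)
    also have "\<dots> < the (T (i, Suc (j + m)))" using Suc.prems assms unfolding is_tableau_def by (simp only: add_Suc_right)
    finally show ?case by simp
  qed simp
  have col: "the (T (i, j)) \<le> the (T (i + m, j))" if "(i + m, j) \<in> dom T" for i j m
    using that
  proof (induction m)
    case (Suc m)
    have "(i + m, j) \<in> dom T" using young_setD[OF Y Suc.prems, of "i + m" j] by simp
    then have "the (T (i, j)) \<le> the (T (i + m, j))" by (rule Suc.IH)
    also have "\<dots> < the (T (Suc (i + m), j))" using Suc.prems assms unfolding is_tableau_def by (simp only: add_Suc_right)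
    finally show ?case by simp
  qed simp
  show ?thesis unfolding increasing_filling_def
  proof (intro conjI allI impI)
    show inj: "inj_on T (dom T)" using assms unfolding is_tableau_def by blast
    fix i j i' j' x y
    assume T: "T (i, j) = Some x" "T (i', j') = Some y" and le: "i \<le> i'" "j \<le> j'" and ne: "(i, j) \<noteq> (i', j')"
    have i'j: "(i', j) \<in> dom T" using young_setD[OF Y, of i' j' i' j] le T(2) by blast
    have "the (T (i, j)) \<le> the (T (i', j))" using col[of i "i' - i" j] le i'j by simp
    also have "\<dots> \<le> the (T (i', j'))" using row[of i' j "j' - j"] le T(2) by auto
    finally have "x \<le> y" using T by simp
    moreover have "x \<noteq> y" using inj_onD[OF inj, of "(i, j)" "(i', j')"] T ne by (auto simp: domI)
    ultimately show "x < y" by simp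
  qed
qed

lemma standard_tableaux_iff:
  "T \<in> standard_tableaux lam \<longleftrightarrow>
     is_partition lam \<and> dom T = young_diagram lam \<and> is_filling T \<and> ran T = {..<card (dom T)}"
proof
  assume T: "T \<in> standard_tableaux lam"
  then have tab: "is_tableau lam T" and ran: "ran T = {..<partition_size lam}"
    unfolding standard_tableaux_def by auto
  have p: "is_partition lam" "dom T = young_diagram lam" using tab unfolding is_tableau_def by auto
  then show "is_partition lam \<and> dom T = young_diagram lam \<and> is_filling T \<and> ran T = {..<card (dom T)}"
    using tableau_increasing_filling[OF tab] ran young_diagram_young_set partition_size_card
    unfolding is_filling_def by simp
next
  assume a: "is_partition lam \<and> dom T = young_diagram lam \<and> is_filling T \<and> ran T = {..<card (dom T)}"
  then have Y: "young_set (dom T)" and inc: "increasing_filling T" unfolding is_filling_def by auto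
  have "the (T (i, j)) < the (T (i', j'))" if "(i', j') \<in> dom T" "i \<le> i'" "j \<le> j'" "(i, j) \<noteq> (i', j')" for i j i' j'
  proof -
    have "(i, j) \<in> dom T" using young_setD[OF Y] that by blast
    then obtain x where x: "T (i, j) = Some x" by blast
    from that(1) obtain y where "T (i', j') = Some y" by blast
    then show ?thesis using increasing_fillingD[OF inc x _ that(2-4)] x by simp
  qed
  then show "T \<in> standard_tableaux lam"
    using a inc partition_size_card unfolding standard_tableaux_def is_tableau_def increasing_filling_def
    by simp
qed

lemma remove_largest_power:
  assumes "ran T = {..<n}" "k \<le> n"
  shows "(remove_largest ^^ k) T = entries_below T (n - k)"
  using assms(2)
proof (induction k)
  case 0
  then show ?case using assms by (simp add: entries_below_ident)
next
  case (Suc k)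
  define m where "m = n - Suc k"
  have m: "n - k = Suc m" "m < n" using Suc.prems unfolding m_def by auto
  have "ran (entries_below T (Suc m)) = {..m}" unfolding ran_entries_below assms(1) using m by auto
  then have Max: "Max (ran (entries_below T (Suc m))) = m" by (auto intro!: Max_eqI)
  have "remove_largest (entries_below T (Suc m)) = entries_below T m"
    unfolding remove_largest_def Max by (rule ext) (auto simp: restrict_map_def entries_below_apply split: option.split)
  then show ?case using Suc m by (simp add: m_def)
qed

lemma shape_chain_eq:
  assumes "T \<in> standard_tableaux lam"
  shows "shape_chain T = map (\<lambda>k. row_lengths (dom (entries_below T (card (dom T) - k)))) [0..<Suc (card (dom T))]"
  using assms remove_largest_power[of T "card (dom T)"]
  unfolding shape_chain_def shape_row_lengths standard_tableaux_iff by simp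

text \<open>A saturated chain of diagrams \<open>Y 0 \<subset> \<dots> \<subset> Y n\<close> is the same thing as a standard tableau:
  the entry \<open>j\<close> is in the square \<open>Y (Suc j) - Y j\<close>.\<close>

locale diagram_chain =
  fixes Y :: "nat \<Rightarrow> (nat \<times> nat) set" and n :: nat
  assumes young: "j \<le> n \<Longrightarrow> young_set (Y j)"
    and mono_step: "j < n \<Longrightarrow> Y j \<subseteq> Y (Suc j)"
    and card_eq: "j \<le> n \<Longrightarrow> card (Y j) = j"
begin

lemma mono: "i \<le> j \<Longrightarrow> j \<le> n \<Longrightarrow> Y i \<subseteq> Y j"
proof (induction j)
  case (Suc j)
  then show ?case using mono_step[of j] by (cases "i = Suc j") auto
qed simp

lemma shape_chain_iff:
  assumes T: "T \<in> standard_tableaux (row_lengths (Y n))"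
  shows "shape_chain T = map (\<lambda>k. row_lengths (Y (n - k))) [0..<Suc n] \<longleftrightarrow>
    (\<forall>j\<le>n. dom (entries_below T j) = Y j)"
proof -
  have dom: "dom T = Y n" using T young_diagram_row_lengths[OF young] unfolding standard_tableaux_iff by simp
  then have card: "card (dom T) = n" using card_eq by simp
  have fil: "is_filling T" using T unfolding standard_tableaux_iff by simp
  have eq: "row_lengths (dom (entries_below T j)) = row_lengths (Y j) \<longleftrightarrow> dom (entries_below T j) = Y j"
    if "j \<le> n" for j
  proof -
    have "young_set (dom (entries_below T j))" using is_filling_entries_below[OF fil] unfolding is_filling_def by simp
    then show ?thesis using young_diagram_row_lengths young[OF that] by metis
  qed
  have "shape_chain T = map (\<lambda>k. row_lengths (Y (n - k))) [0..<Suc n] \<longleftrightarrow>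
    (\<forall>k\<le>n. row_lengths (dom (entries_below T (n - k))) = row_lengths (Y (n - k)))"
    unfolding shape_chain_eq[OF T] card map_eq_conv set_upt by (auto simp: less_Suc_eq_le)
  also have "\<dots> \<longleftrightarrow> (\<forall>j\<le>n. row_lengths (dom (entries_below T j)) = row_lengths (Y j))"
    by (metis diff_diff_cancel diff_le_self)
  finally show ?thesis using eq by blast
qed

lemma ex_tableau: "\<exists>T \<in> standard_tableaux (row_lengths (Y n)). \<forall>j\<le>n. dom (entries_below T j) = Y j"
proof -
  define T where "T = (\<lambda>s. if s \<in> Y n then Some (LEAST x. s \<in> Y (Suc x)) else None)"
  have fin: "finite (Y j)" if "j \<le> n" for j using young[OF that] unfolding young_set_def by simp
  have Y0: "Y 0 = {}" using card_eq[of 0] fin[of 0] by simp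
  have least: "(LEAST x. s \<in> Y (Suc x)) < j \<longleftrightarrow> s \<in> Y j" if s: "s \<in> Y n" and j: "j \<le> n" for s j
  proof
    assume "s \<in> Y j"
    then obtain j' where "j = Suc j'" using Y0 by (cases j) auto
    then show "(LEAST x. s \<in> Y (Suc x)) < j" using \<open>s \<in> Y j\<close> Least_le[of "\<lambda>x. s \<in> Y (Suc x)" j'] by simp
  next
    assume l: "(LEAST x. s \<in> Y (Suc x)) < j"
    obtain n' where "n = Suc n'" using s Y0 by (cases n) auto
    then have "s \<in> Y (Suc (LEAST x. s \<in> Y (Suc x)))" using s by (intro LeastI[of "\<lambda>x. s \<in> Y (Suc x)" n']) simp
    then show "s \<in> Y j" using mono[of "Suc (LEAST x. s \<in> Y (Suc x))" j] l j by auto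
  qed
  have dom: "dom T = Y n" unfolding T_def by (auto split: if_splits)
  have T_iff: "(\<exists>x<j. T s = Some x) \<longleftrightarrow> s \<in> Y j" if "j \<le> n" for s j
    using least[OF _ that, of s] mono[OF that] unfolding T_def by auto
  have below: "dom (entries_below T j) = Y j" if "j \<le> n" for j
    unfolding dom_entries_below using T_iff[OF that] by blast
  have val: "x < n \<and> s \<in> Y (Suc x) \<and> s \<notin> Y x" if "T s = Some x" for s x
  proof -
    have "s \<in> dom T" using that by (rule domI)
    then have "x < n" using T_iff[of n s] that dom by auto
    then show ?thesis using T_iff[of "Suc x" s] T_iff[of x s] that by auto
  qed
  have val': "T s = Some x" if "x < n" "s \<in> Y (Suc x)" "s \<notin> Y x" for s x
  proof -
    have "\<exists>y<Suc x. T s = Some y" using T_iff[of "Suc x" s] that by simp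
    then obtain y where y: "y < Suc x" "T s = Some y" by blast
    moreover have "\<not> y < x" using T_iff[of x s] that y by auto
    ultimately show ?thesis by (simp add: less_Suc_eq)
  qed
  have step_card: "card (Y (Suc x) - Y x) = 1" if "x < n" for x
    using card_Diff_subset[OF fin mono_step[OF that]] card_eq[of x] card_eq[of "Suc x"] that by simp
  have inc: "increasing_filling T" unfolding increasing_filling_def
  proof (intro conjI inj_onI allI impI)
    fix p q assume pq: "p \<in> dom T" "q \<in> dom T" "T p = T q"
    then obtain x where "T p = Some x" "T q = Some x" by (metis domD)
    then have "p \<in> Y (Suc x) - Y x" "q \<in> Y (Suc x) - Y x" "x < n" using val by auto
    then show "p = q" using step_card[of x] card_1_singletonE by (metis singletonD)
  next
    fix i j i' j' x y
    assume T: "T (i, j) = Some x" "T (i', j') = Some y" and le: "i \<le> i'" "j \<le> j'" and ne: "(i, j) \<noteq> (i', j')"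
    have y: "y < n" "(i', j') \<in> Y (Suc y) - Y y" using val[OF T(2)] by auto
    then have ij: "(i, j) \<in> Y (Suc y)" using young_setD[OF young[of "Suc y"], of i' j' i j] le by simp
    have "x \<noteq> y"
    proof
      assume "x = y"
      then have "(i, j) \<in> Y (Suc y) - Y y" using val[OF T(1)] by simp
      then show False using y step_card[of y] ne card_1_singletonE by (metis singletonD)
    qed
    moreover have "x < Suc y" using T_iff[of "Suc y" "(i, j)"] ij y T(1) by auto
    ultimately show "x < y" by simp
  qed
  have ran: "ran T = {..<n}"
  proof (rule subset_antisym; rule subsetI)
    fix x assume "x \<in> ran T"
    then obtain s where "T s = Some x" unfolding ran_def by blast
    then show "x \<in> {..<n}" using val by simp
  next
    fix x assume x: "x \<in> {..<n}"
    then have "card (Y (Suc x) - Y x) \<noteq> 0" using step_card[of x] by simp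
    then have "Y (Suc x) - Y x \<noteq> {}" by (metis card.empty)
    then obtain s where "s \<in> Y (Suc x) - Y x" by blast
    then have "T s = Some x" using val' x by simp
    then show "x \<in> ran T" by (rule ranI)
  qed
  have "T \<in> standard_tableaux (row_lengths (Y n))"
    unfolding standard_tableaux_iff is_filling_def dom
    using is_partition_row_lengths[OF young] young_diagram_row_lengths[OF young] young inc ran card_eq by simp
  then show ?thesis using below by blast
qed

lemma tableau_unique:
  assumes "\<forall>j\<le>n. dom (entries_below T j) = Y j" "\<forall>j\<le>n. dom (entries_below T' j) = Y j"
    and "ran T \<subseteq> {..<n}" "ran T' \<subseteq> {..<n}"
  shows "T = T'"
proof -
  have sub: "B s = Some x" if A: "A s = Some x" and ran: "ran A \<subseteq> {..<n}"
    and *: "\<forall>j\<le>n. dom (entries_below A j) = dom (entries_below B j)" for A B :: tableau and s x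
  proof -
    have "x \<in> ran A" using A by (rule ranI)
    then have xn: "x < n" using ran by auto
    have "s \<in> dom (entries_below A (Suc x))" "s \<notin> dom (entries_below A x)"
      unfolding dom_entries_below using A by auto
    then have "s \<in> dom (entries_below B (Suc x))" "s \<notin> dom (entries_below B x)" using * xn by simp_all
    then show ?thesis unfolding dom_entries_below by (auto simp: less_Suc_eq)
  qed
  show ?thesis
  proof
    fix s
    show "T s = T' s"
    proof (cases "T s")
      case (Some x)
      have "T' s = Some x" by (rule sub[OF Some assms(3)]) (simp add: assms(1,2))
      then show ?thesis using Some by simp
    next
      case None
      have "T' s \<noteq> Some x" for x using sub[of T' s x T] assms None by auto
      then have "T' s = None" by (cases "T' s") blast+
      then show ?thesis using None by simp
    qed
  qed
qed

text \<open>Makes the definite descriptions behind \<open>r_tableau\<close>,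
  \<open>q_tableau\<close> and \<open>evacuation\<close> usable: each turns into a condition on the
  diagrams occupied by the entries below j.\<close>

lemma the_tableau_eq_iff:
  assumes T: "T \<in> standard_tableaux (row_lengths (Y n))"
  shows "(THE T'. T' \<in> standard_tableaux (row_lengths (Y n)) \<and>
      shape_chain T' = map (\<lambda>k. row_lengths (Y (n - k))) [0..<Suc n]) = T \<longleftrightarrow>
    (\<forall>j\<le>n. dom (entries_below T j) = Y j)"
proof -
  define Q where "Q = (\<lambda>T'. T' \<in> standard_tableaux (row_lengths (Y n)) \<and>
      shape_chain T' = map (\<lambda>k. row_lengths (Y (n - k))) [0..<Suc n])"
  have Q_iff: "Q T' \<longleftrightarrow> T' \<in> standard_tableaux (row_lengths (Y n)) \<and> (\<forall>j\<le>n. dom (entries_below T' j) = Y j)" for T'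
    unfolding Q_def using shape_chain_iff[of T'] by (rule conj_cong[OF refl])
  have ran: "ran T' \<subseteq> {..<n}" if "T' \<in> standard_tableaux (row_lengths (Y n))" for T'
  proof -
    have "card (dom T') = n" using that young_diagram_row_lengths[OF young] card_eq unfolding standard_tableaux_iff by simp
    then show ?thesis using that unfolding standard_tableaux_iff by simp
  qed
  have "\<exists>R. Q R" unfolding Q_iff using ex_tableau unfolding Bex_def .
  then obtain R where R: "Q R" ..
  have unique: "A = B" if "Q A" "Q B" for A B
    using that unfolding Q_iff by (intro tableau_unique ran) simp_all
  have "The Q = R" using R unique by (intro the_equality) simp_all
  then have "The Q = T \<longleftrightarrow> Q T" using R unique by metis
  also have "Q T \<longleftrightarrow> (\<forall>j\<le>n. dom (entries_below T j) = Y j)" unfolding Q_iff using T by simp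
  finally show ?thesis unfolding Q_def .
qed

end

section \<open>The growth diagram of a tableau and evacuation\<close>

definition growth :: "tableau \<Rightarrow> nat \<Rightarrow> nat \<Rightarrow> (nat \<times> nat) set" where
  "growth T i j = dom (entries_below ((deflate ^^ i) T) j)"

context
  fixes T lam n
  assumes T: "T \<in> standard_tableaux lam" and n: "n = card (dom T)"
begin

lemma deflate_power:
  assumes "i \<le> n"
  shows "is_filling ((deflate ^^ i) T) \<and> ran ((deflate ^^ i) T) = {i..<n} \<and> card (dom ((deflate ^^ i) T)) = n - i"
  using assms
proof (induction i)
  case 0
  have "is_filling T" "ran T = {..<n}" using T unfolding standard_tableaux_iff n by blast+
  then show ?case unfolding funpow_0 n[symmetric] lessThan_atLeast0 diff_zero by blast
next
  case (Suc i)
  then have IH: "is_filling ((deflate ^^ i) T)" "ran ((deflate ^^ i) T) = {i..<n}" "card (dom ((deflate ^^ i) T)) = n - i"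
    and i: "i < n" by auto
  obtain h where h: "is_filling (deflate ((deflate ^^ i) T))" "ran (deflate ((deflate ^^ i) T)) = {Suc i..<n}"
    "h \<in> dom ((deflate ^^ i) T)" "dom (deflate ((deflate ^^ i) T)) = dom ((deflate ^^ i) T) - {h}"
    by (rule deflate_props[OF IH(1,2) i])
  have "card (dom (deflate ((deflate ^^ i) T))) = n - Suc i"
    unfolding h(4) card_Diff_singleton[OF h(3)] IH(3) by simp
  then show ?case unfolding funpow.simps(2) comp_def using h(1,2) by blast
qed

lemma growth_young: "i \<le> n \<Longrightarrow> young_set (growth T i j)"
  unfolding growth_def
  using is_filling_entries_below[OF conjunct1[OF deflate_power], of i j] unfolding is_filling_def by (rule conjunct1)

lemma growth_diagonal: "i \<le> n \<Longrightarrow> growth T i i = {}"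
proof -
  assume "i \<le> n"
  then have r: "ran ((deflate ^^ i) T) = {i..<n}" using deflate_power by blast
  have "s \<notin> growth T i i" for s
  proof
    assume "s \<in> growth T i i"
    then obtain x where x: "x < i" "(deflate ^^ i) T s = Some x" unfolding growth_def dom_entries_below by blast
    then show False using ranI[of "(deflate ^^ i) T" s x] unfolding r by simp
  qed
  then show ?thesis by blast
qed

lemma growth_last: "i \<le> n \<Longrightarrow> growth T i n = dom ((deflate ^^ i) T)"
proof -
  assume "i \<le> n"
  then have "ran ((deflate ^^ i) T) \<subseteq> {..<n}" using deflate_power[of i] by auto
  then show ?thesis unfolding growth_def by (simp only: entries_below_ident)
qed

lemma ran_entries_below_deflate_power:
  assumes "i \<le> n" "j \<le> n"
  shows "ran (entries_below ((deflate ^^ i) T) j) = {i..<j}"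
proof -
  have *: "ran ((deflate ^^ i) T) = {i..<n}" using deflate_power[OF assms(1)] by blast
  show ?thesis unfolding ran_entries_below * using assms(2) by auto
qed

text \<open>Large entries do not influence how small ones slide. Downward induction on j discards
  the largest entry each time, starting from j = n, where nothing is cut off.\<close>

lemma entries_below_deflate_power:
  assumes "i < j" "j \<le> n"
  shows "deflate (entries_below ((deflate ^^ i) T) j) = entries_below ((deflate ^^ Suc i) T) j"
  using assms(2,1)
proof (induction rule: inc_induct)
  case base
  have "ran ((deflate ^^ i) T) \<subseteq> {..<n}" "ran ((deflate ^^ Suc i) T) \<subseteq> {..<n}"
    using base deflate_power[of i] deflate_power[of "Suc i"] by auto
  then show ?case by (simp only: entries_below_ident funpow.simps(2) comp_def)
next
  case (step j)
  let ?S = "entries_below ((deflate ^^ i) T) (Suc j)"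
  have fil: "is_filling ?S" using is_filling_entries_below deflate_power[of i] step by simp
  have ran: "ran ?S = {i..<Suc j}" by (rule ran_entries_below_deflate_power) (use step in simp_all)
  have "entries_below (deflate ?S) j = deflate (entries_below ?S j)"
    by (rule deflate_entries_below[OF fil ran step.prems])
  then show ?case using step by (simp add: entries_below_entries_below)
qed

lemma growth_local_rule:
  assumes "i < j" "j < n"
  shows "local_rule (column_length (growth T i (Suc j))) (column_length (growth T i j))
    (column_length (growth T (Suc i) (Suc j))) (column_length (growth T (Suc i) j))"
proof -
  let ?S = "entries_below ((deflate ^^ i) T) (Suc j)"
  have fil: "is_filling ?S" using is_filling_entries_below deflate_power[of i] assms by simp
  have ran: "ran ?S = {i..<Suc j}" by (rule ran_entries_below_deflate_power) (use assms in simp_all)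
  have S: "entries_below ?S j = entries_below ((deflate ^^ i) T) j" by (simp add: entries_below_entries_below)
  have D: "deflate ?S = entries_below ((deflate ^^ Suc i) T) (Suc j)"
    "deflate (entries_below ((deflate ^^ i) T) j) = entries_below ((deflate ^^ Suc i) T) j"
    using entries_below_deflate_power[of i] assms by simp_all
  obtain a b where ab: "a \<in> dom ?S" "dom (entries_below ?S j) = dom ?S - {a}"
    "b \<in> dom ?S - {a}" "dom (deflate (entries_below ?S j)) = dom ?S - {a} - {b}"
    "dom (deflate ?S) = (if next_square b a then dom ?S - {a} else dom ?S - {b})"
    by (rule deflate_entries_below[OF fil ran assms(1)]) (rule that)
  have g: "dom ?S = growth T i (Suc j)" "dom (entries_below ?S j) = growth T i j"
    "dom (deflate (entries_below ?S j)) = growth T (Suc i) j" "dom (deflate ?S) = growth T (Suc i) (Suc j)"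
    unfolding growth_def S D by simp_all
  note ab' = ab[unfolded g]
  have y: "young_set (growth T i (Suc j))" "young_set (growth T i j)" "young_set (growth T (Suc i) j)"
    "young_set (growth T (Suc i) (Suc j))" using growth_young assms by simp_all
  show ?thesis unfolding ab'(2,4)
    by (rule local_rule_of_removals[OF y(1) ab'(1) y(2)[unfolded ab'(2)] ab'(3) y(3)[unfolded ab'(4)] y(4) ab'(5)])
qed

lemma evacuation_props:
  "evacuation T \<in> standard_tableaux lam \<and> (\<forall>j\<le>n. dom (entries_below (evacuation T) j) = growth T (n - j) n)"
proof -
  \<comment> \<open>The shapes of the iterated deflations shrink; the index is reversed because
    \<open>diagram_chain\<close> expects a growing chain.\<close>
  let ?Y = "\<lambda>j. dom ((deflate ^^ (n - j)) T)"
  have step: "dom ((deflate ^^ Suc i) T) \<subseteq> dom ((deflate ^^ i) T)" if i: "i < n" for i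
  proof -
    note i_power = deflate_power[OF less_imp_le[OF i]]
    obtain h where "dom (deflate ((deflate ^^ i) T)) = dom ((deflate ^^ i) T) - {h}"
      by (rule deflate_props[OF conjunct1[OF i_power] conjunct1[OF conjunct2[OF i_power]] i])
    then show ?thesis by auto
  qed
  interpret diagram_chain ?Y n
  proof
    fix j assume "j \<le> n"
    then show "young_set (?Y j)" using deflate_power[of "n - j"] unfolding is_filling_def by simp
    show "card (?Y j) = j" using deflate_power[of "n - j"] \<open>j \<le> n\<close> by simp
  next
    fix j assume "j < n"
    then have "n - j = Suc (n - Suc j)" "n - Suc j < n" by auto
    then show "?Y j \<subseteq> ?Y (Suc j)" using step[of "n - Suc j"] by simp
  qed
  have sh: "shape T = row_lengths (?Y n)" "lam = row_lengths (?Y n)"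
    using T row_lengths_young_diagram unfolding standard_tableaux_iff shape_row_lengths by simp_all
  have ch: "map (\<lambda>k. shape ((deflate ^^ k) T)) [0..<Suc (card (dom T))] =
    map (\<lambda>k. row_lengths (?Y (n - k))) [0..<Suc n]"
    unfolding shape_row_lengths n[symmetric] by (rule map_cong[OF refl]) auto
  obtain T' where T': "T' \<in> standard_tableaux (row_lengths (?Y n))" "\<forall>j\<le>n. dom (entries_below T' j) = ?Y j"
    using ex_tableau by blast
  have "evacuation T = T'" unfolding evacuation_def sh(1) ch using the_tableau_eq_iff[OF T'(1)] T'(2) by blast
  then show ?thesis using T' sh growth_last by simp
qed

end

section \<open>Jordan types of subquotients\<close>

locale nilpotent_operator = finite_dimensional_vector_space scale Basis
  for scale :: "'a::field \<Rightarrow> 'b::ab_group_add \<Rightarrow> 'b" (infixr \<open>*s\<close> 75) and Basis :: "'b set" +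
  fixes \<eta> :: "'b \<Rightarrow> 'b"
  assumes linear_\<eta>: "Vector_Spaces.linear scale scale \<eta>"
    and nilpotent: "\<exists>k. \<eta> ^^ k = (\<lambda>v. 0)"
begin

lemma \<eta>_add: "\<eta> (x + y) = \<eta> x + \<eta> y" and \<eta>_scale: "\<eta> (c *s x) = c *s \<eta> x"
  using linear_\<eta> unfolding Vector_Spaces.linear_iff by blast+

lemma power_add: "(\<eta> ^^ k) (x + y) = (\<eta> ^^ k) x + (\<eta> ^^ k) y"
  by (induction k) (simp_all add: \<eta>_add)

lemma power_scale: "(\<eta> ^^ k) (c *s x) = c *s (\<eta> ^^ k) x"
  by (induction k) (simp_all add: \<eta>_scale)

lemma power_zero [simp]: "(\<eta> ^^ k) 0 = 0"
  using power_scale[of k 0 0] by simp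

lemma power_neg: "(\<eta> ^^ k) (- x) = - (\<eta> ^^ k) x"
  using power_add[of k x "- x"] by (simp add: eq_neg_iff_add_eq_0 add.commute)

lemma power_diff: "(\<eta> ^^ k) (x - y) = (\<eta> ^^ k) x - (\<eta> ^^ k) y"
  using power_add[of k x "- y"] power_neg[of k y] by simp

lemma \<eta>_zero [simp]: "\<eta> 0 = 0" and \<eta>_diff: "\<eta> (x - y) = \<eta> x - \<eta> y"
  using power_zero[of 1] power_diff[of 1] by simp_all

lemma power_power: "(\<eta> ^^ j) ((\<eta> ^^ k) x) = (\<eta> ^^ (j + k)) x"
  by (simp add: funpow_add)

definition stable :: "'b set \<Rightarrow> bool" where
  "stable U \<longleftrightarrow> subspace U \<and> \<eta> ` U \<subseteq> U"

lemma stable_subspace: "stable U \<Longrightarrow> subspace U"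
  unfolding stable_def by simp

lemma stable_power: "stable U \<Longrightarrow> x \<in> U \<Longrightarrow> (\<eta> ^^ k) x \<in> U"
  unfolding stable_def by (induction k) auto

lemma subspace_diff_swap: "subspace U \<Longrightarrow> x - y \<in> U \<longleftrightarrow> y - x \<in> U"
  using subspace_neg by (metis minus_diff_eq)

text \<open>For a subspace \<open>U\<close> this is U + \<eta>^k W, the preimage in V of the image
  of \<eta>^k on W/U. Working with preimages avoids forming quotient spaces.\<close>

definition img :: "'b set \<Rightarrow> 'b set \<Rightarrow> nat \<Rightarrow> 'b set" where
  "img U W k = {x. \<exists>w\<in>W. x - (\<eta> ^^ k) w \<in> U}"

text \<open>By \<open>jordan_type_columns\<close> below, this is the length of column \<open>k\<close> of the Jordan type of the
  endomorphism induced on \<open>W / U\<close>.\<close>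

definition cols :: "'b set \<Rightarrow> 'b set \<Rightarrow> nat \<Rightarrow> nat" where
  "cols U W k = dim (img U W k) - dim (img U W (Suc k))"

lemma img_subspace:
  assumes "subspace U" "subspace W"
  shows "subspace (img U W k)"
proof (rule subspaceI)
  show "0 \<in> img U W k" unfolding img_def using subspace_0[OF assms(1)] subspace_0[OF assms(2)]
    by (intro CollectI bexI[of _ 0]) simp_all
next
  fix x y assume "x \<in> img U W k" "y \<in> img U W k"
  then obtain v w where vw: "v \<in> W" "w \<in> W" "x - (\<eta> ^^ k) v \<in> U" "y - (\<eta> ^^ k) w \<in> U" unfolding img_def by auto
  have "(x + y) - (\<eta> ^^ k) (v + w) = (x - (\<eta> ^^ k) v) + (y - (\<eta> ^^ k) w)" by (simp add: power_add)
  then have "(x + y) - (\<eta> ^^ k) (v + w) \<in> U" using subspace_add[OF assms(1) vw(3,4)] by (simp only:)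
  then show "x + y \<in> img U W k" unfolding img_def using subspace_add[OF assms(2) vw(1,2)] by blast
next
  fix c x assume "x \<in> img U W k"
  then obtain v where v: "v \<in> W" "x - (\<eta> ^^ k) v \<in> U" unfolding img_def by auto
  have "c *s x - (\<eta> ^^ k) (c *s v) = c *s (x - (\<eta> ^^ k) v)" by (simp add: power_scale scale_right_diff_distrib)
  then have "c *s x - (\<eta> ^^ k) (c *s v) \<in> U" using subspace_scale[OF assms(1) v(2)] by simp
  then show "c *s x \<in> img U W k" unfolding img_def using subspace_scale[OF assms(2) v(1)] by blast
qed

lemma img_supset: "subspace W \<Longrightarrow> U \<subseteq> img U W k"
  unfolding img_def using subspace_0[of W] by (auto intro!: bexI[of _ 0])

lemma power_in_img: "subspace U \<Longrightarrow> w \<in> W \<Longrightarrow> (\<eta> ^^ k) w \<in> img U W k"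
  unfolding img_def using subspace_0[of U] by (auto intro!: bexI[of _ w])

lemma img_0: "subspace U \<Longrightarrow> subspace W \<Longrightarrow> U \<subseteq> W \<Longrightarrow> img U W 0 = W"
proof
  assume a: "subspace U" "subspace W" "U \<subseteq> W"
  show "img U W 0 \<subseteq> W"
  proof
    fix x assume "x \<in> img U W 0"
    then obtain w where "w \<in> W" "x - w \<in> U" unfolding img_def by auto
    then show "x \<in> W" using a subspace_add[OF a(2), of "x - w" w] by auto
  qed
  show "W \<subseteq> img U W 0" using power_in_img[of U _ W 0] a by auto
qed

lemma img_Suc_subset: "stable W \<Longrightarrow> img U W (Suc k) \<subseteq> img U W k"
proof
  assume W: "stable W"
  fix x assume "x \<in> img U W (Suc k)"
  then obtain w where w: "w \<in> W" "x - (\<eta> ^^ Suc k) w \<in> U" unfolding img_def by auto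
  then have "\<eta> w \<in> W" "x - (\<eta> ^^ k) (\<eta> w) \<in> U" using W unfolding stable_def by (auto simp: funpow_swap1)
  then show "x \<in> img U W k" unfolding img_def by blast
qed

lemma img_antimono: "stable W \<Longrightarrow> j \<le> k \<Longrightarrow> img U W k \<subseteq> img U W j"
  using lift_Suc_antimono_le[of "img U W" j k] img_Suc_subset[of W U] by blast

lemma img_mono: "U \<subseteq> U' \<Longrightarrow> W \<subseteq> W' \<Longrightarrow> img U W k \<subseteq> img U' W' k"
  unfolding img_def by blast

lemma img_eventually: "\<exists>k. img U W k \<subseteq> U"
proof -
  obtain k where k: "\<eta> ^^ k = (\<lambda>v. 0)" using nilpotent by blast
  then show ?thesis unfolding img_def by (intro exI[of _ k]) auto
qed

lemma img_dim_mono: "stable U \<Longrightarrow> stable W \<Longrightarrow> dim (img U W (Suc k)) \<le> dim (img U W k)"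
  by (intro dim_subset img_Suc_subset)

lemma codim_one_decompose:
  assumes "subspace A" "subspace B" "A \<subseteq> B" "dim B = dim A + 1" "v \<in> B" "v \<notin> A" "x \<in> B"
  obtains c where "x - c *s v \<in> A"
proof -
  have A: "span A = A" using assms(1) by (simp add: span_eq_iff)
  have "span (insert v A) = B"
  proof (rule subspace_dim_equal)
    show "span (insert v A) \<subseteq> B" using assms by (intro span_minimal) auto
    show "dim B \<le> dim (span (insert v A))" using assms(4,6) unfolding dim_span dim_insert A by simp
  qed (use assms in auto)
  then show thesis using that assms(7) span_breakdown_eq[of x v A] A by auto
qed

lemma dim_extend_one:
  assumes "subspace A" "subspace B" "A \<subseteq> B" "v \<in> B" "v \<notin> A" "\<And>x. x \<in> B \<Longrightarrow> \<exists>c. x - c *s v \<in> A"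
  shows "dim B = dim A + 1"
proof -
  have A: "span A = A" using assms(1) by (simp add: span_eq_iff)
  have "B \<subseteq> span (insert v A)" using assms(6) span_breakdown_eq[of _ v A] A by auto
  moreover have "span (insert v A) \<subseteq> B" using assms by (intro span_minimal) auto
  ultimately have "dim B = dim (insert v A)" by (metis dim_span subset_antisym)
  then show ?thesis using assms(5) A by (simp add: dim_insert)
qed

lemma codim_one_ex:
  assumes "subspace A" "subspace B" "A \<subseteq> B" "dim B = dim A + 1"
  obtains v where "v \<in> B" "v \<notin> A"
  using assms by (metis Suc_eq_plus1 n_not_Suc_n subsetI subset_antisym)

text \<open>(M + \<eta>^k W)/(U + \<eta>^k W) is a quotient of the line M/U, so it is either zero or
  a line.\<close>

lemma dim_img_line:
  assumes "stable U" "stable M" "stable W" "U \<subseteq> M" "dim M = dim U + 1"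
  shows "dim (img M W k) = dim (img U W k) + of_bool (\<not> M \<subseteq> img U W k)"
proof (cases "M \<subseteq> img U W k")
  note sub = stable_subspace[OF assms(1)] stable_subspace[OF assms(2)] stable_subspace[OF assms(3)]
  case True
  have "img M W k \<subseteq> img U W k"
  proof
    fix x assume "x \<in> img M W k"
    then obtain w where w: "w \<in> W" "x - (\<eta> ^^ k) w \<in> M" unfolding img_def by auto
    then have "(x - (\<eta> ^^ k) w) + (\<eta> ^^ k) w \<in> img U W k"
      using True power_in_img[OF sub(1) w(1)] by (intro subspace_add[OF img_subspace[OF sub(1,3)]]) auto
    then show "x \<in> img U W k" by simp
  qed
  then have "img M W k = img U W k" using img_mono[OF assms(4), of W W k] by blast
  then show ?thesis using True by simp
next
  note sub = stable_subspace[OF assms(1)] stable_subspace[OF assms(2)] stable_subspace[OF assms(3)]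
  case False
  then obtain v where v: "v \<in> M" "v \<notin> img U W k" by blast
  then have vU: "v \<notin> U" using img_supset[OF sub(3), of U k] by blast
  have "dim (img M W k) = dim (img U W k) + 1"
  proof (rule dim_extend_one[OF img_subspace[OF sub(1,3)] img_subspace[OF sub(2,3)] img_mono[OF assms(4) order_refl]])
    show "v \<in> img M W k" using v(1) img_supset[OF sub(3), of M k] by blast
    show "v \<notin> img U W k" by (rule v(2))
    fix x assume "x \<in> img M W k"
    then obtain w where w: "w \<in> W" "x - (\<eta> ^^ k) w \<in> M" unfolding img_def by auto
    obtain c where "(x - (\<eta> ^^ k) w) - c *s v \<in> U"
      by (rule codim_one_decompose[OF sub(1,2) assms(4,5) v(1) vU w(2)])
    then have "(x - c *s v) - (\<eta> ^^ k) w \<in> U" by (simp add: algebra_simps)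
    then show "\<exists>c. x - c *s v \<in> img U W k" using w(1) unfolding img_def by blast
  qed
  then show ?thesis using False by simp
qed

text \<open>The column that shrinks is the depth c of the line M/U, the largest exponent with
  \<open>M\<close> inside U + \<eta>^c W: replacing \<open>U\<close> by \<open>M\<close> raises the
  dimension of \<open>img\<close> by one exactly for k > c, and taking consecutive differences
  leaves only k = c.\<close>

lemma cols_line:
  assumes "stable U" "stable M" "stable W" "U \<subseteq> M" "dim M = dim U + 1"
    and "M \<subseteq> img U W c" "\<not> M \<subseteq> img U W (Suc c)"
  shows "cols U W k = cols M W k + of_bool (k = c)"
proof -
  have iff: "M \<subseteq> img U W k \<longleftrightarrow> k \<le> c" for k
    using assms(6,7) img_antimono[OF assms(3), of k c U] img_antimono[OF assms(3), of "Suc c" k U]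
    by (meson not_less_eq_eq subset_trans)
  have d: "dim (img M W k) = dim (img U W k) + of_bool (c < k)" for k
    unfolding dim_img_line[OF assms(1-5)] iff by (simp add: not_le)
  have le: "dim (img M W (Suc k)) \<le> dim (img M W k)" for k by (rule img_dim_mono[OF assms(2,3)])
  show ?thesis unfolding cols_def using d[of k] d[of "Suc k"] le[of k] by (auto simp: of_bool_def split: if_splits)
qed

lemma cols_line_ex:
  assumes "stable U" "stable M" "stable W" "U \<subseteq> M" "M \<subseteq> W" "dim M = dim U + 1"
  obtains c where "M \<subseteq> img U W c" "\<not> M \<subseteq> img U W (Suc c)"
proof -
  note sub = stable_subspace[OF assms(1)] stable_subspace[OF assms(3)]
  have 0: "M \<subseteq> img U W 0" using img_0[OF sub] assms by auto
  obtain k where "img U W k \<subseteq> U" using img_eventually by blast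
  moreover have "\<not> M \<subseteq> U" using assms(4,6) by (metis Suc_eq_plus1 n_not_Suc_n subset_antisym)
  ultimately have "\<not> M \<subseteq> img U W k" by blast
  with 0 show thesis using that by (induction k) auto
qed

definition pre :: "'b set \<Rightarrow> 'b set \<Rightarrow> nat \<Rightarrow> 'b set" where
  "pre U W k = {x \<in> W. (\<eta> ^^ k) x \<in> U}"

lemma pre_mono: "stable U \<Longrightarrow> j \<le> k \<Longrightarrow> pre U W j \<subseteq> pre U W k"
proof
  fix x assume a: "stable U" "j \<le> k" "x \<in> pre U W j"
  then have "(\<eta> ^^ j) x \<in> U" unfolding pre_def by simp
  then have "(\<eta> ^^ (k - j)) ((\<eta> ^^ j) x) \<in> U" by (rule stable_power[OF a(1)])
  then show "x \<in> pre U W k" using a unfolding pre_def power_power by simp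
qed

text \<open>\<open>pre U W k\<close> represents the kernel of \<eta>^k on W/U. If it reaches outside
  \<open>H\<close>, every vector of \<open>W\<close> can be moved into \<open>H\<close> by an
  element of the kernel, and the images of \<open>W\<close> and \<open>H\<close> coincide. Otherwise
  \<eta>^k v is new for a vector v of \<open>W\<close> outside \<open>H\<close>.\<close>

lemma dim_img_hyperplane:
  assumes "stable U" "stable H" "stable W" "H \<subseteq> W" "dim W = dim H + 1"
  shows "dim (img U W k) = dim (img U H k) + of_bool (pre U W k \<subseteq> H)"
proof (cases "pre U W k \<subseteq> H")
  note sub = stable_subspace[OF assms(1)] stable_subspace[OF assms(2)] stable_subspace[OF assms(3)]
  case True
  obtain v where v: "v \<in> W" "v \<notin> H" by (rule codim_one_ex[OF sub(2,3) assms(4,5)])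
  have "dim (img U W k) = dim (img U H k) + 1"
  proof (rule dim_extend_one[OF img_subspace[OF sub(1,2)] img_subspace[OF sub(1,3)] img_mono[OF order_refl assms(4)]])
    show "(\<eta> ^^ k) v \<in> img U W k" by (rule power_in_img[OF sub(1) v(1)])
    show "(\<eta> ^^ k) v \<notin> img U H k"
    proof
      assume "(\<eta> ^^ k) v \<in> img U H k"
      then obtain h where h: "h \<in> H" "(\<eta> ^^ k) v - (\<eta> ^^ k) h \<in> U" unfolding img_def by auto
      then have "v - h \<in> pre U W k" unfolding pre_def using v assms(4) subspace_diff[OF sub(3)] by (auto simp: power_diff)
      then have "v - h \<in> H" using True by blast
      then show False using subspace_add[OF sub(2) _ h(1)] v(2) by fastforce
    qed
    fix x assume "x \<in> img U W k"
    then obtain w where w: "w \<in> W" "x - (\<eta> ^^ k) w \<in> U" unfolding img_def by auto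
    obtain c where "w - c *s v \<in> H" by (rule codim_one_decompose[OF sub(2,3) assms(4,5) v w(1)])
    moreover have "(x - c *s (\<eta> ^^ k) v) - (\<eta> ^^ k) (w - c *s v) \<in> U"
      using w(2) by (simp add: power_diff power_scale)
    ultimately show "\<exists>c. x - c *s (\<eta> ^^ k) v \<in> img U H k" unfolding img_def by blast
  qed
  then show ?thesis using True by simp
next
  note sub = stable_subspace[OF assms(1)] stable_subspace[OF assms(2)] stable_subspace[OF assms(3)]
  case False
  then obtain v where v: "v \<in> W" "v \<notin> H" "(\<eta> ^^ k) v \<in> U" unfolding pre_def by blast
  have "img U W k \<subseteq> img U H k"
  proof
    fix x assume "x \<in> img U W k"
    then obtain w where w: "w \<in> W" "x - (\<eta> ^^ k) w \<in> U" unfolding img_def by auto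
    obtain c where c: "w - c *s v \<in> H" by (rule codim_one_decompose[OF sub(2,3) assms(4,5) v(1,2) w(1)])
    have "x - (\<eta> ^^ k) (w - c *s v) = (x - (\<eta> ^^ k) w) + c *s (\<eta> ^^ k) v" by (simp add: power_diff power_scale)
    then have "x - (\<eta> ^^ k) (w - c *s v) \<in> U" using subspace_add[OF sub(1) w(2) subspace_scale[OF sub(1) v(3)]] by (simp only:)
    then show "x \<in> img U H k" using c unfolding img_def by blast
  qed
  then have "img U W k = img U H k" using img_mono[OF order_refl assms(4), of U k] by blast
  then show ?thesis using False by simp
qed

text \<open>Dual to \<open>cols_line\<close>, with kernels in place of images: c + 1 is the least
  exponent for which the power of \<eta> sends a vector of \<open>W\<close> outside \<open>H\<close>
  into \<open>U\<close>.\<close>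

lemma cols_hyperplane:
  assumes "stable U" "stable H" "stable W" "H \<subseteq> W" "dim W = dim H + 1"
    and "pre U W c \<subseteq> H" "\<not> pre U W (Suc c) \<subseteq> H"
  shows "cols U W k = cols U H k + of_bool (k = c)"
proof -
  have iff: "pre U W k \<subseteq> H \<longleftrightarrow> k \<le> c" for k
    using assms(6,7) pre_mono[OF assms(1), of k c W] pre_mono[OF assms(1), of "Suc c" k W]
    by (meson not_less_eq_eq subset_trans)
  have d: "dim (img U W k) = dim (img U H k) + of_bool (k \<le> c)" for k
    unfolding dim_img_hyperplane[OF assms(1-5)] iff ..
  have le: "dim (img U H (Suc k)) \<le> dim (img U H k)" for k by (rule img_dim_mono[OF assms(1,2)])
  show ?thesis unfolding cols_def using d[of k] d[of "Suc k"] le[of k] by (auto simp: of_bool_def split: if_splits)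
qed

lemma cols_hyperplane_ex:
  assumes "stable U" "stable H" "stable W" "U \<subseteq> H" "H \<subseteq> W" "dim W = dim H + 1"
  obtains c where "pre U W c \<subseteq> H" "\<not> pre U W (Suc c) \<subseteq> H"
proof -
  have 0: "pre U W 0 \<subseteq> H" using assms(4) unfolding pre_def by auto
  obtain k where k: "\<eta> ^^ k = (\<lambda>v. 0)" using nilpotent by blast
  then have "pre U W k = W" unfolding pre_def using subspace_0[OF stable_subspace[OF assms(1)]] by auto
  moreover have "\<not> W \<subseteq> H" using assms(5,6) by (metis Suc_eq_plus1 n_not_Suc_n subset_antisym)
  ultimately have "\<not> pre U W k \<subseteq> H" by blast
  with 0 show thesis using that by (induction k) auto
qed

text \<open>Vectors of \<open>A'\<close> that are independent modulo \<open>A\<close> have images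
  independent modulo \<open>B\<close>. So a basis of \<open>A\<close> is extended to one of
  \<open>A'\<close>, and the images of the added vectors are adjoined to \<open>B\<close> one at a
  time, each raising the dimension.\<close>

lemma quotient_dim_le:
  assumes sub: "subspace A" "subspace A'" "subspace B" "subspace B'" and inc: "A \<subseteq> A'" "B \<subseteq> B'"
    and map: "\<And>x. x \<in> A' \<Longrightarrow> \<eta> x \<in> B'" and inj: "\<And>x. x \<in> A' \<Longrightarrow> \<eta> x \<in> B \<Longrightarrow> x \<in> A"
  shows "dim A' - dim A \<le> dim B' - dim B"
proof -
  obtain E where E: "E \<subseteq> A" "independent E" "A \<subseteq> span E" "card E = dim A" using basis_exists[of A] by blast
  obtain F where F: "E \<subseteq> F" "F \<subseteq> A'" "independent F" "A' \<subseteq> span F"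
    using maximal_independent_subset_extend[of E A'] E inc by blast
  have finF: "finite F" "finite E" using F E finiteI_independent by auto
  have "card F = dim A'" using basis_card_eq_dim[OF F(2,4,3)] .
  then have cardD: "card (F - E) = dim A' - dim A" using F(1) finF E(4) by (simp add: card_Diff_subset)
  have spanE: "span E = A" using E span_minimal[OF E(1) sub(1)] by blast
  have "dim (span (B \<union> \<eta> ` D)) = dim B + card D" if "D \<subseteq> F - E" for D
    using finite_subset[OF that] finF that
  proof (induction D rule: infinite_finite_induct)
    case empty
    then show ?case by simp
  next
    case (insert x D)
    have "\<eta> x \<notin> span (B \<union> \<eta> ` D)"
    proof
      assume "\<eta> x \<in> span (B \<union> \<eta> ` D)"
      then obtain b y where bz: "\<eta> x = b + y" "b \<in> span B" "y \<in> span (\<eta> ` D)" unfolding span_Un by auto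
      have bB: "b \<in> B" using bz(2) sub(3) by (metis span_eq_iff)
      have "span (\<eta> ` D) = \<eta> ` span D"
      proof -
        interpret Vector_Spaces.linear scale scale \<eta> by (rule linear_\<eta>)
        show ?thesis by (rule span_image)
      qed
      then obtain z where z: "y = \<eta> z" "z \<in> span D" using bz(3) by auto
      have zA': "z \<in> A'" using z(2) insert.prems F(2) span_minimal[OF _ sub(2), of D] by blast
      have xA': "x \<in> A'" using insert.prems F(2) by auto
      have "\<eta> (x - z) \<in> B" using bz(1) z(1) bB by (simp add: \<eta>_diff)
      then have "x - z \<in> A" using inj subspace_diff[OF sub(2) xA' zA'] by blast
      then have "x - z \<in> span (F - {x})" using spanE span_mono[of E "F - {x}"] F(1) insert.prems by auto
      moreover have "z \<in> span (F - {x})" using z(2) span_mono[of D "F - {x}"] insert by auto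
      ultimately have "(x - z) + z \<in> span (F - {x})" by (rule span_add)
      then show False using F(3) insert.prems unfolding dependent_def by auto
    qed
    then show ?case using insert by (simp add: dim_insert)
  qed simp
  from this[of "F - E"] have "dim (span (B \<union> \<eta> ` (F - E))) = dim B + (dim A' - dim A)" using cardD by simp
  moreover have "span (B \<union> \<eta> ` (F - E)) \<subseteq> B'" using map F(2) inc by (intro span_minimal[OF _ sub(4)]) auto
  ultimately show ?thesis using dim_subset[of "span (B \<union> \<eta> ` (F - E))" B'] by simp
qed

text \<open>The vector \<open>u\<close> heads a Jordan block of size exactly d + 1 of W/U. Without
  such a vector, \<eta> would map the quotient of \<open>img U W d\<close> by
  \<open>img U W (Suc d)\<close> injectively to the next such quotient, contrary to the strict drop
  of the column lengths.\<close>

lemma cols_descent_vector: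
  assumes "stable U" "stable W" "cols U W (Suc d) < cols U W d"
  obtains (vector) u where "u \<in> W" "(\<eta> ^^ Suc d) u \<in> U" "(\<eta> ^^ d) u \<notin> img U W (Suc d)"
proof (rule ccontr)
  assume no: "\<not> thesis"
  have *: "(\<eta> ^^ d) u \<in> img U W (Suc d)" if u: "u \<in> W" "(\<eta> ^^ Suc d) u \<in> U" for u
    using vector[OF u] no by blast
  note sub = stable_subspace[OF assms(1)] stable_subspace[OF assms(2)]
  have "cols U W d \<le> cols U W (Suc d)" unfolding cols_def
  proof (rule quotient_dim_le)
    show "subspace (img U W (Suc d))" "subspace (img U W d)" "subspace (img U W (Suc (Suc d)))"
      "subspace (img U W (Suc d))" using img_subspace[OF sub] by auto
    show "img U W (Suc d) \<subseteq> img U W d" "img U W (Suc (Suc d)) \<subseteq> img U W (Suc d)" using img_Suc_subset[OF assms(2)] by auto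
  next
    fix x assume "x \<in> img U W d"
    then obtain w where w: "w \<in> W" "x - (\<eta> ^^ d) w \<in> U" unfolding img_def by auto
    have "\<eta> (x - (\<eta> ^^ d) w) \<in> U" using w assms(1) unfolding stable_def by blast
    then have e: "\<eta> x - (\<eta> ^^ Suc d) w \<in> U" by (simp add: \<eta>_diff)
    then show "\<eta> x \<in> img U W (Suc d)" using w(1) unfolding img_def by blast
    assume "\<eta> x \<in> img U W (Suc (Suc d))"
    then obtain z where z: "z \<in> W" "\<eta> x - (\<eta> ^^ Suc (Suc d)) z \<in> U" unfolding img_def by auto
    \<comment> \<open>With \<open>w - \<eta> z\<close> in place of \<open>w\<close>, the vector is
      sent into \<open>U\<close> by \<eta>^(d+1), so that fact \<open>*\<close> applies to it; the
      term \<eta>^(d+1) z lost in the exchange is in the smaller image anyway.\<close>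
    have "(\<eta> ^^ Suc d) (w - \<eta> z) = (\<eta> x - (\<eta> ^^ Suc (Suc d)) z) - (\<eta> x - (\<eta> ^^ Suc d) w)"
      using power_power[of "Suc d" 1 z] by (simp add: power_diff \<eta>_diff)
    then have "(\<eta> ^^ Suc d) (w - \<eta> z) \<in> U" using subspace_diff[OF sub(1) z(2) e] by simp
    moreover have wz: "w - \<eta> z \<in> W" using subspace_diff[OF sub(2) w(1)] z(1) assms(2) unfolding stable_def by blast
    ultimately have "(\<eta> ^^ d) (w - \<eta> z) \<in> img U W (Suc d)" using * by blast
    moreover have "(\<eta> ^^ Suc d) z \<in> img U W (Suc d)" by (rule power_in_img[OF sub(1) z(1)])
    moreover have "x - (\<eta> ^^ d) w \<in> img U W (Suc d)" using w(2) img_supset[OF sub(2), of U "Suc d"] by blast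
    ultimately have "(\<eta> ^^ d) (w - \<eta> z) + (\<eta> ^^ Suc d) z + (x - (\<eta> ^^ d) w) \<in> img U W (Suc d)"
      by (intro subspace_add[OF img_subspace[OF sub]])
    moreover have "(\<eta> ^^ d) (w - \<eta> z) + (\<eta> ^^ Suc d) z + (x - (\<eta> ^^ d) w) = x"
      using power_power[of d 1 z] by (simp add: power_diff)
    ultimately show "x \<in> img U W (Suc d)" by simp
  qed
  then show False using assms(3) by simp
qed

lemma ex_functional:
  assumes "subspace A" "v \<notin> A"
  obtains \<phi> where "Vector_Spaces.linear scale (*) \<phi>" "\<phi> v = 1" "\<And>x. x \<in> A \<Longrightarrow> \<phi> x = 0"
proof -
  obtain E where E: "E \<subseteq> A" "independent E" "A \<subseteq> span E" by (rule basis_exists[of A])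
  interpret vector_space_pair scale "(*) :: 'a \<Rightarrow> 'a \<Rightarrow> 'a"
    by unfold_locales (auto simp: algebra_simps)
  have "span E = A" using E span_minimal[OF E(1) assms(1)] by blast
  then have ind: "independent (insert v E)" using assms(2) E(2) by (intro independent_insertI) auto
  obtain \<phi> where \<phi>: "Vector_Spaces.linear scale (*) \<phi>" "\<forall>x\<in>insert v E. \<phi> x = (if x = v then 1 else 0)"
    using linear_independent_extend[OF ind, of "\<lambda>x. if x = v then 1 else 0"] by blast
  have "\<phi> x = 0" if "x \<in> A" for x
  proof -
    have "v \<notin> E" using E(1) assms(2) by blast
    then have "\<And>x. x \<in> E \<Longrightarrow> \<phi> x = 0" using \<phi>(2) by auto
    then show ?thesis using linear_eq_0_on_span[OF \<phi>(1), of E x] that E(3) by auto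
  qed
  then show thesis using that[of \<phi>] \<phi> by simp
qed

end

section \<open>Jordan bases of subquotients\<close>

fun block_pos :: "nat list \<Rightarrow> nat \<Rightarrow> nat" where
  "block_pos [] j = 0"
| "block_pos (n # ns) j = (if j < n then j else block_pos ns (j - n))"

lemma block_pos_0 [simp]: "block_pos ns 0 = 0"
  by (induction ns) auto

lemma block_pos_le: "block_pos ns j \<le> j"
proof (induction ns arbitrary: j)
  case (Cons n ns)
  then show ?case using le_trans[OF Cons diff_le_self[of j n]] by simp
qed simp

text \<open>\<open>block_pos ns j\<close> is the offset of index j inside its block, so a shift to
  the left by at most that offset stays in the block. Indices beyond the last block have offset 0 by
  default.\<close>

lemma block_pos_diff: "k \<le> block_pos ns j \<Longrightarrow> block_pos ns (j - k) = block_pos ns j - k"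
proof (induction ns arbitrary: j)
  case (Cons n ns)
  show ?case
  proof (cases "j < n")
    case True
    then show ?thesis using Cons.prems by auto
  next
    case False
    then have k: "k \<le> block_pos ns (j - n)" using Cons.prems by simp
    then have "k \<le> j - n" using block_pos_le[of ns "j - n"] by simp
    show ?thesis
    proof (cases "j - k < n")
      case True
      then have "j - n = k" using \<open>k \<le> j - n\<close> by simp
      moreover have "block_pos ns (j - n) \<le> j - n" by (rule block_pos_le)
      ultimately have "block_pos ns (j - n) = k" "j - k = n" using k False by auto
      then show ?thesis using True by simp
    next
      case F: False
      then have "block_pos (n # ns) (j - k) = block_pos ns (j - n - k)" by (simp add: diff_right_commute add.commute)
      then show ?thesis using Cons.IH[OF k] False by simp
    qed
  qed
qed simp

lemma jordan_matrix_index: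
  assumes "i < sum_list ns" "j < sum_list ns"
  shows "jordan_matrix (map (\<lambda>n. (n, 0 :: 'a :: {zero, one})) ns) $$ (i, j) =
    (if Suc i = j \<and> block_pos ns j \<noteq> 0 then 1 else 0)"
  using assms
proof (induction ns arbitrary: i j)
  case (Cons n ns)
  let ?J = "jordan_matrix (map (\<lambda>n. (n, 0 :: 'a)) ns)"
  have dim: "dim_row ?J = sum_list ns" "dim_col ?J = sum_list ns" by (simp_all add: comp_def)
  have J: "jordan_matrix (map (\<lambda>n. (n, 0 :: 'a)) (n # ns)) =
    four_block_mat (jordan_block n 0) (0\<^sub>m n (sum_list ns)) (0\<^sub>m (sum_list ns) n) ?J"
    using dim unfolding jordan_matrix_def by (simp add: Let_def)
  have e: "jordan_matrix (map (\<lambda>n. (n, 0 :: 'a)) (n # ns)) $$ (i, j) =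
    (if i < n then if j < n then jordan_block n 0 $$ (i, j) else 0\<^sub>m n (sum_list ns) $$ (i, j - n)
      else if j < n then 0\<^sub>m (sum_list ns) n $$ (i - n, j) else ?J $$ (i - n, j - n))"
    unfolding J using Cons.prems by (subst index_mat_four_block(1)) (simp_all add: dim comp_def)
  show ?case
  proof (cases "i < n \<or> j < n")
    case True
    then show ?thesis unfolding e using Cons.prems by (auto simp: le_less_Suc_eq)
  next
    case False
    then have "?J $$ (i - n, j - n) = (if Suc (i - n) = j - n \<and> block_pos ns (j - n) \<noteq> 0 then 1 else 0)"
      using Cons.prems by (intro Cons.IH) auto
    then show ?thesis unfolding e using False by auto
  qed
qed simp

text \<open>Every block longer than k contains exactly one index of offset k, the others contain
  none. This is how block sizes turn into column lengths.\<close>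

lemma card_block_pos_eq: "card {j. j < sum_list ns \<and> block_pos ns j = k} = length (filter (\<lambda>n. k < n) ns)"
proof (induction ns)
  case (Cons n ns)
  let ?A = "{j. j < sum_list ns \<and> block_pos ns j = k}"
  have "{j. j < sum_list (n # ns) \<and> block_pos (n # ns) j = k} = (if k < n then {k} else {}) \<union> (+) n ` ?A" (is "?L = ?R")
  proof (rule subset_antisym; rule subsetI)
    fix j assume j: "j \<in> ?L"
    show "j \<in> ?R"
    proof (cases "j < n")
      case True
      then show ?thesis using j by auto
    next
      case False
      then have "j - n \<in> ?A" "j = n + (j - n)" using j by auto
      then show ?thesis by blast
    qed
  qed (auto split: if_splits)
  moreover have "card ((if k < n then {k} else {}) \<union> (+) n ` ?A) = of_bool (k < n) + card ?A"
  proof (subst card_Un_disjoint)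
    show "card (if k < n then {k} else {}) + card ((+) n ` ?A) = of_bool (k < n) + card ?A"
      by (simp add: card_image)
  qed auto
  ultimately show ?case using Cons by simp
qed simp

lemma sum_lessThan_split: "(\<Sum>i<m + n. g i) = (\<Sum>i<m. g i) + (\<Sum>i<n. g (m + i :: nat) :: 'a :: comm_monoid_add)"
  by (induction n) (simp_all add: add.assoc)

context nilpotent_operator
begin

text \<open>The ones of \<open>jordan_matrix\<close> stand above the diagonal, so modulo
  \<open>U\<close> the operator sends a basis vector to its predecessor in the block and the first
  vector of a block to 0.\<close>

definition jordan_basis :: "'b set \<Rightarrow> 'b set \<Rightarrow> nat list \<Rightarrow> 'b list \<Rightarrow> bool" where
  "jordan_basis U W ns ws \<longleftrightarrow> quotient_basis U W ws \<and> length ws = sum_list ns \<and>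
     (\<forall>j < length ws. \<eta> (ws ! j) - (if block_pos ns j = 0 then 0 else ws ! (j - 1)) \<in> U)"

lemma jordan_matrix_column:
  assumes "length ws = sum_list ns" "j < length ws"
  shows "(\<Sum>i<length ws. (jordan_matrix (map (\<lambda>n. (n, 0)) ns) $$ (i, j)) *s (ws ! i)) =
    (if block_pos ns j = 0 then 0 else ws ! (j - 1))"
proof -
  have "(\<Sum>i<length ws. (jordan_matrix (map (\<lambda>n. (n, 0)) ns) $$ (i, j)) *s (ws ! i)) =
    (\<Sum>i<length ws. if i = j - 1 then (if block_pos ns j = 0 then 0 else ws ! (j - 1)) else 0)"
  proof (rule sum.cong[OF refl])
    fix i assume "i \<in> {..<length ws}"
    then have "jordan_matrix (map (\<lambda>n. (n, 0 :: 'a)) ns) $$ (i, j) = (if Suc i = j \<and> block_pos ns j \<noteq> 0 then 1 else 0)"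
      using assms by (intro jordan_matrix_index) auto
    then show "(jordan_matrix (map (\<lambda>n. (n, 0)) ns) $$ (i, j)) *s (ws ! i) =
      (if i = j - 1 then (if block_pos ns j = 0 then 0 else ws ! (j - 1)) else 0)" by (cases j) auto
  qed
  also have "\<dots> = (if block_pos ns j = 0 then 0 else ws ! (j - 1))"
    using assms(2) by (subst sum.delta) auto
  finally show ?thesis .
qed

lemma quotient_matrix_jordan_iff:
  assumes "length ws = sum_list ns"
  shows "quotient_matrix \<eta> U ws (jordan_matrix (map (\<lambda>n. (n, 0)) ns)) \<longleftrightarrow>
    (\<forall>j < length ws. \<eta> (ws ! j) - (if block_pos ns j = 0 then 0 else ws ! (j - 1)) \<in> U)"
proof -
  have "jordan_matrix (map (\<lambda>n. (n, 0 :: 'a)) ns) \<in> carrier_mat (length ws) (length ws)"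
    using jordan_matrix_carrier[of "map (\<lambda>n. (n, 0 :: 'a)) ns"] assms by (simp add: comp_def)
  then show ?thesis unfolding quotient_matrix_def using jordan_matrix_column[OF assms] by auto
qed

lemma \<eta>_sum: "\<eta> (\<Sum>i\<in>I. g i) = (\<Sum>i\<in>I. \<eta> (g i))"
  by (induction I rule: infinite_finite_induct) (simp_all add: \<eta>_add)

text \<open>Turns the matrix similarity inside \<open>jordan_nf\<close> into an actual change of
  basis of W/U; the columns of \<open>P\<close> are the coordinates of the new basis.\<close>

lemma quotient_basis_change:
  assumes U: "subspace U" and qb: "quotient_basis U W ws" and qm: "quotient_matrix \<eta> U ws A"
    and m: "m = length ws" and PQ: "P \<in> carrier_mat m m" "Q \<in> carrier_mat m m" "P * Q = 1\<^sub>m m" "Q * P = 1\<^sub>m m"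
    and J: "J \<in> carrier_mat m m" "A = P * J * Q"
  defines "vs \<equiv> map (\<lambda>j. \<Sum>i<m. (P $$ (i, j)) *s (ws ! i)) [0..<m]"
  shows "quotient_basis U W vs \<and> quotient_matrix \<eta> U vs J"
proof -
  have len: "length vs = m" unfolding vs_def by simp
  have vs: "vs ! j = (\<Sum>i<m. (P $$ (i, j)) *s (ws ! i))" if "j < m" for j using that unfolding vs_def by simp
  \<comment> \<open>Taking \<open>R\<close> to be \<open>Q\<close>, a single column, or
    \<open>J\<close> yields spanning, independence and the matrix of \<eta>, respectively.\<close>
  have comb: "(\<Sum>j<m. (R $$ (j, l)) *s (vs ! j)) = (\<Sum>i<m. ((P * R) $$ (i, l)) *s (ws ! i))"
    if R: "R \<in> carrier_mat m k" and l: "l < k" for R k l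
  proof -
    have "(\<Sum>j<m. (R $$ (j, l)) *s (vs ! j)) = (\<Sum>j<m. \<Sum>i<m. (R $$ (j, l) * P $$ (i, j)) *s (ws ! i))"
      by (rule sum.cong) (simp_all add: vs scale_sum_right)
    also have "\<dots> = (\<Sum>i<m. \<Sum>j<m. (R $$ (j, l) * P $$ (i, j)) *s (ws ! i))" by (rule sum.swap)
    also have "\<dots> = (\<Sum>i<m. ((P * R) $$ (i, l)) *s (ws ! i))"
    proof (rule sum.cong[OF refl])
      fix i assume i: "i \<in> {..<m}"
      have "(P * R) $$ (i, l) = (\<Sum>j<m. R $$ (j, l) * P $$ (i, j))"
        using i R l PQ(1) by (simp add: scalar_prod_def lessThan_atLeast0 mult.commute)
      then show "(\<Sum>j<m. (R $$ (j, l) * P $$ (i, j)) *s (ws ! i)) = ((P * R) $$ (i, l)) *s (ws ! i)"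
        by (simp add: scale_sum_left)
    qed
    finally show ?thesis .
  qed
  have ws: "ws ! l = (\<Sum>j<m. (Q $$ (j, l)) *s (vs ! j))" if l: "l < m" for l
  proof -
    have "(\<Sum>j<m. (Q $$ (j, l)) *s (vs ! j)) = (\<Sum>i<m. (if i = l then ws ! i else 0))"
      unfolding comb[OF PQ(2) l] PQ(3) using l by (intro sum.cong) auto
    then show ?thesis using l by simp
  qed
  have "span (U \<union> set vs) = W"
  proof -
    have "set vs \<subseteq> span (U \<union> set ws)"
    proof
      fix x assume "x \<in> set vs"
      then obtain j where "j < m" "x = vs ! j" using len by (auto simp: in_set_conv_nth)
      then have x: "x = (\<Sum>i<m. (P $$ (i, j)) *s (ws ! i))" using vs by simp
      show "x \<in> span (U \<union> set ws)" unfolding x by (intro span_sum span_scale span_base) (simp add: m)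
    qed
    moreover have "set ws \<subseteq> span (U \<union> set vs)"
    proof
      fix x assume "x \<in> set ws"
      then obtain l where "l < m" "x = ws ! l" using m by (auto simp: in_set_conv_nth)
      then have x: "x = (\<Sum>j<m. (Q $$ (j, l)) *s (vs ! j))" using ws by simp
      show "x \<in> span (U \<union> set vs)" unfolding x by (intro span_sum span_scale span_base) (simp add: len)
    qed
    moreover have "U \<subseteq> span (U \<union> set ws)" "U \<subseteq> span (U \<union> set vs)" using span_base by auto
    ultimately have "span (U \<union> set vs) = span (U \<union> set ws)"
      by (intro subset_antisym span_minimal) auto
    then show ?thesis using qb unfolding quotient_basis_def by simp
  qed
  moreover have "\<forall>i<m. c i = 0" if c: "(\<Sum>i<m. c i *s (vs ! i)) \<in> U" for c
  proof -
    define R where "R = mat m 1 (\<lambda>(i, _). c i)"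
    have R: "R \<in> carrier_mat m 1" unfolding R_def by simp
    have "(\<Sum>i<m. c i *s (vs ! i)) = (\<Sum>j<m. (R $$ (j, 0)) *s (vs ! j))" unfolding R_def by (intro sum.cong) auto
    also have "\<dots> = (\<Sum>i<m. ((P * R) $$ (i, 0)) *s (ws ! i))" by (rule comb[OF R]) simp
    finally have "\<forall>i<m. (P * R) $$ (i, 0) = 0" using c qb m unfolding quotient_basis_def by auto
    then have PR: "P * R = 0\<^sub>m m 1" using PQ(1) R by (intro eq_matI) auto
    have "R = (Q * P) * R" using PQ(4) R by simp
    also have "\<dots> = Q * (P * R)" by (rule assoc_mult_mat[OF PQ(2,1) R])
    also have "\<dots> = 0\<^sub>m m 1" unfolding PR using PQ(2) by simp
    finally have "R $$ (i, 0) = 0" if "i < m" for i using that by simp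
    then show ?thesis unfolding R_def by simp
  qed
  moreover have "\<eta> (vs ! j) - (\<Sum>i<m. (J $$ (i, j)) *s (vs ! i)) \<in> U" if j: "j < m" for j
  proof -
    have A: "A \<in> carrier_mat m m" using qm m unfolding quotient_matrix_def by simp
    have "A * P = P * J"
    proof -
      have "A * P = (P * J) * (Q * P)" unfolding J(2)
        using PQ(1,2) J(1) by (intro assoc_mult_mat[of _ m m _ m _ m]) auto
      then show ?thesis unfolding PQ(4) using PQ(1) J(1) by simp
    qed
    then have e1: "(\<Sum>i<m. (J $$ (i, j)) *s (vs ! i)) = (\<Sum>i<m. ((A * P) $$ (i, j)) *s (ws ! i))"
      using comb[OF J(1) j] by simp
    have "(\<Sum>i<m. ((A * P) $$ (i, j)) *s (ws ! i)) = (\<Sum>i<m. \<Sum>k<m. (P $$ (k, j) * A $$ (i, k)) *s (ws ! i))"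
    proof (rule sum.cong[OF refl])
      fix i assume i: "i \<in> {..<m}"
      have "(A * P) $$ (i, j) = (\<Sum>k<m. P $$ (k, j) * A $$ (i, k))"
        using i j A PQ(1) by (simp add: scalar_prod_def lessThan_atLeast0 mult.commute)
      then show "((A * P) $$ (i, j)) *s (ws ! i) = (\<Sum>k<m. (P $$ (k, j) * A $$ (i, k)) *s (ws ! i))"
        by (simp add: scale_sum_left)
    qed
    also have "\<dots> = (\<Sum>k<m. (P $$ (k, j)) *s (\<Sum>i<m. (A $$ (i, k)) *s (ws ! i)))"
      by (subst sum.swap) (simp add: scale_sum_right)
    finally have "\<eta> (vs ! j) - (\<Sum>i<m. (J $$ (i, j)) *s (vs ! i)) =
      (\<Sum>k<m. (P $$ (k, j)) *s (\<eta> (ws ! k) - (\<Sum>i<m. (A $$ (i, k)) *s (ws ! i))))"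
      unfolding e1 vs[OF j] \<eta>_sum by (simp add: \<eta>_scale scale_right_diff_distrib sum_subtractf)
    also have "\<dots> \<in> U" using qm m unfolding quotient_matrix_def
      by (intro subspace_sum[OF U] subspace_scale[OF U]) auto
    finally show ?thesis .
  qed
  ultimately show ?thesis unfolding quotient_basis_def quotient_matrix_def len using J(1) by blast
qed

lemma jordan_basis_power:
  assumes U: "stable U" and jb: "jordan_basis U W ns ws" and j: "j < length ws"
  shows "(\<eta> ^^ k) (ws ! j) - (if block_pos ns j < k then 0 else ws ! (j - k)) \<in> U"
proof (induction k)
  case 0
  then show ?case using subspace_0[OF stable_subspace[OF U]] by simp
next
  case (Suc k)
  let ?x = "if block_pos ns j < k then 0 else ws ! (j - k)"
  let ?y = "if block_pos ns j < Suc k then 0 else ws ! (j - Suc k)"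
  have "\<eta> ((\<eta> ^^ k) (ws ! j) - ?x) \<in> U" using Suc U unfolding stable_def by blast
  moreover have "\<eta> ?x - ?y \<in> U"
  proof (cases "block_pos ns j < k")
    case True
    then show ?thesis using subspace_0[OF stable_subspace[OF U]] by simp
  next
    case False
    then have "block_pos ns (j - k) = block_pos ns j - k" by (intro block_pos_diff) simp
    moreover have "\<eta> (ws ! (j - k)) - (if block_pos ns (j - k) = 0 then 0 else ws ! (j - k - 1)) \<in> U"
      using jb j unfolding jordan_basis_def by (meson diff_le_self le_less_trans)
    ultimately show ?thesis using False by (auto split: if_splits)
  qed
  ultimately have "\<eta> ((\<eta> ^^ k) (ws ! j) - ?x) + (\<eta> ?x - ?y) \<in> U" by (rule subspace_add[OF stable_subspace[OF U]])
  moreover have "\<eta> ((\<eta> ^^ k) (ws ! j) - ?x) + (\<eta> ?x - ?y) = (\<eta> ^^ Suc k) (ws ! j) - ?y"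
    by (simp only: \<eta>_diff funpow.simps comp_def) simp
  ultimately show ?case by simp
qed

lemma dim_span_quotient_basis:
  assumes U: "subspace U" and qb: "quotient_basis U W ws" and I: "I \<subseteq> {..<length ws}"
  shows "dim (span (U \<union> (!) ws ` I)) = dim U + card I"
proof -
  have "finite I" using I finite_subset by blast
  then show ?thesis using I
  proof (induction I)
    case empty
    then show ?case by simp
  next
    case (insert i I)
    let ?m = "length ws"
    \<comment> \<open>These are the vectors with coordinates modulo \<open>U\<close> supported in
      \<open>I\<close>. The set contains the span so far, but by independence modulo
      \<open>U\<close> not the next basis vector.\<close>
    define S where "S = {x. \<exists>c. (\<forall>j. j \<notin> I \<longrightarrow> c j = 0) \<and> x - (\<Sum>j<?m. c j *s (ws ! j)) \<in> U}"
    have "subspace S"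
    proof (rule subspaceI)
      show "0 \<in> S" unfolding S_def using subspace_0[OF U] by (intro CollectI exI[of _ "\<lambda>_. 0"]) simp
    next
      fix x y assume "x \<in> S" "y \<in> S"
      then obtain c d where cd: "\<forall>j. j \<notin> I \<longrightarrow> c j = 0" "x - (\<Sum>j<?m. c j *s (ws ! j)) \<in> U"
        "\<forall>j. j \<notin> I \<longrightarrow> d j = 0" "y - (\<Sum>j<?m. d j *s (ws ! j)) \<in> U" unfolding S_def by blast
      have "(x + y) - (\<Sum>j<?m. (c j + d j) *s (ws ! j)) = (x - (\<Sum>j<?m. c j *s (ws ! j))) + (y - (\<Sum>j<?m. d j *s (ws ! j)))"
        by (simp add: scale_left_distrib sum.distrib)
      then have "(x + y) - (\<Sum>j<?m. (c j + d j) *s (ws ! j)) \<in> U" using subspace_add[OF U cd(2,4)] by (simp only:)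
      then show "x + y \<in> S" unfolding S_def using cd(1,3) by (intro CollectI exI[of _ "\<lambda>j. c j + d j"]) simp
    next
      fix a x assume "x \<in> S"
      then obtain c where c: "\<forall>j. j \<notin> I \<longrightarrow> c j = 0" "x - (\<Sum>j<?m. c j *s (ws ! j)) \<in> U" unfolding S_def by blast
      have "a *s x - (\<Sum>j<?m. (a * c j) *s (ws ! j)) = a *s (x - (\<Sum>j<?m. c j *s (ws ! j)))"
        by (simp add: scale_right_diff_distrib scale_sum_right)
      then have "a *s x - (\<Sum>j<?m. (a * c j) *s (ws ! j)) \<in> U" using subspace_scale[OF U c(2)] by (simp only:)
      then show "a *s x \<in> S" unfolding S_def using c(1) by (intro CollectI exI[of _ "\<lambda>j. a * c j"]) simp
    qed
    moreover have "U \<subseteq> S" unfolding S_def by (intro subsetI CollectI exI[of _ "\<lambda>_. 0"]) simp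
    moreover have "ws ! j \<in> S" if "j \<in> I" for j
    proof -
      have "(\<Sum>k<?m. (if k = j then 1 else 0) *s (ws ! k)) = (\<Sum>k<?m. if k = j then ws ! k else 0)" by (intro sum.cong) auto
      also have "\<dots> = ws ! j" using that insert.prems by auto
      finally show ?thesis unfolding S_def using that subspace_0[OF U]
        by (intro CollectI exI[of _ "\<lambda>k. if k = j then 1 else 0"]) auto
    qed
    ultimately have sub: "span (U \<union> (!) ws ` I) \<subseteq> S" by (intro span_minimal) auto
    have "ws ! i \<notin> span (U \<union> (!) ws ` I)"
    proof
      assume "ws ! i \<in> span (U \<union> (!) ws ` I)"
      then obtain c where c: "\<forall>j. j \<notin> I \<longrightarrow> c j = 0" "ws ! i - (\<Sum>j<?m. c j *s (ws ! j)) \<in> U"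
        using sub unfolding S_def by blast
      have im: "i < ?m" using insert.prems by simp
      have "(\<Sum>j<?m. (of_bool (j = i) - c j) *s (ws ! j)) = (\<Sum>j<?m. if j = i then ws ! j else 0) - (\<Sum>j<?m. c j *s (ws ! j))"
        by (simp add: scale_left_diff_distrib sum_subtractf of_bool_def if_distrib[of "\<lambda>a. a *s _"] cong: if_cong)
      also have "\<dots> = ws ! i - (\<Sum>j<?m. c j *s (ws ! j))" using im by simp
      finally have "(\<Sum>j<?m. (of_bool (j = i) - c j) *s (ws ! j)) \<in> U" using c(2) by simp
      then have "of_bool (i = i) - c i = 0"
        using qb im unfolding quotient_basis_def by (auto dest!: spec[of _ "\<lambda>j. of_bool (j = i) - c j"])
      then show False using c(1) insert.hyps by simp
    qed
    then show ?case using insert by (simp add: dim_insert)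
  qed
qed

text \<open>U + \<eta>^k W is spanned by \<open>U\<close> and the basis vectors
  \<open>ws ! (j - k)\<close> for which j has offset at least k. Raising k by one loses one
  dimension for each index of offset exactly k, hence for each block longer than k.\<close>

lemma cols_jordan_basis:
  assumes U: "stable U" and jb: "jordan_basis U W ns ws"
  shows "cols U W k = length (filter (\<lambda>n. k < n) ns)"
proof -
  let ?m = "length ws"
  note subU = stable_subspace[OF U]
  have qb: "quotient_basis U W ws" and m: "?m = sum_list ns" using jb unfolding jordan_basis_def by auto
  have W: "W = span (U \<union> set ws)" using qb unfolding quotient_basis_def by simp
  have subW: "subspace W" unfolding W by (rule subspace_span)
  have wsW: "ws ! j \<in> W" if "j < ?m" for j unfolding W using that by (intro span_base) auto
  have dim: "dim (img U W k) = dim U + card {j. j < ?m \<and> k \<le> block_pos ns j}" for k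
  proof -
    let ?I = "(\<lambda>j. j - k) ` {j. j < ?m \<and> k \<le> block_pos ns j}"
    have "img U W k = span (U \<union> (!) ws ` ?I)"
    proof (rule subset_antisym)
      let ?S = "span (U \<union> (!) ws ` ?I)"
      have US: "U \<subseteq> ?S" using span_base by auto
      have "subspace {w. (\<eta> ^^ k) w \<in> ?S}"
        by (intro subspaceI) (auto simp: power_add power_scale span_add span_scale span_zero)
      moreover have "U \<subseteq> {w. (\<eta> ^^ k) w \<in> ?S}" using stable_power[OF U] US by blast
      moreover have "set ws \<subseteq> {w. (\<eta> ^^ k) w \<in> ?S}"
      proof
        fix x assume "x \<in> set ws"
        then obtain j where j: "j < ?m" "x = ws ! j" by (auto simp: in_set_conv_nth)
        let ?y = "if block_pos ns j < k then 0 else ws ! (j - k)"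
        have "?y \<in> ?S" using j span_zero by (auto intro!: span_base)
        moreover have "(\<eta> ^^ k) x - ?y \<in> ?S" using jordan_basis_power[OF U jb j(1), of k] j(2) US by blast
        ultimately have "((\<eta> ^^ k) x - ?y) + ?y \<in> ?S" by (intro span_add)
        then show "x \<in> {w. (\<eta> ^^ k) w \<in> ?S}" by simp
      qed
      ultimately have "W \<subseteq> {w. (\<eta> ^^ k) w \<in> ?S}" unfolding W by (intro span_minimal) auto
      then have WS: "(\<eta> ^^ k) w \<in> ?S" if "w \<in> W" for w using that by blast
      show "img U W k \<subseteq> ?S"
      proof
        fix x assume "x \<in> img U W k"
        then obtain w where w: "w \<in> W" "x - (\<eta> ^^ k) w \<in> U" unfolding img_def by blast
        then have "(x - (\<eta> ^^ k) w) + (\<eta> ^^ k) w \<in> ?S" using WS US by (intro span_add) auto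
        then show "x \<in> ?S" by simp
      qed
      have "ws ! (j - k) \<in> img U W k" if "j < ?m" "k \<le> block_pos ns j" for j
      proof -
        have "(\<eta> ^^ k) (ws ! j) - ws ! (j - k) \<in> U" using jordan_basis_power[OF U jb that(1), of k] that(2) by simp
        then have "ws ! (j - k) - (\<eta> ^^ k) (ws ! j) \<in> U" using subspace_diff_swap[OF subU] by blast
        then show ?thesis unfolding img_def using wsW[OF that(1)] by blast
      qed
      then show "?S \<subseteq> img U W k"
        using img_supset[OF subW, of U k] by (intro span_minimal img_subspace subU subW) auto
    qed
    moreover have "?I \<subseteq> {..<?m}" by auto
    moreover have "inj_on (\<lambda>j. j - k) {j. j < ?m \<and> k \<le> block_pos ns j}"
    proof (rule inj_onI)
      fix i j assume ij: "i \<in> {j. j < ?m \<and> k \<le> block_pos ns j}" "j \<in> {j. j < ?m \<and> k \<le> block_pos ns j}" "i - k = j - k"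
      then have "k \<le> i" "k \<le> j" using block_pos_le[of ns i] block_pos_le[of ns j] by auto
      then show "i = j" using ij(3) by simp
    qed
    ultimately show ?thesis using dim_span_quotient_basis[OF subU qb, of ?I] by (simp add: card_image)
  qed
  have "{j. j < ?m \<and> k \<le> block_pos ns j} = {j. j < ?m \<and> Suc k \<le> block_pos ns j} \<union> {j. j < ?m \<and> block_pos ns j = k}"
    by auto
  then have "card {j. j < ?m \<and> k \<le> block_pos ns j} =
    card {j. j < ?m \<and> Suc k \<le> block_pos ns j} + card {j. j < ?m \<and> block_pos ns j = k}"
    by (simp add: card_Un_disjoint disjoint_iff)
  then show ?thesis unfolding cols_def dim using card_block_pos_eq[of ns k] m by simp
qed


lemma functional_linear:
  assumes "Vector_Spaces.linear scale (*) \<phi>"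
  shows "\<phi> 0 = 0" "\<phi> (x + y) = \<phi> x + \<phi> y" "\<phi> (x - y) = \<phi> x - \<phi> y" "\<phi> (c *s x) = c * \<phi> x"
    "\<phi> (\<Sum>i\<in>I. g i) = (\<Sum>i\<in>I. \<phi> (g i))"
proof -
  show add: "\<phi> (x + y) = \<phi> x + \<phi> y" and scale: "\<phi> (c *s x) = c * \<phi> x" for x y c
    using assms unfolding Vector_Spaces.linear_iff by blast+
  show zero: "\<phi> 0 = 0" using scale[of 0 0] by simp
  show "\<phi> (x - y) = \<phi> x - \<phi> y" using add[of "x - y" y] by simp
  show "\<phi> (\<Sum>i\<in>I. g i) = (\<Sum>i\<in>I. \<phi> (g i))"
    by (induction I rule: infinite_finite_induct) (simp_all add: add zero)
qed

lemma power_sum: "(\<eta> ^^ k) (\<Sum>i\<in>I. g i) = (\<Sum>i\<in>I. (\<eta> ^^ k) (g i))"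
  by (induction I rule: infinite_finite_induct) (simp_all add: power_add)

text \<open>Split off a Jordan block of maximal size: if \<open>\<phi>\<close> vanishes on \<open>U\<close> but not on \<open>\<eta>\<^sup>d h\<close>, a
  complement of the block generated by \<open>h\<close> consists of all \<open>y\<close> with \<open>\<phi> (\<eta>\<^sup>k y) = 0\<close> for all \<open>k\<close>.\<close>

lemma ex_jordan_basis:
  assumes "stable U" "stable W" "U \<subseteq> W"
  shows "\<exists>ns ws. jordan_basis U W ns ws \<and> sorted_wrt (\<ge>) ns \<and> 0 \<notin> set ns \<and>
    (\<forall>N. (\<eta> ^^ N) ` W \<subseteq> U \<longrightarrow> (\<forall>n\<in>set ns. n \<le> N))"
  using assms(2,3)
proof (induction "dim W" arbitrary: W rule: less_induct)
  case less
  note subU = stable_subspace[OF assms(1)] and subW = stable_subspace[OF less.prems(1)]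
  show ?case
  proof (cases "W = U")
    case True
    then have "jordan_basis U W [] []" unfolding jordan_basis_def quotient_basis_def
      using subU by (simp add: span_eq_iff)
    then show ?thesis by (intro exI[of _ "[]"]) simp
  next
    case False
    obtain N where N: "\<eta> ^^ N = (\<lambda>v. 0)" using nilpotent by blast
    then have "(\<eta> ^^ N) ` W \<subseteq> U" using subspace_0[OF subU] by auto
    moreover have "\<not> (\<eta> ^^ 0) ` W \<subseteq> U" using False less.prems by auto
    ultimately obtain d where d: "\<not> (\<eta> ^^ d) ` W \<subseteq> U" "(\<eta> ^^ Suc d) ` W \<subseteq> U"
      by (induction N) auto
    then obtain h where h: "h \<in> W" "(\<eta> ^^ d) h \<notin> U" by blast
    have big: "(\<eta> ^^ k) y \<in> U" if "d < k" "y \<in> W" for k y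
    proof -
      have "(\<eta> ^^ (k - Suc d)) ((\<eta> ^^ Suc d) y) \<in> U" by (rule stable_power[OF assms(1)]) (use d(2) that(2) in blast)
      then show ?thesis using that(1) unfolding power_power by simp
    qed
    obtain \<phi> where \<phi>: "Vector_Spaces.linear scale (*) \<phi>" "\<phi> ((\<eta> ^^ d) h) = 1" "\<And>x. x \<in> U \<Longrightarrow> \<phi> x = 0"
      by (rule ex_functional[OF subU h(2)]) (rule that)
    note lin = functional_linear[OF \<phi>(1)]
    define K where "K = {y \<in> W. \<forall>k. \<phi> ((\<eta> ^^ k) y) = 0}"
    have subK: "subspace K"
    proof (rule subspaceI)
      show "0 \<in> K" unfolding K_def using subspace_0[OF subW] lin(1) by simp
      show "x + y \<in> K" if "x \<in> K" "y \<in> K" for x y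
        using that subspace_add[OF subW] unfolding K_def by (simp add: power_add lin(2))
      show "c *s x \<in> K" if "x \<in> K" for c x
        using that subspace_scale[OF subW] unfolding K_def by (simp add: power_scale lin(4))
    qed
    have "\<eta> y \<in> K" if "y \<in> K" for y
    proof -
      have "\<eta> y \<in> W" using that less.prems(1) unfolding K_def stable_def by blast
      moreover have "\<phi> ((\<eta> ^^ k) (\<eta> y)) = 0" for k
      proof -
        have "\<phi> ((\<eta> ^^ Suc k) y) = 0" using that unfolding K_def by blast
        then show ?thesis by (simp add: funpow_swap1)
      qed
      ultimately show ?thesis unfolding K_def by blast
    qed
    then have stK: "stable K" using subK unfolding stable_def by blast
    have UK: "U \<subseteq> K"
    proof
      fix x assume "x \<in> U"
      then show "x \<in> K" unfolding K_def using less.prems(2) \<phi>(3)[OF stable_power[OF assms(1)]] by auto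
    qed
    have KW: "K \<subseteq> W" unfolding K_def by blast
    have "h \<notin> K" using \<phi>(2) unfolding K_def by (auto intro!: exI[of _ d])
    then have "K \<subset> W" using KW h(1) by blast
    moreover have "span K = K" "span W = W" using subK subW by (simp_all only: span_eq_iff)
    ultimately have "span K \<subset> span W" by (simp only:)
    then have "dim K < dim W" by (rule dim_psubset)
    from less.hyps[OF this stK UK] obtain ns ws where
      ns: "jordan_basis U K ns ws" "sorted_wrt (\<ge>) ns" "0 \<notin> set ns" "\<forall>N. (\<eta> ^^ N) ` K \<subseteq> U \<longrightarrow> (\<forall>n\<in>set ns. n \<le> N)"
      by (elim exE conjE) (rule that)
    define us where "us = map (\<lambda>l. (\<eta> ^^ (d - l)) h) [0..<Suc d]"
    have us: "length us = Suc d" "us ! l = (\<eta> ^^ (d - l)) h" if "l \<le> d" for l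
      using that unfolding us_def by (simp_all del: upt_Suc add: nth_map)
    have len: "length us = Suc d" unfolding us_def by simp
    have usW: "set us \<subseteq> W" unfolding us_def by (auto simp del: upt_Suc intro: stable_power[OF less.prems(1) h(1)])
    have spanK: "span (U \<union> set ws) = K" using ns(1) unfolding jordan_basis_def quotient_basis_def by simp
    have span: "span (U \<union> set (us @ ws)) = W"
    proof (rule subset_antisym)
      have "set ws \<subseteq> W" using spanK span_superset[of "U \<union> set ws"] KW by auto
      then show "span (U \<union> set (us @ ws)) \<subseteq> W" using usW less.prems(2) by (intro span_minimal subW) auto
      show "W \<subseteq> span (U \<union> set (us @ ws))"
      proof
        fix y assume y: "y \<in> W"
        \<comment> \<open>Triangular elimination: a multiple of \<eta>^r h makes the value at k = d
          - r vanish and leaves those at larger k alone, since \<eta>^(k+r) h then lies in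
          \<open>U\<close>. At r = d + 1 all k are covered.\<close>
        have "\<exists>z\<in>span (set us). \<forall>k. d < k + r \<longrightarrow> \<phi> ((\<eta> ^^ k) (y - z)) = 0" if "r \<le> Suc d" for r
          using that
        proof (induction r)
          case 0
          have "\<phi> ((\<eta> ^^ k) y) = 0" if "d < k" for k using big[OF that y] \<phi>(3) by blast
          then show ?case by (intro bexI[of _ 0]) (simp_all add: span_zero)
        next
          case (Suc r)
          then obtain z where z: "z \<in> span (set us)" "\<And>k. d < k + r \<Longrightarrow> \<phi> ((\<eta> ^^ k) (y - z)) = 0" by auto
          define c where "c = \<phi> ((\<eta> ^^ (d - r)) (y - z))"
          have "us ! (d - r) = (\<eta> ^^ r) h" using us(2)[of "d - r"] Suc.prems by simp
          then have "(\<eta> ^^ r) h \<in> set us" using len by (metis diff_le_self le_imp_less_Suc nth_mem)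
          then have "z + c *s (\<eta> ^^ r) h \<in> span (set us)" by (rule span_add[OF z(1) span_scale[OF span_base]])
          moreover have "\<phi> ((\<eta> ^^ k) (y - (z + c *s (\<eta> ^^ r) h))) = 0" if k: "d < k + Suc r" for k
          proof -
            have e: "\<phi> ((\<eta> ^^ k) (y - (z + c *s (\<eta> ^^ r) h))) = \<phi> ((\<eta> ^^ k) (y - z)) - c * \<phi> ((\<eta> ^^ (k + r)) h)"
              by (simp add: power_diff power_add power_scale lin power_power)
            show ?thesis
            proof (cases "d < k + r")
              case True
              then show ?thesis unfolding e using z(2) \<phi>(3)[OF big[OF True h(1)]] by simp
            next
              case False
              then have kr: "k = d - r" "k + r = d" using k Suc.prems by auto
              show ?thesis unfolding e unfolding kr(2) \<phi>(2) unfolding kr(1) c_def[symmetric] by simp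
            qed
          qed
          ultimately show ?case by blast
        qed
        from this[of "Suc d"] obtain z where z: "z \<in> span (set us)" "\<And>k. \<phi> ((\<eta> ^^ k) (y - z)) = 0" by auto
        have "z \<in> W" using z(1) span_minimal[OF usW subW] by blast
        then have "y - z \<in> K" unfolding K_def using z(2) subspace_diff[OF subW y] by simp
        then have "y - z \<in> span (U \<union> set (us @ ws))" unfolding spanK[symmetric]
          using span_mono[of "U \<union> set ws" "U \<union> set (us @ ws)"] by auto
        moreover have "z \<in> span (U \<union> set (us @ ws))" using z(1) span_mono[of "set us" "U \<union> set (us @ ws)"] by auto
        ultimately have "(y - z) + z \<in> span (U \<union> set (us @ ws))" by (rule span_add)
        then show "y \<in> span (U \<union> set (us @ ws))" by simp
      qed
    qed
    have indep: "\<forall>i<length (us @ ws). c i = 0" if c: "(\<Sum>i<length (us @ ws). c i *s ((us @ ws) ! i)) \<in> U" for c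
    proof -
      let ?x = "\<Sum>l<Suc d. c l *s (us ! l)" and ?y = "\<Sum>i<length ws. c (Suc d + i) *s (ws ! i)"
      have "(\<Sum>i<length (us @ ws). c i *s ((us @ ws) ! i)) =
        (\<Sum>i<Suc d. c i *s ((us @ ws) ! i)) + (\<Sum>i<length ws. c (Suc d + i) *s ((us @ ws) ! (Suc d + i)))"
        unfolding length_append len by (rule sum_lessThan_split)
      also have "\<dots> = ?x + ?y"
        by (intro arg_cong2[where f = "(+)"] sum.cong) (simp_all add: nth_append len)
      finally have xyU: "?x + ?y \<in> U" using c by simp
      have yK: "?y \<in> K" unfolding spanK[symmetric] by (intro span_sum span_scale span_base) auto
      have "(?x + ?y) - ?y \<in> K" using xyU UK yK by (intro subspace_diff[OF subK]) auto
      then have xK: "?x \<in> K" by simp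
      \<comment> \<open>Apply \<eta>^l and then \<phi>, beginning with l = d: the terms with i < l
        fall into \<open>U\<close>, those with i > l have been dealt with, and i = l contributes
        \<open>c l\<close>.\<close>
      have "c l = 0" if "l \<le> d" for l
        using that
      proof (induction "d - l" arbitrary: l rule: less_induct)
        case less
        have "\<phi> ((\<eta> ^^ l) ?x) = (\<Sum>i<Suc d. c i * \<phi> ((\<eta> ^^ l) (us ! i)))"
          by (simp add: power_sum power_scale lin del: sum.lessThan_Suc)
        also have "\<dots> = (\<Sum>i<Suc d. if i = l then c l else 0)"
        proof (rule sum.cong[OF refl])
          fix i assume "i \<in> {..<Suc d}"
          then have i: "i \<le> d" by simp
          have e: "(\<eta> ^^ l) (us ! i) = (\<eta> ^^ (l + (d - i))) h" unfolding us(2)[OF i] power_power ..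
          consider "i < l" | "i = l" | "i > l" by linarith
          then show "c i * \<phi> ((\<eta> ^^ l) (us ! i)) = (if i = l then c l else 0)"
          proof cases
            case 1
            then have "d < l + (d - i)" using i by simp
            then show ?thesis unfolding e using 1 \<phi>(3)[OF big[OF _ h(1)]] by simp
          next
            case 2
            then show ?thesis unfolding e using \<phi>(2) i by simp
          next
            case 3
            then show ?thesis using less.hyps[of i] i by simp
          qed
        qed
        also have "\<dots> = c l" using less.prems by simp
        finally show ?case using xK unfolding K_def by simp
      qed
      then have c0: "\<forall>l<Suc d. c l = 0" by (simp add: less_Suc_eq_le)
      then have "?x = 0" by (intro sum.neutral) simp
      then have "?y \<in> U" using xyU by simp
      moreover have "\<forall>c. (\<Sum>i<length ws. c i *s (ws ! i)) \<in> U \<longrightarrow> (\<forall>i<length ws. c i = 0)"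
        using ns(1) unfolding jordan_basis_def quotient_basis_def by simp
      ultimately have c1: "\<forall>i<length ws. c (Suc d + i) = 0" by (auto dest!: spec[of _ "\<lambda>i. c (Suc d + i)"])
      show ?thesis
      proof (intro allI impI)
        fix i assume i: "i < length (us @ ws)"
        show "c i = 0"
        proof (cases "i < Suc d")
          case False
          then have "i = Suc d + (i - Suc d)" "i - Suc d < length ws" using i len by auto
          then show ?thesis using c1[rule_format, of "i - Suc d"] by simp
        next
          case True
          then show ?thesis by (rule c0[rule_format])
        qed
      qed
    qed
    have rel: "\<eta> ((us @ ws) ! j) - (if block_pos (Suc d # ns) j = 0 then 0 else (us @ ws) ! (j - 1)) \<in> U"
      if j: "j < length (us @ ws)" for j
    proof (cases "j < Suc d")
      case True
      then have jd: "j \<le> d" by simp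
      have e: "\<eta> (us ! j) = (\<eta> ^^ Suc (d - j)) h" unfolding us(2)[OF jd] by simp
      show ?thesis
      proof (cases j)
        case 0
        then show ?thesis using e True len big[OF _ h(1), of "Suc d"] by (simp add: nth_append)
      next
        case (Suc j')
        then have d': "d - j' = Suc (d - j)" "j' \<le> d" using jd by auto
        have "\<eta> (us ! j) = us ! j'" unfolding e us(2)[OF d'(2)] d'(1) ..
        then show ?thesis using True len Suc subspace_0[OF subU] by (simp add: nth_append)
      qed
    next
      case False
      define i where "i = j - Suc d"
      have i: "i < length ws" "j = Suc d + i" using j False len unfolding i_def by auto
      have "\<eta> (ws ! i) - (if block_pos ns i = 0 then 0 else ws ! (i - 1)) \<in> U"
        using ns(1) i(1) unfolding jordan_basis_def by blast
      moreover have "i = 0 \<Longrightarrow> block_pos ns i = 0" by simp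
      ultimately show ?thesis using i len by (cases i) (auto simp: nth_append split: if_splits)
    qed
    have "length (us @ ws) = sum_list (Suc d # ns)" using len ns(1) unfolding jordan_basis_def by simp
    then have "jordan_basis U W (Suc d # ns) (us @ ws)"
      unfolding jordan_basis_def quotient_basis_def using span indep rel by blast
    \<comment> \<open>The clause on \<open>N\<close> in the statement serves this point:
      \<eta>^(d+1) maps \<open>W\<close>, and so \<open>K\<close>, into \<open>U\<close>, hence the
      blocks of \<open>K\<close> have size at most d + 1 and the new list is still sorted.\<close>
    moreover have "\<forall>n\<in>set ns. n \<le> Suc d"
      using ns(4)[rule_format, of "Suc d", OF order_trans[OF image_mono[OF KW] d(2)]] by (rule ballI)
    moreover have "Suc d \<le> N \<and> (\<forall>n\<in>set ns. n \<le> N)" if N: "(\<eta> ^^ N) ` W \<subseteq> U" for N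
    proof
      show "Suc d \<le> N"
      proof (rule ccontr)
        assume "\<not> Suc d \<le> N"
        then have "(\<eta> ^^ (d - N)) ((\<eta> ^^ N) h) = (\<eta> ^^ d) h" unfolding power_power by simp
        moreover have "(\<eta> ^^ (d - N)) ((\<eta> ^^ N) h) \<in> U" by (rule stable_power[OF assms(1)]) (use N h(1) in blast)
        ultimately show False using h(2) by simp
      qed
      show "\<forall>n\<in>set ns. n \<le> N"
        using ns(4)[rule_format, of N, OF order_trans[OF image_mono[OF KW] N]] by (rule ballI)
    qed
    ultimately have "jordan_basis U W (Suc d # ns) (us @ ws) \<and> sorted_wrt (\<ge>) (Suc d # ns) \<and> 0 \<notin> set (Suc d # ns) \<and>
      (\<forall>N. (\<eta> ^^ N) ` W \<subseteq> U \<longrightarrow> (\<forall>n\<in>set (Suc d # ns). n \<le> N))"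
      using ns(2,3) by simp
    then show ?thesis by (intro exI)
  qed
qed

lemma jordan_type_columns:
  assumes "stable U" "stable W" "U \<subseteq> W"
  shows "is_partition (jordan_type \<eta> U W) \<and> (\<forall>k. card {i. k < jordan_type \<eta> U W i} = cols U W k)"
proof -
  let ?l = "\<lambda>lam. map (\<lambda>i. (lam i, 0 :: 'a)) [0..<card {i. lam i \<noteq> 0}]"
  define P where "P = (\<lambda>lam. is_partition lam \<and> (\<exists>ws A. quotient_basis U W ws \<and> quotient_matrix \<eta> U ws A \<and> jordan_nf A (?l lam)))"
  \<comment> \<open>The definition of \<open>jordan_type\<close> lists as many initial parts as
    there are nonzero ones; by monotonicity these are all the nonzero parts.\<close>
  have support: "i < card {i. lam i \<noteq> 0}" if "is_partition lam" "lam i \<noteq> 0" for lam :: "nat \<Rightarrow> nat" and i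
  proof -
    have "i < column_length (young_diagram lam) 0"
      using young_set_column[OF young_diagram_young_set[OF that(1)], of i 0] that(2) unfolding young_diagram_def by simp
    then show ?thesis unfolding column_length_def young_diagram_def by simp
  qed
  have P_cols: "card {i. k < lam i} = cols U W k" if P: "P lam" for lam k
  proof -
    define ns where "ns = map lam [0..<card {i. lam i \<noteq> 0}]"
    have ns: "?l lam = map (\<lambda>n. (n, 0)) ns" unfolding ns_def by simp
    obtain ws A where wA: "quotient_basis U W ws" "quotient_matrix \<eta> U ws A" "jordan_nf A (?l lam)"
      using P unfolding P_def by blast
    let ?J = "jordan_matrix (map (\<lambda>n. (n, 0 :: 'a)) ns)"
    obtain Q R where QR: "similar_mat_wit A ?J Q R" using wA(3) unfolding jordan_nf_def similar_mat_def ns by blast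
    have A: "A \<in> carrier_mat (length ws) (length ws)" using wA(2) unfolding quotient_matrix_def by simp
    then have dimA: "dim_row A = length ws" by simp
    have w: "Q \<in> carrier_mat (length ws) (length ws)" "R \<in> carrier_mat (length ws) (length ws)"
      "Q * R = 1\<^sub>m (length ws)" "R * Q = 1\<^sub>m (length ws)" "?J \<in> carrier_mat (length ws) (length ws)" "A = Q * ?J * R"
      using QR[unfolded similar_mat_wit_def Let_def dimA insert_subset] by simp_all
    define vs where "vs = map (\<lambda>j. \<Sum>i<length ws. (Q $$ (i, j)) *s (ws ! i)) [0..<length ws]"
    have vs: "length vs = length ws" "quotient_basis U W vs" "quotient_matrix \<eta> U vs ?J"
      using quotient_basis_change[OF stable_subspace[OF assms(1)] wA(1,2) refl w] unfolding vs_def by simp_all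
    have "sum_list (map fst (map (\<lambda>n. (n, 0 :: 'a)) ns)) = length ws"
      using carrier_matD(1)[OF w(5)] unfolding jordan_matrix_dim .
    then have len: "length vs = sum_list ns" unfolding vs(1) by (simp add: comp_def)
    have "jordan_basis U W ns vs" unfolding jordan_basis_def
      using vs len quotient_matrix_jordan_iff[OF len] by blast
    then have "cols U W k = length (filter (\<lambda>n. k < n) ns)" by (rule cols_jordan_basis[OF assms(1)])
    also have "\<dots> = card {i. i < card {i. lam i \<noteq> 0} \<and> k < lam i}" unfolding ns_def length_filter_conv_card
      by (simp cong: conj_cong)
    also have "{i. i < card {i. lam i \<noteq> 0} \<and> k < lam i} = {i. k < lam i}"
    proof -
      have "is_partition lam" using P unfolding P_def by (rule conjunct1)
      then have "k < lam i \<Longrightarrow> i < card {i. lam i \<noteq> 0}" for i using support[of lam i] by simp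
      then show ?thesis by blast
    qed
    finally show ?thesis ..
  qed
  obtain ns ws where ns: "jordan_basis U W ns ws" "sorted_wrt (\<ge>) ns" "0 \<notin> set ns"
    using ex_jordan_basis[OF assms] by (elim exE conjE) (rule that)
  define lam where "lam = (\<lambda>i. if i < length ns then ns ! i else 0)"
  have supp: "{i. lam i \<noteq> 0} = {..<length ns}" unfolding lam_def using ns(3) by (auto simp: in_set_conv_nth)
  have "antimono lam" unfolding lam_def
    using ns(2) by (intro antimonoI) (auto simp: sorted_wrt_iff_nth_less le_less)
  then have part: "is_partition lam" unfolding is_partition_def supp by simp
  have l: "?l lam = map (\<lambda>n. (n, 0)) ns" unfolding supp card_lessThan by (rule nth_equalityI) (simp_all add: lam_def)
  let ?J = "jordan_matrix (map (\<lambda>n. (n, 0 :: 'a)) ns)"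
  have len: "length ws = sum_list ns" using ns(1) unfolding jordan_basis_def by simp
  have "quotient_matrix \<eta> U ws ?J" unfolding quotient_matrix_jordan_iff[OF len] using ns(1) unfolding jordan_basis_def by blast
  moreover have "jordan_nf ?J (?l lam)" unfolding l jordan_nf_def
  proof
    show "0 \<notin> fst ` set (map (\<lambda>n. (n, 0 :: 'a)) ns)" using ns(3) by auto
    show "similar_mat ?J ?J" by (rule similar_mat_refl[OF jordan_matrix_carrier])
  qed
  ultimately have "P lam" unfolding P_def using part ns(1) unfolding jordan_basis_def by blast
  moreover have "m = lam" if "P m" for m
  proof (rule partition_eqI[OF _ part])
    show "is_partition m" using that unfolding P_def by (rule conjunct1)
    show "card {i. k < m i} = card {i. k < lam i}" for k unfolding P_cols[OF that] P_cols[OF \<open>P lam\<close>] ..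
  qed
  ultimately have "(THE lam. P lam) = lam" by (rule the_equality)
  then have "jordan_type \<eta> U W = lam" unfolding jordan_type_def P_def .
  then show ?thesis using part P_cols[OF \<open>P lam\<close>] by (simp only: simp_thms)
qed

end

section \<open>Deformations\<close>

lemma column_length_antimono: "young_set Y \<Longrightarrow> column_length Y (Suc k) \<le> column_length Y k"
  by (metis young_set_column young_setD le_refl le_SucI not_le_imp_less less_irrefl)

lemma card_young_set:
  assumes "young_set Y" "\<And>k. N \<le> k \<Longrightarrow> column_length Y k = 0"
  shows "card Y = (\<Sum>k<N. column_length Y k)"
proof -
  have "Y = prod.swap ` (SIGMA k:{..<N}. {..<column_length Y k})"
  proof (rule subset_antisym; rule subsetI)
    fix s assume s: "s \<in> Y"
    obtain i k where ik: "s = (i, k)" by (cases s)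
    then have "i < column_length Y k" using s young_set_column[OF assms(1)] by simp
    moreover have "k < N" using assms(2)[of k] calculation by (cases "k < N") auto
    ultimately show "s \<in> prod.swap ` (SIGMA k:{..<N}. {..<column_length Y k})"
      unfolding ik in_swap_image by simp
  next
    fix s assume s: "s \<in> prod.swap ` (SIGMA k:{..<N}. {..<column_length Y k})"
    obtain i k where ik: "s = (i, k)" by (cases s)
    show "s \<in> Y" using s unfolding ik in_swap_image young_set_column[OF assms(1)] by simp
  qed
  then have "card Y = card (prod.swap ` (SIGMA k:{..<N}. {..<column_length Y k}))" by (rule arg_cong)
  also have "\<dots> = (\<Sum>k<N. column_length Y k)" by (subst card_image) (auto intro: inj_onI simp: card_SigmaI)
  finally show ?thesis .
qed

context nilpotent_operator
begin

lemma jordan_type_young: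
  assumes "stable U" "stable W" "U \<subseteq> W"
  shows "young_set (young_diagram (jordan_type \<eta> U W))"
    "column_length (young_diagram (jordan_type \<eta> U W)) = cols U W"
    "card (young_diagram (jordan_type \<eta> U W)) = dim W - dim U"
proof -
  let ?Y = "young_diagram (jordan_type \<eta> U W)"
  note sub = stable_subspace[OF assms(1)] stable_subspace[OF assms(2)]
  show Y: "young_set ?Y" using jordan_type_columns[OF assms] young_diagram_young_set by blast
  show col: "column_length ?Y = cols U W"
    using jordan_type_columns[OF assms] unfolding column_length_def young_diagram_def by auto
  obtain N where "img U W N \<subseteq> U" using img_eventually by blast
  then have N: "img U W k = U" if "N \<le> k" for k
    using img_antimono[OF assms(2) that, of U] img_supset[OF sub(2), of U k] by blast
  have "column_length ?Y k = 0" if "N \<le> k" for k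
    unfolding col cols_def using N[OF that] N[of "Suc k"] that by simp
  then have "card ?Y = (\<Sum>k<N. cols U W k)" using card_young_set[OF Y, of N] unfolding col by blast
  also have "\<dots> = dim (img U W 0) - dim (img U W N)"
  proof (induction N)
    case (Suc N)
    have "dim (img U W N) \<le> dim (img U W 0)" by (intro dim_subset img_antimono assms) simp
    moreover have "dim (img U W (Suc N)) \<le> dim (img U W N)" by (rule img_dim_mono[OF assms(1,2)])
    ultimately show ?case using Suc unfolding cols_def by simp
  qed simp
  also have "\<dots> = dim W - dim U" using img_0[OF sub assms(3)] N[of N] by simp
  finally show "card ?Y = dim W - dim U" .
qed

lemma young_diagram_eq_iff:
  assumes "stable U" "stable W" "U \<subseteq> W" "young_set Y"
  shows "Y = young_diagram (jordan_type \<eta> U W) \<longleftrightarrow> cols U W = column_length Y"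
  using jordan_type_young[OF assms(1-3)] young_set_eqI[OF assms(4)] by metis

lemma cols_antimono:
  assumes "stable U" "stable W" "U \<subseteq> W"
  shows "cols U W (Suc k) \<le> cols U W k"
  using column_length_antimono[OF jordan_type_young(1)[OF assms], of k] unfolding jordan_type_young(2)[OF assms] .

text \<open>On the line B/A the operator is multiplication by a scalar c, and nilpotency gives c^N =
  0, hence c = 0.\<close>

lemma codim_one_\<eta>:
  assumes "stable A" "stable B" "A \<subseteq> B" "dim B = dim A + 1" "v \<in> B"
  shows "\<eta> v \<in> A"
proof (cases "v \<in> A")
  case True
  then show ?thesis using assms(1) unfolding stable_def by blast
next
  case False
  note sub = stable_subspace[OF assms(1)] stable_subspace[OF assms(2)]
  have "\<eta> v \<in> B" using assms(2,5) unfolding stable_def by blast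
  then obtain c where c: "\<eta> v - c *s v \<in> A"
    by (rule codim_one_decompose[OF sub assms(3,4,5) False])
  have pow: "(\<eta> ^^ k) v - (c ^ k) *s v \<in> A" for k
  proof (induction k)
    case 0
    then show ?case using subspace_0[OF sub(1)] by simp
  next
    case (Suc k)
    have "\<eta> ((\<eta> ^^ k) v - (c ^ k) *s v) \<in> A" using Suc assms(1) unfolding stable_def by blast
    then have "\<eta> ((\<eta> ^^ k) v - (c ^ k) *s v) + (c ^ k) *s (\<eta> v - c *s v) \<in> A"
      using c by (intro subspace_add[OF sub(1)] subspace_scale[OF sub(1)])
    moreover have "\<eta> ((\<eta> ^^ k) v - (c ^ k) *s v) + (c ^ k) *s (\<eta> v - c *s v) = (\<eta> ^^ Suc k) v - (c ^ Suc k) *s v"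
      by (simp add: \<eta>_diff \<eta>_scale scale_right_diff_distrib mult.commute)
    ultimately show ?case by simp
  qed
  obtain N where "\<eta> ^^ N = (\<lambda>v. 0)" using nilpotent by blast
  then have "0 - (c ^ N) *s v \<in> A" using pow[of N] by simp
  then have "(c ^ N) *s v \<in> A" using subspace_neg[OF sub(1)] by fastforce
  have "c = 0"
  proof (rule ccontr)
    assume "c \<noteq> 0"
    then have "v = inverse (c ^ N) *s ((c ^ N) *s v)" by simp
    then show False using subspace_scale[OF sub(1) \<open>(c ^ N) *s v \<in> A\<close>] False by metis
  qed
  then show ?thesis using c by simp
qed

abbreviation shear :: "('b \<Rightarrow> 'b) \<Rightarrow> 'a \<Rightarrow> 'b \<Rightarrow> 'b" where
  "shear n t \<equiv> \<lambda>x. x + t *s n x"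

text \<open>Almost all \<open>1 + t n\<close> are invertible and preserve every subspace containing \<open>H\<close>; the preservation of
  \<open>cols\<close> is what is left of commuting with \<open>\<eta>\<close> on \<open>H / U\<close>.\<close>

definition deforms :: "'b set \<Rightarrow> 'b set \<Rightarrow> ('b \<Rightarrow> 'b) \<Rightarrow> 'a set \<Rightarrow> bool" where
  "deforms U H n B \<longleftrightarrow> Vector_Spaces.linear scale scale n \<and> finite B \<and> range n \<subseteq> H \<and> (\<forall>x\<in>U. n x = 0) \<and>
     (\<forall>t. t \<notin> B \<longrightarrow> inj (shear n t) \<and>
       (\<forall>Y X. stable Y \<longrightarrow> stable X \<longrightarrow> U \<subseteq> Y \<longrightarrow> Y \<subseteq> X \<longrightarrow> X \<subseteq> H \<longrightarrow>
          stable (shear n t ` X) \<and>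
          cols (shear n t ` Y) (shear n t ` X) = cols Y X))"

lemma deform_linear:
  assumes "Vector_Spaces.linear scale scale n"
  shows "Vector_Spaces.linear scale scale (shear n t)"
  using assms unfolding Vector_Spaces.linear_iff
  by (simp add: scale_right_distrib algebra_simps scale_left_commute)

lemma dim_image_inj:
  assumes "Vector_Spaces.linear scale scale g" "inj g"
  shows "dim (g ` X) = dim X"
proof -
  interpret finite_dimensional_vector_space_pair_1 scale Basis scale ..
  show ?thesis using assms by (intro dim_image_eq) (auto intro: inj_on_subset)
qed

lemma subspace_linear_image:
  assumes "Vector_Spaces.linear scale scale g" "subspace X"
  shows "subspace (g ` X)"
proof -
  interpret Vector_Spaces.linear scale scale g by (rule assms(1))
  show ?thesis by (rule subspace_image[OF assms(2)])
qed

lemma deform_image_above: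
  assumes "Vector_Spaces.linear scale scale n" "range n \<subseteq> H" "H \<subseteq> X" "subspace X" "inj (shear n t)"
  shows "shear n t ` X = X"
proof (rule subspace_dim_equal)
  show "subspace (shear n t ` X)" by (rule subspace_linear_image[OF deform_linear[OF assms(1)] assms(4)])
  show "subspace X" by (rule assms(4))
  show "shear n t ` X \<subseteq> X"
    using assms(2,3) subspace_add[OF assms(4)] subspace_scale[OF assms(4)] by blast
  show "dim X \<le> dim (shear n t ` X)" unfolding dim_image_inj[OF deform_linear[OF assms(1)] assms(5)] ..
qed

end

text \<open>As \<phi> kills \<open>U\<close> and \<eta>^(d+1) H, it induces a k[\<eta>]-module map
  from H/U to k[\<eta>]/(\<eta>^(d+1)). As \<eta>^(d+1) u lies in \<open>U\<close>, sending 1 to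
  \<open>u\<close> is a map back. The composite is \<open>nil\<close>.\<close>

locale deformation = nilpotent_operator scale Basis \<eta>
  for scale :: "'a::field \<Rightarrow> 'b::ab_group_add \<Rightarrow> 'b" (infixr \<open>*s\<close> 75) and Basis :: "'b set" and \<eta> :: "'b \<Rightarrow> 'b" +
  fixes U H :: "'b set" and d :: nat and \<phi> :: "'b \<Rightarrow> 'a" and u :: 'b
  assumes stU: "stable U" and stH: "stable H" and UH: "U \<subseteq> H"
    and lin_\<phi>: "Vector_Spaces.linear scale (*) \<phi>" and \<phi>U: "x \<in> U \<Longrightarrow> \<phi> x = 0"
    and \<phi>H: "x \<in> H \<Longrightarrow> \<phi> ((\<eta> ^^ Suc d) x) = 0" and uH: "u \<in> H" and uU: "(\<eta> ^^ Suc d) u \<in> U"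
begin

lemmas subU = stable_subspace[OF stU] and subH = stable_subspace[OF stH]
  and \<phi>_lin = functional_linear[OF lin_\<phi>]

text \<open>Modulo \<open>U\<close>, this is the endomorphism \<open>y \<mapsto> p(\<eta>) u\<close> of the \<open>k[\<eta>]\<close>-module \<open>H\<close>, where the
  coefficient of \<open>p\<close> at \<open>\<eta>\<^sup>k\<close> is \<open>\<phi> (\<eta>\<^bsup>d-k\<^esup> y)\<close>.\<close>

definition nil :: "'b \<Rightarrow> 'b" where
  "nil y = (\<Sum>k\<le>d. \<phi> ((\<eta> ^^ (d - k)) y) *s (\<eta> ^^ k) u)"

lemma nil_linear: "Vector_Spaces.linear scale scale nil"
  unfolding Vector_Spaces.linear_iff
proof (intro conjI allI)
  show "vector_space scale" ..
  show "vector_space scale" ..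
  show "nil (x + y) = nil x + nil y" for x y
    unfolding nil_def by (simp add: power_add \<phi>_lin(2) scale_left_distrib sum.distrib)
  show "nil (c *s x) = c *s nil x" for c x
    unfolding nil_def by (simp add: power_scale \<phi>_lin(4) scale_sum_right)
qed

lemma nil_H: "nil y \<in> H"
  unfolding nil_def by (intro subspace_sum[OF subH] subspace_scale[OF subH] stable_power[OF stH uH])

lemma nil_U: "y \<in> U \<Longrightarrow> nil y = 0"
  unfolding nil_def using \<phi>U[OF stable_power[OF stU]] by simp

lemma \<phi>_power: "y \<in> H \<Longrightarrow> d < k \<Longrightarrow> \<phi> ((\<eta> ^^ k) y) = 0"
  using \<phi>H[OF stable_power[OF stH], of y "k - Suc d"] unfolding power_power by simp

text \<open>Applies whenever \<eta> y lies in \<open>U\<close>. On the classes killed by \<eta>,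
  among them a stable line M/U, the deformation is therefore governed by the rank-one map sending y
  to \<phi>(y) \<eta>^d u.\<close>

lemma nil_eq_top:
  assumes "\<And>j. 0 < j \<Longrightarrow> \<phi> ((\<eta> ^^ j) y) = 0"
  shows "nil y = \<phi> y *s (\<eta> ^^ d) u"
proof -
  have "nil y = (\<Sum>k\<le>d. if k = d then \<phi> y *s (\<eta> ^^ d) u else 0)"
    unfolding nil_def by (intro sum.cong) (auto simp: assms)
  then show ?thesis by simp
qed

text \<open>Both sides are the same sum up to a shift of the index. The two boundary terms are
  \<phi>(\<eta>^(d+1) y) u, which is zero, and \<phi>(y) \<eta>^(d+1) u, which lies in
  \<open>U\<close>.\<close>

lemma nil_commute:
  assumes "y \<in> H"
  shows "nil (\<eta> y) - \<eta> (nil y) \<in> U"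
proof -
  let ?g = "\<lambda>k. \<phi> ((\<eta> ^^ (Suc d - k)) y) *s (\<eta> ^^ k) u"
  have "nil (\<eta> y) = (\<Sum>k\<le>d. ?g k)" unfolding nil_def
  proof (rule sum.cong[OF refl])
    fix k assume "k \<in> {..d}"
    then have "(\<eta> ^^ (d - k)) (\<eta> y) = (\<eta> ^^ (Suc d - k)) y" by (simp add: Suc_diff_le funpow_swap1)
    then show "\<phi> ((\<eta> ^^ (d - k)) (\<eta> y)) *s (\<eta> ^^ k) u = ?g k" by simp
  qed
  also have "\<dots> = (\<Sum>k\<le>Suc d. ?g k) - \<phi> y *s (\<eta> ^^ Suc d) u" by simp
  also have "(\<Sum>k\<le>Suc d. ?g k) = ?g 0 + (\<Sum>k\<le>d. ?g (Suc k))" by (rule sum.atMost_Suc_shift)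
  also have "?g 0 = 0" using \<phi>H[OF assms] by simp
  also have "(\<Sum>k\<le>d. ?g (Suc k)) = \<eta> (nil y)" unfolding nil_def \<eta>_sum by (simp add: \<eta>_scale)
  finally have "nil (\<eta> y) - \<eta> (nil y) = (- \<phi> y) *s (\<eta> ^^ Suc d) u" by simp
  then show ?thesis using subspace_scale[OF subU uU, of "- \<phi> y"] by (simp only:)
qed

definition move :: "'a \<Rightarrow> 'b \<Rightarrow> 'b" where
  "move t y = y + t *s nil y"

lemma move_linear: "Vector_Spaces.linear scale scale (move t)"
  unfolding move_def by (rule deform_linear[OF nil_linear])

lemma move_add: "move t (x + y) = move t x + move t y" and move_scale: "move t (c *s x) = c *s move t x"
  using move_linear[of t] unfolding Vector_Spaces.linear_iff by blast+

lemma move_diff: "move t (x - y) = move t x - move t y"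
  using move_add[of t "x - y" y] by simp

lemma move_U: "y \<in> U \<Longrightarrow> move t y = y"
  unfolding move_def by (simp add: nil_U)

lemma move_H: "y \<in> H \<Longrightarrow> move t y \<in> H"
  unfolding move_def by (intro subspace_add[OF subH] subspace_scale[OF subH] nil_H)

lemma move_power_commute:
  assumes "y \<in> H"
  shows "(\<eta> ^^ k) (move t y) - move t ((\<eta> ^^ k) y) \<in> U"
proof (induction k)
  case 0
  then show ?case using subspace_0[OF subU] by simp
next
  case (Suc k)
  let ?z = "(\<eta> ^^ k) y"
  have z: "?z \<in> H" by (rule stable_power[OF stH assms])
  have "\<eta> ((\<eta> ^^ k) (move t y) - move t ?z) \<in> U" using Suc stU unfolding stable_def by blast
  moreover have "\<eta> (move t ?z) - move t (\<eta> ?z) = (- t) *s (nil (\<eta> ?z) - \<eta> (nil ?z))"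
    unfolding move_def by (simp add: \<eta>_add \<eta>_scale scale_right_diff_distrib)
  then have "\<eta> (move t ?z) - move t (\<eta> ?z) \<in> U" using subspace_scale[OF subU nil_commute[OF z], of "- t"] by (simp only:)
  ultimately have "\<eta> ((\<eta> ^^ k) (move t y) - move t ?z) + (\<eta> (move t ?z) - move t (\<eta> ?z)) \<in> U"
    by (rule subspace_add[OF subU])
  then show ?case by (simp add: \<eta>_diff)
qed

text \<open>The kernel of \<open>move t\<close> on H/U is stable, as \<open>move t\<close> commutes
  with \<eta> there; if nonzero, it contains a nonzero class killed by \<eta>. On such classes
  \<open>nil_eq_top\<close> applies, and evaluating \<phi> leaves the single condition on t. A
  vector of V that \<open>move t\<close> kills lies in the range of \<open>nil\<close>, hence in
  \<open>H\<close>, and then in \<open>U\<close>, where \<open>move t\<close> is the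
  identity.\<close>

lemma move_inj:
  assumes t: "1 + t * \<phi> ((\<eta> ^^ d) u) \<noteq> 0"
  shows "inj (move t)"
proof -
  have key: "x \<in> U" if x: "x \<in> H" "move t x \<in> U" "\<eta> x \<in> U" for x
  proof -
    have "\<phi> ((\<eta> ^^ j) x) = 0" if "0 < j" for j
    proof -
      have "(\<eta> ^^ j) x = (\<eta> ^^ (j - 1)) (\<eta> x)" using that by (cases j) (simp_all add: funpow_swap1)
      then show ?thesis using \<phi>U[OF stable_power[OF stU x(3)]] by simp
    qed
    then have n: "nil x = \<phi> x *s (\<eta> ^^ d) u" by (rule nil_eq_top)
    have "0 = \<phi> (move t x)" using \<phi>U[OF x(2)] by simp
    also have "\<dots> = \<phi> x * (1 + t * \<phi> ((\<eta> ^^ d) u))" unfolding move_def n by (simp add: \<phi>_lin algebra_simps)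
    finally have "\<phi> x = 0" using t by simp
    then show ?thesis using x(2) unfolding move_def n by simp
  qed
  have ker: "x \<in> U" if x: "x \<in> H" "move t x \<in> U" for x
  proof (rule ccontr)
    assume xU: "x \<notin> U"
    obtain N where "\<eta> ^^ N = (\<lambda>v. 0)" using nilpotent by blast
    then have N: "(\<eta> ^^ N) x \<in> U" using subspace_0[OF subU] by simp
    obtain k where k: "(\<eta> ^^ k) x \<notin> U" "(\<eta> ^^ Suc k) x \<in> U"
    proof -
      have "\<exists>k. (\<eta> ^^ k) x \<notin> U \<and> (\<eta> ^^ Suc k) x \<in> U" using N
      proof (induction N)
        case 0
        then show ?case using xU by simp
      next
        case (Suc N)
        then show ?case by (cases "(\<eta> ^^ N) x \<in> U") blast+
      qed
      then show thesis using that by blast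
    qed
    have "(\<eta> ^^ k) (move t x) \<in> U" by (rule stable_power[OF stU x(2)])
    moreover have "(\<eta> ^^ k) (move t x) - move t ((\<eta> ^^ k) x) \<in> U" by (rule move_power_commute[OF x(1)])
    ultimately have "(\<eta> ^^ k) (move t x) - ((\<eta> ^^ k) (move t x) - move t ((\<eta> ^^ k) x)) \<in> U" by (rule subspace_diff[OF subU])
    then have "move t ((\<eta> ^^ k) x) \<in> U" by simp
    then show False using key[OF stable_power[OF stH x(1), of k]] k by simp
  qed
  have zero: "x = 0" if "move t x = 0" for x
  proof -
    have "x = (- t) *s nil x" using that unfolding move_def by (simp add: eq_neg_iff_add_eq_0)
    then have "x \<in> H" using subspace_scale[OF subH nil_H] by metis
    then have "x \<in> U" using ker that subspace_0[OF subU] by simp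
    then show ?thesis using move_U[of x t] that by simp
  qed
  show ?thesis
  proof (rule injI)
    fix x y assume "move t x = move t y"
    then have "move t (x - y) = 0" by (simp add: move_diff)
    then show "x = y" using zero[of "x - y"] by simp
  qed
qed

lemma move_stable:
  assumes "stable X" "U \<subseteq> X" "X \<subseteq> H"
  shows "stable (move t ` X)"
  unfolding stable_def
proof
  show "subspace (move t ` X)" by (rule subspace_linear_image[OF move_linear stable_subspace[OF assms(1)]])
  show "\<eta> ` move t ` X \<subseteq> move t ` X"
  proof
    fix z assume "z \<in> \<eta> ` move t ` X"
    then obtain x where x: "x \<in> X" "z = \<eta> (move t x)" by blast
    define w where "w = \<eta> (move t x) - move t (\<eta> x)"
    have w: "w \<in> U" using move_power_commute[of x 1 t] x assms(3) unfolding w_def by auto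
    have "z = move t (\<eta> x) + move t w" using move_U[OF w, of t] unfolding x(2) by (simp add: w_def)
    then have "z = move t (\<eta> x + w)" by (simp add: move_add)
    moreover have "\<eta> x + w \<in> X" using w x(1) assms unfolding stable_def by (intro subspace_add) auto
    ultimately show "z \<in> move t ` X" by blast
  qed
qed

lemma move_img:
  assumes "stable Y" "stable X" "U \<subseteq> Y" "X \<subseteq> H"
  shows "img (move t ` Y) (move t ` X) k = move t ` img Y X k"
proof (rule subset_antisym; rule subsetI)
  note subY = stable_subspace[OF assms(1)]
  fix z assume "z \<in> img (move t ` Y) (move t ` X) k"
  then obtain x y where xy: "x \<in> X" "y \<in> Y" "z - (\<eta> ^^ k) (move t x) = move t y" unfolding img_def by blast
  define w where "w = (\<eta> ^^ k) (move t x) - move t ((\<eta> ^^ k) x)"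
  have w: "w \<in> U" unfolding w_def using xy(1) assms(4) by (intro move_power_commute) auto
  have "z = move t y + move t ((\<eta> ^^ k) x) + w" using xy(3) unfolding w_def by (simp add: algebra_simps)
  then have "z = move t ((y + w) + (\<eta> ^^ k) x)" by (simp add: move_add move_U[OF w] algebra_simps)
  moreover have "(y + w) + (\<eta> ^^ k) x - (\<eta> ^^ k) x \<in> Y" using subspace_add[OF subY xy(2)] w assms(3) by auto
  then have "(y + w) + (\<eta> ^^ k) x \<in> img Y X k" unfolding img_def using xy(1) by blast
  ultimately show "z \<in> move t ` img Y X k" by blast
next
  note subY = stable_subspace[OF assms(1)]
  fix z assume "z \<in> move t ` img Y X k"
  then obtain v x where v: "z = move t v" "x \<in> X" "v - (\<eta> ^^ k) x \<in> Y" unfolding img_def by blast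
  define w where "w = (\<eta> ^^ k) (move t x) - move t ((\<eta> ^^ k) x)"
  have w: "w \<in> U" unfolding w_def using v(2) assms(4) by (intro move_power_commute) auto
  have "z - (\<eta> ^^ k) (move t x) = move t v - move t ((\<eta> ^^ k) x) - w" unfolding w_def v(1) by simp
  also have "\<dots> = move t ((v - (\<eta> ^^ k) x) - w)" by (simp add: move_diff move_U[OF w])
  finally have "z - (\<eta> ^^ k) (move t x) = move t ((v - (\<eta> ^^ k) x) - w)" .
  moreover have "(v - (\<eta> ^^ k) x) - w \<in> Y" using subspace_diff[OF subY v(3)] w assms(3) by auto
  ultimately show "z \<in> img (move t ` Y) (move t ` X) k" unfolding img_def using v(2) by blast
qed

text \<open>The parameter 0 is excluded too, because there the flag stays put and a bad cell stays
  bad.\<close>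

lemma finite_singular: "finite (insert 0 {t. 1 + t * \<phi> ((\<eta> ^^ d) u) = 0})"
proof -
  have "{t. 1 + t * \<phi> ((\<eta> ^^ d) u) = 0} \<subseteq> {- 1 / \<phi> ((\<eta> ^^ d) u)}"
  proof
    fix t assume "t \<in> {t. 1 + t * \<phi> ((\<eta> ^^ d) u) = 0}"
    then have t: "1 + t * \<phi> ((\<eta> ^^ d) u) = 0" by simp
    then have "\<phi> ((\<eta> ^^ d) u) \<noteq> 0" by auto
    moreover have "t * \<phi> ((\<eta> ^^ d) u) = - 1" using t by (simp add: eq_neg_iff_add_eq_0 add.commute)
    ultimately have "t = - 1 / \<phi> ((\<eta> ^^ d) u)" by (rule nonzero_eq_divide_eq[THEN iffD2])
    then show "t \<in> {- 1 / \<phi> ((\<eta> ^^ d) u)}" by (simp only: singleton_iff)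
  qed
  then have "finite {t. 1 + t * \<phi> ((\<eta> ^^ d) u) = 0}" by (rule finite_subset) simp
  then show ?thesis by simp
qed

lemma deforms_nil: "deforms U H nil (insert 0 {t. 1 + t * \<phi> ((\<eta> ^^ d) u) = 0})"
proof -
  have mv: "(\<lambda>x. x + t *s nil x) = move t" for t unfolding move_def ..
  have "stable (move t ` X) \<and> cols (move t ` Y) (move t ` X) = cols Y X"
    if t: "1 + t * \<phi> ((\<eta> ^^ d) u) \<noteq> 0" and YX: "stable Y" "stable X" "U \<subseteq> Y" "Y \<subseteq> X" "X \<subseteq> H" for t Y X
  proof
    show "stable (move t ` X)" using YX by (intro move_stable) auto
    show "cols (move t ` Y) (move t ` X) = cols Y X"
      unfolding cols_def move_img[OF YX(1,2,3,5)] dim_image_inj[OF move_linear move_inj[OF t]] ..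
  qed
  then show ?thesis unfolding deforms_def mv using nil_linear finite_singular nil_H nil_U move_inj by auto
qed

end

section \<open>Correcting one cell: moving a line or a hyperplane\<close>

lemma of_bool_shift_unique:
  fixes a b :: "nat \<Rightarrow> nat"
  assumes "\<And>k. a k = b k + of_bool (k = c)" "\<And>k. a k = b k + of_bool (k = d)"
  shows "c = d"
  using assms(1)[of c] assms(2)[of c] by (auto split: if_splits simp: of_bool_def)

lemma of_bool_two_shifts:
  fixes a b :: "nat \<Rightarrow> nat"
  assumes "\<And>k. a k = b k + of_bool (k = p) + of_bool (k = q)" "\<And>k. a k = b k + of_bool (k = c) + of_bool (k = d)"
  shows "p = c \<and> q = d \<or> p = d \<and> q = c"
proof -
  have e: "of_bool (k = p) + of_bool (k = q) = (of_bool (k = c) + of_bool (k = d) :: nat)" for k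
    using assms(1)[of k] assms(2)[of k] by simp
  consider "p = c" | "p = d" "p \<noteq> c" | "p \<noteq> c" "p \<noteq> d" by blast
  then show ?thesis
  proof cases
    case 1
    then show ?thesis using e[of q] by (cases "q = d") simp_all
  next
    case 2
    then show ?thesis using e[of q] by (cases "q = c") simp_all
  next
    case 3
    then show ?thesis using e[of p] by simp
  qed
qed

context nilpotent_operator
begin

text \<open>Call the largest k with \<open>M\<close> inside the k-th image the depth of the line
  M/U. It is d in \<open>H\<close>, and the cell is bad because the depth in \<open>W\<close> is
  some c > d instead of d. The deformation replaces v in \<open>M\<close> by v + t \<eta>^d u, where
  \<open>u\<close> heads a Jordan block of size d + 1 of W/U; as v is deeper than \<eta>^d u, the
  sum has depth exactly d for nonzero t.\<close>

lemma deform_line: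
  assumes st: "stable U" "stable M" "stable H" "stable W" and inc: "U \<subseteq> M" "M \<subseteq> H" "H \<subseteq> W"
    and dims: "dim M = dim U + 1" "dim W = dim H + 1"
    and rule: "local_rule (cols U W) (cols U H) \<beta> (cols M H)" and bad: "cols M W \<noteq> \<beta>"
  obtains n B where "deforms U H n B" "\<And>t. t \<notin> B \<Longrightarrow> cols (shear n t ` M) W = \<beta>"
proof -
  note sub = stable_subspace[OF st(1)] stable_subspace[OF st(2)] stable_subspace[OF st(3)] stable_subspace[OF st(4)]
  obtain c d where cd: "\<And>k. cols U W k = cols U H k + of_bool (k = c)" "\<And>k. cols U H k = cols M H k + of_bool (k = d)"
    and cases: "\<beta> = cols U H \<and> (c = d \<or> cols U W d \<le> cols U W (Suc d)) \<or>
      c \<noteq> d \<and> cols U W (Suc c) < cols U W c \<and> cols U W (Suc d) < cols U W d \<and> (\<forall>k. cols U W k = \<beta> k + of_bool (k = d))"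
    using rule unfolding local_rule_def by blast
  obtain c' where c': "M \<subseteq> img U W c'" "\<not> M \<subseteq> img U W (Suc c')"
    using cols_line_ex[OF st(1,2,4) inc(1) order_trans[OF inc(2,3)] dims(1)] by blast
  note colc' = cols_line[OF st(1,2,4) inc(1) dims(1) c']
  obtain d' where d': "M \<subseteq> img U H d'" "\<not> M \<subseteq> img U H (Suc d')"
    using cols_line_ex[OF st(1,2,3) inc(1,2) dims(1)] by blast
  have d'd: "d' = d" by (rule of_bool_shift_unique[OF cols_line[OF st(1,2,3) inc(1) dims(1) d'] cd(2)])
  obtain e where e: "pre U W e \<subseteq> H" "\<not> pre U W (Suc e) \<subseteq> H"
    using cols_hyperplane_ex[OF st(1,3,4) order_trans[OF inc(1,2)] inc(3) dims(2)] by blast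
  have ec: "e = c" by (rule of_bool_shift_unique[OF cols_hyperplane[OF st(1,3,4) inc(3) dims(2) e] cd(1)])
  obtain p where p: "pre M W p \<subseteq> H" "\<not> pre M W (Suc p) \<subseteq> H"
    using cols_hyperplane_ex[OF st(2,3,4) inc(2,3) dims(2)] by blast
  note colp = cols_hyperplane[OF st(2,3,4) inc(3) dims(2) p]
  \<comment> \<open>Passing from W/U to H/M by way of W/M or by way of H/U shortens the same
    columns, possibly in the other order.\<close>
  have perm: "c' = c \<and> p = d \<or> c' = d \<and> p = c"
  proof (rule of_bool_two_shifts)
    show "cols U W k = cols M H k + of_bool (k = c') + of_bool (k = p)" for k unfolding colc' colp by simp
    show "cols U W k = cols M H k + of_bool (k = c) + of_bool (k = d)" for k unfolding cd by simp
  qed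
  \<comment> \<open>With only one partition in between, no cell can be bad: if W/M lost a square in
    column d while columns d and d + 1 of W/U are equal, its column lengths would not be
    decreasing.\<close>
  have "\<not> (\<beta> = cols U H \<and> (c = d \<or> cols U W d \<le> cols U W (Suc d)))"
  proof
    assume a: "\<beta> = cols U H \<and> (c = d \<or> cols U W d \<le> cols U W (Suc d))"
    show False
    proof (cases "c' = c")
      case True
      have "cols M W k = \<beta> k" for k using colc'[of k] cd(1)[of k] a True by simp
      then show False using bad ext[of "cols M W" \<beta>] by simp
    next
      case False
      then have "c' = d" "c \<noteq> d" using perm by auto
      moreover have "cols M W (Suc d) \<le> cols M W d" by (rule cols_antimono[OF st(2,4) order_trans[OF inc(2,3)]])
      ultimately show False using colc'[of d] colc'[of "Suc d"] a by simp
    qed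
  qed
  then have cn: "c \<noteq> d" "cols U W (Suc d) < cols U W d" and \<beta>: "\<And>k. cols U W k = \<beta> k + of_bool (k = d)"
    using cases by auto
  have "c' \<noteq> d"
  proof
    assume "c' = d"
    then have "cols M W k = \<beta> k" for k using colc'[of k] \<beta>[of k] by simp
    then show False using bad ext[of "cols M W" \<beta>] by simp
  qed
  then have Mc: "M \<subseteq> img U W c" "\<not> M \<subseteq> img U W (Suc c)" using perm c' by auto
  have Md: "M \<subseteq> img U W d" using d'(1) img_mono[OF order_refl inc(3), of U d] unfolding d'd by blast
  have dc: "d < c"
  proof (rule ccontr)
    assume "\<not> d < c"
    then have "Suc c \<le> d" using cn(1) by simp
    then show False using Md Mc(2) img_antimono[OF st(4), of "Suc c" d U] by blast
  qed
  \<comment> \<open>The head of a block of size d + 1. It lies in \<open>H\<close>, since d < c and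
    \<open>H\<close> contains everything that \<eta>^c sends into \<open>U\<close>.\<close>
  obtain u where u: "u \<in> W" "(\<eta> ^^ Suc d) u \<in> U" "(\<eta> ^^ d) u \<notin> img U W (Suc d)"
    by (rule cols_descent_vector[OF st(1,4) cn(2)])
  have uH: "u \<in> H"
  proof -
    have "u \<in> pre U W (Suc d)" unfolding pre_def using u(1,2) by simp
    then show ?thesis using pre_mono[OF st(1), of "Suc d" c W] dc e(1) unfolding ec by auto
  qed
  obtain v where v: "v \<in> M" "v \<notin> img U H (Suc d)" using d'(2) unfolding d'd by blast
  \<comment> \<open>In \<open>W\<close> the vector \<open>v\<close> does lie in
    \<open>img U W (Suc d)\<close>, because d < c. Such a functional exists for \<open>H\<close>
    only, so the endomorphism has to live on H/U.\<close>
  obtain \<phi> where \<phi>: "Vector_Spaces.linear scale (*) \<phi>" "\<phi> v = 1" "\<And>x. x \<in> img U H (Suc d) \<Longrightarrow> \<phi> x = 0"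
    by (rule ex_functional[OF img_subspace[OF sub(1,3)] v(2)]) (rule that)
  interpret deformation scale Basis \<eta> U H d \<phi> u
  proof (intro deformation.intro deformation_axioms.intro)
    show "nilpotent_operator scale Basis \<eta>" by unfold_locales
    show "stable U" "stable H" "U \<subseteq> H" using st inc by auto
    show "Vector_Spaces.linear scale (*) \<phi>" by (rule \<phi>(1))
    show "\<phi> x = 0" if "x \<in> U" for x using \<phi>(3) img_supset[OF sub(3), of U "Suc d"] that by blast
    show "\<phi> ((\<eta> ^^ Suc d) x) = 0" if "x \<in> H" for x by (rule \<phi>(3)[OF power_in_img[OF sub(1) that]])
    show "u \<in> H" by (rule uH)
    show "(\<eta> ^^ Suc d) u \<in> U" by (rule u(2))
  qed
  let ?B = "insert 0 {t. 1 + t * \<phi> ((\<eta> ^^ d) u) = 0}"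
  have nilM: "nil x = \<phi> x *s (\<eta> ^^ d) u" if "x \<in> M" for x
  proof (rule nil_eq_top)
    fix j :: nat assume "0 < j"
    then have "(\<eta> ^^ j) x = (\<eta> ^^ (j - 1)) (\<eta> x)" by (cases j) (simp_all add: funpow_swap1)
    then show "\<phi> ((\<eta> ^^ j) x) = 0"
      using \<phi>U[OF stable_power[OF st(1) codim_one_\<eta>[OF st(1,2) inc(1) dims(1) that]]] by simp
  qed
  have "cols (move t ` M) W = \<beta>" if t: "t \<notin> ?B" for t
  proof -
    have t0: "t \<noteq> 0" and t1: "1 + t * \<phi> ((\<eta> ^^ d) u) \<noteq> 0" using t by auto
    have stM: "stable (move t ` M)" by (rule move_stable[OF st(2) inc(1,2)])
    have UM: "U \<subseteq> move t ` M"
    proof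
      fix x assume x: "x \<in> U"
      then have "x = move t x" by (simp add: move_U)
      then show "x \<in> move t ` M" using x inc(1) by blast
    qed
    have dM: "dim (move t ` M) = dim U + 1" unfolding dim_image_inj[OF move_linear move_inj[OF t1]] by (rule dims(1))
    note subd = img_subspace[OF sub(1,4)]
    have in_d: "move t ` M \<subseteq> img U W d"
    proof
      fix z assume "z \<in> move t ` M"
      then obtain x where x: "x \<in> M" "z = move t x" by blast
      have "x + t *s (\<phi> x *s (\<eta> ^^ d) u) \<in> img U W d"
        using Md x(1) power_in_img[OF sub(1) u(1), of d] by (intro subspace_add[OF subd] subspace_scale[OF subd]) auto
      then show "z \<in> img U W d" unfolding x(2) move_def nilM[OF x(1)] .
    qed
    have not_in: "\<not> move t ` M \<subseteq> img U W (Suc d)"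
    proof
      assume "move t ` M \<subseteq> img U W (Suc d)"
      then have "move t v \<in> img U W (Suc d)" using v(1) by blast
      then have "v + t *s (\<eta> ^^ d) u \<in> img U W (Suc d)" unfolding move_def nilM[OF v(1)] \<phi>(2) by simp
      moreover have "v \<in> img U W (Suc d)" using v(1) Mc(1) img_antimono[OF st(4), of "Suc d" c U] dc by auto
      ultimately have "(v + t *s (\<eta> ^^ d) u) - v \<in> img U W (Suc d)" by (rule subspace_diff[OF subd])
      then have "t *s (\<eta> ^^ d) u \<in> img U W (Suc d)" by simp
      then have "inverse t *s (t *s (\<eta> ^^ d) u) \<in> img U W (Suc d)" by (rule subspace_scale[OF subd])
      then show False using u(3) t0 by simp
    qed
    have "cols U W k = cols (move t ` M) W k + of_bool (k = d)" for k
      by (rule cols_line[OF st(1) stM st(4) UM dM in_d not_in])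
    then have "cols (move t ` M) W k = \<beta> k" for k using \<beta>[of k] by (metis add_right_imp_eq)
    then show ?thesis by (rule ext)
  qed
  then show thesis using that[OF deforms_nil] unfolding move_def by blast
qed

text \<open>Dual to \<open>deform_line\<close>. What counts is the least power of \<eta> that sends
  a vector of \<open>W\<close> outside the hyperplane into \<open>U\<close>. It should be c + 1, but
  for a bad \<open>H\<close> it is d + 1 with d > c. Shearing along a vector \<open>u\<close>
  outside \<open>H\<close> that \<eta>^(c+1) sends into \<open>M\<close> yields a hyperplane that
  misses \<open>x0\<close>, the head of a block of size c + 1 of W/U.\<close>

lemma deform_hyperplane:
  assumes st: "stable U" "stable M" "stable H" "stable W" and inc: "U \<subseteq> M" "M \<subseteq> H" "H \<subseteq> W"
    and dims: "dim M = dim U + 1" "dim W = dim H + 1"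
    and rule: "local_rule (cols U W) \<alpha> (cols M W) (cols M H)" and bad: "cols U H \<noteq> \<alpha>"
  obtains n B where "deforms M W n B" "\<And>t. t \<notin> B \<Longrightarrow> cols U (shear n t ` H) = \<alpha>"
proof -
  note sub = stable_subspace[OF st(1)] stable_subspace[OF st(2)] stable_subspace[OF st(3)] stable_subspace[OF st(4)]
  obtain c d where cd: "\<And>k. cols U W k = \<alpha> k + of_bool (k = c)" "\<And>k. \<alpha> k = cols M H k + of_bool (k = d)"
    and cases: "cols M W = \<alpha> \<and> (c = d \<or> cols U W d \<le> cols U W (Suc d)) \<or>
      c \<noteq> d \<and> cols U W (Suc c) < cols U W c \<and> cols U W (Suc d) < cols U W d \<and> (\<forall>k. cols U W k = cols M W k + of_bool (k = d))"
    using rule unfolding local_rule_def by blast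
  obtain c' where c': "M \<subseteq> img U W c'" "\<not> M \<subseteq> img U W (Suc c')"
    using cols_line_ex[OF st(1,2,4) inc(1) order_trans[OF inc(2,3)] dims(1)] by blast
  note colc' = cols_line[OF st(1,2,4) inc(1) dims(1) c']
  obtain r where r: "M \<subseteq> img U H r" "\<not> M \<subseteq> img U H (Suc r)"
    using cols_line_ex[OF st(1,2,3) inc(1,2) dims(1)] by blast
  note colr = cols_line[OF st(1,2,3) inc(1) dims(1) r]
  obtain q where q: "pre U W q \<subseteq> H" "\<not> pre U W (Suc q) \<subseteq> H"
    using cols_hyperplane_ex[OF st(1,3,4) order_trans[OF inc(1,2)] inc(3) dims(2)] by blast
  note colq = cols_hyperplane[OF st(1,3,4) inc(3) dims(2) q]
  obtain p where p: "pre M W p \<subseteq> H" "\<not> pre M W (Suc p) \<subseteq> H"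
    using cols_hyperplane_ex[OF st(2,3,4) inc(2,3) dims(2)] by blast
  note colp = cols_hyperplane[OF st(2,3,4) inc(3) dims(2) p]
  have perm: "q = c \<and> r = d \<or> q = d \<and> r = c"
  proof (rule of_bool_two_shifts)
    show "cols U W k = cols M H k + of_bool (k = q) + of_bool (k = r)" for k unfolding colq colr by simp
    show "cols U W k = cols M H k + of_bool (k = c) + of_bool (k = d)" for k unfolding cd by simp
  qed
  have "q \<noteq> c"
  proof
    assume "q = c"
    then have "cols U H k = \<alpha> k" for k using colq[of k] cd(1)[of k] by simp
    then show False using bad ext[of "cols U H" \<alpha>] by simp
  qed
  then have qd: "q = d" "c \<noteq> d" using perm by auto
  \<comment> \<open>H/U arises from W/U by shortening column d, so column d of W/U strictly exceeds
    the next one. This leaves only the second alternative of the local rule.\<close>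
  have "cols U H (Suc d) \<le> cols U H d" by (rule cols_antimono[OF st(1,3) order_trans[OF inc(1,2)]])
  then have "cols U W (Suc d) < cols U W d" using colq[of d] colq[of "Suc d"] qd by simp
  then have cn: "cols U W (Suc c) < cols U W c" and \<beta>: "\<And>k. cols U W k = cols M W k + of_bool (k = d)"
    using cases qd(2) by auto
  have c'd: "c' = d" by (rule of_bool_shift_unique[OF colc' \<beta>])
  have "c' = c \<and> p = d \<or> c' = d \<and> p = c"
  proof (rule of_bool_two_shifts)
    show "cols U W k = cols M H k + of_bool (k = c') + of_bool (k = p)" for k unfolding colc' colp by simp
    show "cols U W k = cols M H k + of_bool (k = c) + of_bool (k = d)" for k unfolding cd by simp
  qed
  then have pc: "p = c" using c'd qd by auto
  have preM: "pre U W k \<subseteq> pre M W k" for k unfolding pre_def using inc(1) by blast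
  have lt: "c < d"
  proof (rule ccontr)
    assume "\<not> c < d"
    then have "pre U W (Suc d) \<subseteq> pre U W c" using qd by (intro pre_mono[OF st(1)]) simp
    then show False using preM[of c] p(1) q(2) unfolding pc qd(1) by blast
  qed
  obtain x0 where x0: "x0 \<in> W" "(\<eta> ^^ Suc c) x0 \<in> U" "(\<eta> ^^ c) x0 \<notin> img U W (Suc c)"
    by (rule cols_descent_vector[OF st(1,4) cn])
  \<comment> \<open>As the depth d of \<open>M\<close> in \<open>W\<close> exceeds c, enlarging
    \<open>U\<close> to \<open>M\<close> adds nothing to the image of \<eta>^(c+1). So \<eta>^c x0
    stays outside it, and \<phi> can be chosen on W/M.\<close>
  have Mimg: "M \<subseteq> img U W (Suc c)"
    using c'(1) img_antimono[OF st(4), of "Suc c" d U] lt unfolding c'd by auto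
  have x0M: "(\<eta> ^^ c) x0 \<notin> img M W (Suc c)"
  proof
    assume "(\<eta> ^^ c) x0 \<in> img M W (Suc c)"
    then obtain w where w: "w \<in> W" "(\<eta> ^^ c) x0 - (\<eta> ^^ Suc c) w \<in> M" unfolding img_def by blast
    have "((\<eta> ^^ c) x0 - (\<eta> ^^ Suc c) w) + (\<eta> ^^ Suc c) w \<in> img U W (Suc c)"
      by (rule subspace_add[OF img_subspace[OF sub(1,4)] subsetD[OF Mimg w(2)] power_in_img[OF sub(1) w(1)]])
    then show False using x0(3) by simp
  qed
  obtain \<phi> where \<phi>: "Vector_Spaces.linear scale (*) \<phi>" "\<phi> ((\<eta> ^^ c) x0) = 1" "\<And>x. x \<in> img M W (Suc c) \<Longrightarrow> \<phi> x = 0"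
    by (rule ex_functional[OF img_subspace[OF sub(2,4)] x0M]) (rule that)
  \<comment> \<open>Here \<eta>^(c+1) u is in \<open>M\<close> but not in \<open>U\<close>, because
    \<open>H\<close> contains whatever \<eta>^d sends into \<open>U\<close> and c < d. Hence the
    endomorphism has to live on W/M.\<close>
  obtain u where u: "u \<in> W" "(\<eta> ^^ Suc c) u \<in> M" "u \<notin> H" using p(2) unfolding pre_def pc by blast
  interpret deformation scale Basis \<eta> M W c \<phi> u
  proof (intro deformation.intro deformation_axioms.intro)
    show "nilpotent_operator scale Basis \<eta>" by unfold_locales
    show "stable M" "stable W" "M \<subseteq> W" using st inc by auto
    show "Vector_Spaces.linear scale (*) \<phi>" by (rule \<phi>(1))
    show "\<phi> x = 0" if "x \<in> M" for x using \<phi>(3) img_supset[OF sub(4), of M "Suc c"] that by blast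
    show "\<phi> ((\<eta> ^^ Suc c) x) = 0" if "x \<in> W" for x by (rule \<phi>(3)[OF power_in_img[OF sub(2) that]])
    show "u \<in> W" by (rule u(1))
    show "(\<eta> ^^ Suc c) u \<in> M" by (rule u(2))
  qed
  let ?B = "insert 0 {t. 1 + t * \<phi> ((\<eta> ^^ c) u) = 0}"
  have \<eta>W: "\<eta> x \<in> H" if "x \<in> W" for x by (rule codim_one_\<eta>[OF st(3,4) inc(3) dims(2) that])
  have x0H: "x0 \<in> H"
  proof -
    have "x0 \<in> pre U W (Suc c)" unfolding pre_def using x0(1,2) by simp
    then show ?thesis using pre_mono[OF st(1), of "Suc c" d W] lt q(1) unfolding qd by auto
  qed
  have "cols U (move t ` H) = \<alpha>" if t: "t \<notin> ?B" for t
  proof -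
    have t0: "t \<noteq> 0" and t1: "1 + t * \<phi> ((\<eta> ^^ c) u) \<noteq> 0" using t by auto
    have mW: "move t ` H \<subseteq> W" using move_H inc(3) by blast
    have "move t ` M = (\<lambda>x. x) ` M" by (rule image_cong[OF refl]) (rule move_U)
    then have mM: "move t ` M = M" by simp
    have MH: "M \<subseteq> move t ` H" using mM inc(2) by blast
    have dH: "dim W = dim (move t ` H) + 1" unfolding dim_image_inj[OF move_linear move_inj[OF t1]] by (rule dims(2))
    have stH': "stable (move t ` H)" by (rule move_stable[OF st(3) inc(2,3)])
    have "cols (move t ` M) (move t ` H) = cols M H"
      unfolding cols_def move_img[OF st(2,3) order_refl inc(3)] dim_image_inj[OF move_linear move_inj[OF t1]] ..
    then have colM: "cols M (move t ` H) = cols M H" unfolding mM .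
    obtain p' where p': "pre M W p' \<subseteq> move t ` H" "\<not> pre M W (Suc p') \<subseteq> move t ` H"
      using cols_hyperplane_ex[OF st(2) stH' st(4) MH mW dH] by blast
    \<comment> \<open>H/M and its image have the same type, so the moved hyperplane contains the
      same kernel modulo \<open>M\<close>, and a fortiori the kernel modulo
      \<open>U\<close>.\<close>
    have "p' = p"
      by (rule of_bool_shift_unique[OF cols_hyperplane[OF st(2) stH' st(4) mW dH p', unfolded colM] colp])
    then have pre_in: "pre U W c \<subseteq> move t ` H" using p'(1) preM[of c] unfolding pc by blast
    \<comment> \<open>If \<open>x0\<close> were the image of y in \<open>H\<close>, then
      \<open>nil y\<close> would lie in \<open>H\<close>. All its terms except the multiple
      \<phi>(\<eta>^c y) of \<open>u\<close> lie in \<eta> W, hence in \<open>H\<close>, so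
      \<phi>(\<eta>^c y) = 0. But then \<eta>^c x0 and \<eta>^c y agree modulo \<open>M\<close>,
      whereas \<phi>(\<eta>^c x0) = 1.\<close>
    have pre_not: "\<not> pre U W (Suc c) \<subseteq> move t ` H"
    proof
      assume "pre U W (Suc c) \<subseteq> move t ` H"
      moreover have "x0 \<in> pre U W (Suc c)" unfolding pre_def using x0(1,2) by simp
      ultimately obtain y where y: "y \<in> H" "x0 = move t y" by blast
      have yW: "y \<in> W" using y(1) inc(3) by blast
      have "inverse t *s (x0 - y) \<in> H" using subspace_scale[OF sub(3) subspace_diff[OF sub(3) x0H y(1)]] .
      then have nH: "nil y \<in> H" using t0 unfolding y(2) move_def by simp
      have split: "nil y = \<phi> ((\<eta> ^^ c) y) *s u + (\<Sum>k<c. \<phi> ((\<eta> ^^ (c - Suc k)) y) *s (\<eta> ^^ Suc k) u)"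
        unfolding nil_def lessThan_Suc_atMost[symmetric] by (subst sum.lessThan_Suc_shift) simp
      have "(\<Sum>k<c. \<phi> ((\<eta> ^^ (c - Suc k)) y) *s (\<eta> ^^ Suc k) u) \<in> H"
      proof (intro subspace_sum[OF sub(3)] subspace_scale[OF sub(3)])
        fix k show "(\<eta> ^^ Suc k) u \<in> H" using \<eta>W[OF stable_power[OF st(4) u(1), of k]] by simp
      qed
      then have "nil y - (\<Sum>k<c. \<phi> ((\<eta> ^^ (c - Suc k)) y) *s (\<eta> ^^ Suc k) u) \<in> H" by (rule subspace_diff[OF sub(3) nH])
      then have uH: "\<phi> ((\<eta> ^^ c) y) *s u \<in> H" unfolding split by simp
      have z0: "\<phi> ((\<eta> ^^ c) y) = 0"
      proof (rule ccontr)
        assume a: "\<phi> ((\<eta> ^^ c) y) \<noteq> 0"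
        have "inverse (\<phi> ((\<eta> ^^ c) y)) *s (\<phi> ((\<eta> ^^ c) y) *s u) \<in> H" by (rule subspace_scale[OF sub(3) uH])
        then show False using a u(3) by simp
      qed
      have "nil ((\<eta> ^^ c) y) = \<phi> ((\<eta> ^^ c) y) *s (\<eta> ^^ c) u"
      proof (rule nil_eq_top)
        fix j :: nat assume "0 < j"
        then show "\<phi> ((\<eta> ^^ j) ((\<eta> ^^ c) y)) = 0" unfolding power_power by (intro \<phi>_power yW) simp
      qed
      then have "move t ((\<eta> ^^ c) y) = (\<eta> ^^ c) y" unfolding move_def z0 by simp
      then have "(\<eta> ^^ c) x0 - (\<eta> ^^ c) y \<in> M" using move_power_commute[OF yW, of c t] unfolding y(2) by simp
      then have "\<phi> ((\<eta> ^^ c) x0 - (\<eta> ^^ c) y) = 0" by (rule \<phi>U)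
      then have "\<phi> ((\<eta> ^^ c) x0) = \<phi> ((\<eta> ^^ c) y)" unfolding \<phi>_lin(3) by simp
      then show False using z0 \<phi>(2) by simp
    qed
    have "cols U W k = cols U (move t ` H) k + of_bool (k = c)" for k
      by (rule cols_hyperplane[OF st(1) stH' st(4) mW dH pre_in pre_not])
    then have "cols U (move t ` H) k = \<alpha> k" for k using cd(1)[of k] by (metis add_right_imp_eq)
    then show ?thesis by (rule ext)
  qed
  then show thesis using that[OF deforms_nil] unfolding move_def by blast
qed

end

section \<open>Closures in the flag variety\<close>

definition polynomial_function :: "('a::field \<Rightarrow> 'a) \<Rightarrow> bool" where
  "polynomial_function g \<longleftrightarrow> (\<exists>q. \<forall>t. g t = poly q t)"

lemma polynomial_function_const: "polynomial_function (\<lambda>_. c)"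
  unfolding polynomial_function_def by (intro exI[of _ "[:c:]"]) simp

lemma polynomial_function_affine: "polynomial_function (\<lambda>t. a + t * b)"
  unfolding polynomial_function_def by (intro exI[of _ "[:a, b:]"]) simp

lemma polynomial_function_add:
  "polynomial_function f \<Longrightarrow> polynomial_function g \<Longrightarrow> polynomial_function (\<lambda>t. f t + g t)"
  unfolding polynomial_function_def by (metis poly_add)

lemma polynomial_function_mult:
  "polynomial_function f \<Longrightarrow> polynomial_function g \<Longrightarrow> polynomial_function (\<lambda>t. f t * g t)"
  unfolding polynomial_function_def by (metis poly_mult)

lemma polynomial_function_power: "polynomial_function f \<Longrightarrow> polynomial_function (\<lambda>t. f t ^ k)"
  by (induction k) (simp_all add: polynomial_function_const polynomial_function_mult)

lemma polynomial_function_sum: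
  "(\<And>i. i \<in> I \<Longrightarrow> polynomial_function (f i)) \<Longrightarrow> polynomial_function (\<lambda>t. \<Sum>i\<in>I. f i t)"
  by (induction I rule: infinite_finite_induct) (simp_all add: polynomial_function_const polynomial_function_add)

lemma polynomial_function_prod:
  "(\<And>i. i \<in> I \<Longrightarrow> polynomial_function (f i)) \<Longrightarrow> polynomial_function (\<lambda>t. \<Prod>i\<in>I. f i t)"
  by (induction I rule: infinite_finite_induct) (simp_all add: polynomial_function_const polynomial_function_mult)

lemma polynomial_function_det:
  assumes "\<And>i j. i < n \<Longrightarrow> j < n \<Longrightarrow> polynomial_function (\<lambda>t. A t i j)"
  shows "polynomial_function (\<lambda>t. det (mat n n (\<lambda>(i, j). A t i j)))"
proof -
  have "det (mat n n (\<lambda>(i, j). A t i j)) = (\<Sum>p | p permutes {0..<n}. signof p * (\<Prod>i = 0..<n. A t i (p i)))" for t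
  proof -
    let ?A = "mat n n (\<lambda>(i, j). A t i j)"
    have "det ?A = (\<Sum>p | p permutes {0..<n}. signof p * (\<Prod>i = 0..<n. ?A $$ (i, p i)))" by (rule det_def') simp
    also have "\<dots> = (\<Sum>p | p permutes {0..<n}. signof p * (\<Prod>i = 0..<n. A t i (p i)))"
      by (intro sum.cong refl arg_cong2[where f = "(*)"] prod.cong) (auto simp: permutes_in_image)
    finally show ?thesis .
  qed
  then show ?thesis
    by (simp only:) (intro polynomial_function_sum polynomial_function_mult polynomial_function_const
      polynomial_function_prod assms, auto simp: permutes_in_image)
qed

lemma finite_zeros_polynomial_function:
  assumes "polynomial_function g" "g a \<noteq> 0"
  shows "finite {t. g t = 0}"
proof -
  obtain q where q: "\<And>t. g t = poly q t" using assms(1) unfolding polynomial_function_def by blast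
  then have "q \<noteq> 0" using assms(2) by auto
  then show ?thesis using poly_roots_finite[of q] q by simp
qed

context finite_dimensional_vector_space
begin

lemma complete_flagsD:
  assumes "f \<in> complete_flags"
  shows "length f = Suc dimension" "f ! 0 = {0}" "f ! dimension = UNIV"
    "i \<le> dimension \<Longrightarrow> subspace (f ! i)" "i \<le> dimension \<Longrightarrow> dim (f ! i) = i"
    "i < dimension \<Longrightarrow> f ! i \<subset> f ! Suc i"
  using assms unfolding complete_flags_def by auto

lemma complete_flags_mono:
  assumes "f \<in> complete_flags" "i \<le> j" "j \<le> dimension"
  shows "f ! i \<subseteq> f ! j"
  using assms(2,3)
proof (induction j rule: dec_induct)
  case (step j)
  then show ?case using complete_flagsD(6)[OF assms(1), of j] by auto
qed simp

lemma ex_adapted_basis: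
  assumes f: "f \<in> complete_flags"
  shows "\<exists>vs. adapted_basis f vs"
proof -
  have "\<exists>v. v \<in> f ! Suc i \<and> v \<notin> f ! i" if "i < dimension" for i using complete_flagsD(6)[OF f that] by blast
  then obtain v where v: "\<And>i. i < dimension \<Longrightarrow> v i \<in> f ! Suc i \<and> v i \<notin> f ! i" by metis
  let ?vs = "map v [0..<dimension]"
  have "span (set (take i ?vs)) = f ! i" if "i \<le> dimension" for i
    using that
  proof (induction i)
    case 0
    then show ?case using complete_flagsD(2)[OF f] by simp
  next
    case (Suc i)
    then have i: "i < dimension" and IH: "span (set (take i ?vs)) = f ! i" by auto
    have "set (take (Suc i) ?vs) = insert (v i) (set (take i ?vs))" using i by (simp add: take_Suc_conv_app_nth)
    then have "span (set (take (Suc i) ?vs)) = span (insert (v i) (f ! i))"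
      by (metis IH span_insert span_span)
    also have "\<dots> = f ! Suc i"
    proof (rule subspace_dim_equal)
      show "subspace (f ! Suc i)" using complete_flagsD(4)[OF f] i by simp
      then show "span (insert (v i) (f ! i)) \<subseteq> f ! Suc i"
        using v[OF i] complete_flagsD(6)[OF f i] by (intro span_minimal) auto
      have span: "span (f ! i) = f ! i" using complete_flagsD(4)[OF f, of i] i by (simp add: span_eq_iff)
      show "dim (f ! Suc i) \<le> dim (span (insert (v i) (f ! i)))"
        unfolding dim_span dim_insert span
        using v[OF i] complete_flagsD(5)[OF f, of i] complete_flagsD(5)[OF f, of "Suc i"] i by simp
    qed simp
    finally show ?case .
  qed
  then have "adapted_basis f ?vs" unfolding adapted_basis_def by simp
  then show ?thesis by blast
qed

lemma topspace_flag_variety: "topspace flag_variety = complete_flags"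
proof -
  let ?p = "Poly_Mapping.single (0 :: 'b list \<Rightarrow>\<^sub>0 nat) (1 :: 'a)"
  have "multihomogeneous ?p" unfolding multihomogeneous_def by simp
  moreover have "eval_poly ?p x = 1" for x unfolding eval_poly_def by simp
  \<comment> \<open>\<open>zero_locus\<close> asks for vanishing on all adapted bases, so emptiness
    requires that every flag have at least one.\<close>
  then have "zero_locus ?p = {}" unfolding zero_locus_def using ex_adapted_basis by auto
  ultimately have "complete_flags \<in> {complete_flags - zero_locus p | p. multihomogeneous p}" by fastforce
  then show ?thesis unfolding flag_variety_def topology_generated_by_topspace by blast
qed

end

context nilpotent_operator
begin

definition move_flag :: "('b \<Rightarrow> 'b) \<Rightarrow> 'a \<Rightarrow> 'b set list \<Rightarrow> 'b set list" where
  "move_flag n t f = map ((`) (shear n t)) f"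

lemma move_flag_nth:
  "f \<in> complete_flags \<Longrightarrow> i \<le> dimension \<Longrightarrow> move_flag n t f ! i = shear n t ` (f ! i)"
  unfolding move_flag_def using complete_flagsD(1)[of f] by simp

lemma move_flag_complete:
  assumes f: "f \<in> complete_flags" and n: "Vector_Spaces.linear scale scale n" and inj: "inj (shear n t)"
  shows "move_flag n t f \<in> complete_flags"
proof -
  let ?g = "shear n t"
  note lin = deform_linear[OF n, of t]
  have n0: "n 0 = 0"
  proof -
    interpret Vector_Spaces.linear scale scale n by (rule n)
    show ?thesis by (rule zero)
  qed
  have nth: "move_flag n t f ! i = ?g ` (f ! i)" if "i \<le> dimension" for i by (rule move_flag_nth[OF f that])
  show ?thesis unfolding complete_flags_def
  proof (intro CollectI conjI allI impI)
    show "length (move_flag n t f) = Suc dimension" unfolding move_flag_def using complete_flagsD(1)[OF f] by simp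
    show "move_flag n t f ! 0 = {0}" using nth[of 0] complete_flagsD(2)[OF f] n0 by simp
    show "move_flag n t f ! dimension = UNIV"
      using nth[of dimension] complete_flagsD(3)[OF f] linear_inj_imp_surj[OF lin inj] by simp
    show "subspace (move_flag n t f ! i)" if "i \<le> dimension" for i
      unfolding nth[OF that] by (rule subspace_linear_image[OF lin complete_flagsD(4)[OF f that]])
    show "dim (move_flag n t f ! i) = i" if "i \<le> dimension" for i
      unfolding nth[OF that] dim_image_inj[OF lin inj] by (rule complete_flagsD(5)[OF f that])
    show "move_flag n t f ! i \<subset> move_flag n t f ! Suc i" if "i < dimension" for i
    proof -
      have "?g ` (f ! i) \<subset> ?g ` (f ! Suc i)"
        using complete_flagsD(6)[OF f that] inj by (metis image_strict_mono inj_on_subset subset_UNIV)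
      then show ?thesis using nth[of i] nth[of "Suc i"] that by simp
    qed
  qed
qed

lemma polynomial_function_pluecker:
  assumes vs: "length vs = dimension" and bs: "distinct bs" "set bs \<subseteq> Basis"
  shows "polynomial_function (\<lambda>t. pluecker_coord (map (shear n t) vs) bs)"
proof -
  have len: "length bs \<le> dimension" unfolding dimension_def using distinct_card[OF bs(1)] card_mono[OF finite_Basis bs(2)] by simp
  have "polynomial_function (\<lambda>t. representation Basis (map (shear n t) vs ! l) (bs ! k))"
    if "l < length bs" for k l
  proof -
    have "l < length vs" using that len vs by simp
    then have "representation Basis (map (shear n t) vs ! l) (bs ! k) =
      representation Basis (vs ! l) (bs ! k) + t * representation Basis (n (vs ! l)) (bs ! k)" for t
      by (simp add: representation_add representation_scale independent_Basis span_Basis)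
    then show ?thesis by (simp add: polynomial_function_affine)
  qed
  then show ?thesis unfolding pluecker_coord_def by (intro polynomial_function_det) simp
qed

text \<open>The Pluecker coordinates of the flags \<open>(1 + t n) f\<close> are polynomials in \<open>t\<close>.\<close>

lemma finite_outside_neighbourhood:
  assumes f: "f \<in> complete_flags" and n: "Vector_Spaces.linear scale scale n"
    and B: "finite B" "\<And>t. t \<notin> B \<Longrightarrow> inj (shear n t)"
    and X: "openin flag_variety X" "f \<in> X"
  shows "finite {t. move_flag n t f \<notin> X}"
proof -
  have "generate_topology_on {complete_flags - zero_locus p | p. multihomogeneous p} X"
    using X(1) unfolding flag_variety_def openin_topology_generated_by_iff .
  then show ?thesis using X(2)
  proof (induction X rule: generate_topology_on.induct)
    case Empty
    then show ?case by simp
  next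
    case (Int a b)
    then have "finite ({t. move_flag n t f \<notin> a} \<union> {t. move_flag n t f \<notin> b})" by simp
    then show ?case by (rule rev_finite_subset) auto
  next
    case (UN K)
    then obtain k where "k \<in> K" "f \<in> k" by blast
    then have "finite {t. move_flag n t f \<notin> k}" using UN by blast
    then show ?case by (rule rev_finite_subset) (use \<open>k \<in> K\<close> in auto)
  next
    case (Basis s)
    then obtain p where p: "s = complete_flags - zero_locus p" "multihomogeneous p" by blast
    then obtain vs where vs: "adapted_basis f vs" "eval_poly p (pluecker_coord vs) \<noteq> 0"
      using Basis f unfolding zero_locus_def by blast
    let ?vs = "\<lambda>t. map (shear n t) vs"
    have len: "length vs = dimension" using vs(1) unfolding adapted_basis_def by simp
    have poly: "polynomial_function (\<lambda>t. eval_poly p (pluecker_coord (?vs t)))" unfolding eval_poly_def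
    proof (intro polynomial_function_sum polynomial_function_mult polynomial_function_const
        polynomial_function_prod polynomial_function_power)
      fix m bs assume "m \<in> Poly_Mapping.keys p" "bs \<in> Poly_Mapping.keys m"
      then have "distinct bs" "set bs \<subseteq> Basis" using p(2) unfolding multihomogeneous_def by auto
      then show "polynomial_function (\<lambda>t. pluecker_coord (?vs t) bs)" by (rule polynomial_function_pluecker[OF len])
    qed
    \<comment> \<open>The parameter 0 gives back \<open>vs\<close>, so the polynomial in t is not
      identically zero.\<close>
    have "eval_poly p (pluecker_coord (?vs 0)) \<noteq> 0" using vs(2) by simp
    from finite_zeros_polynomial_function[OF poly this]
    have fin: "finite (B \<union> {t. eval_poly p (pluecker_coord (?vs t)) = 0})" using B(1) by simp
    have "move_flag n t f \<in> s" if t: "t \<notin> B" "eval_poly p (pluecker_coord (?vs t)) \<noteq> 0" for t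
    proof -
      have "adapted_basis (move_flag n t f) (?vs t)" unfolding adapted_basis_def
      proof (intro conjI allI impI)
        show "length (?vs t) = dimension" using len by simp
        fix i assume i: "i \<le> dimension"
        interpret Vector_Spaces.linear scale scale "shear n t" by (rule deform_linear[OF n])
        have "span (set (take i (?vs t))) = shear n t ` span (set (take i vs))"
          unfolding take_map set_map by (rule span_image)
        then show "span (set (take i (?vs t))) = move_flag n t f ! i"
          using vs(1) i move_flag_nth[OF f i, of n t] unfolding adapted_basis_def by simp
      qed
      then show ?thesis using t(2) move_flag_complete[OF f n B(2)[OF t(1)]] unfolding p(1) zero_locus_def by blast
    qed
    then show ?case by (intro finite_subset[OF _ fin]) blast
  qed
qed

lemma closure_of_move_flag:
  assumes inf: "infinite (UNIV :: 'a set)" and f: "f \<in> stable_flags \<eta>"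
    and n: "Vector_Spaces.linear scale scale n"
    and B: "finite B" "\<And>t. t \<notin> B \<Longrightarrow> inj (shear n t)"
    and S: "\<And>t. t \<notin> B \<Longrightarrow> move_flag n t f \<in> S" "S \<subseteq> stable_flags \<eta>"
  shows "f \<in> stable_flag_variety \<eta> closure_of S"
  unfolding in_closure_of
proof (intro conjI allI impI)
  have fc: "f \<in> complete_flags" using f unfolding stable_flags_def by simp
  then show "f \<in> topspace (stable_flag_variety \<eta>)"
    unfolding stable_flag_variety_def topspace_subtopology topspace_flag_variety using f by simp
  fix X assume "f \<in> X \<and> openin (stable_flag_variety \<eta>) X"
  then obtain O' where O': "openin flag_variety O'" "X = O' \<inter> stable_flags \<eta>" "f \<in> O'"
    unfolding stable_flag_variety_def openin_subtopology by blast
  have "finite (B \<union> {t. move_flag n t f \<notin> O'})"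
    using finite_outside_neighbourhood[OF fc n B O'(1,3)] B(1) by simp
  then obtain t where t: "t \<notin> B" "move_flag n t f \<in> O'" using inf ex_new_if_finite[OF inf] by blast
  then have "move_flag n t f \<in> S \<and> move_flag n t f \<in> X" using S O'(2) by blast
  then show "\<exists>y. y \<in> S \<and> y \<in> X" by blast
qed

end

section \<open>Flags and growth diagrams\<close>

context nilpotent_operator
begin

lemma stable_flagsD:
  assumes "f \<in> stable_flags \<eta>"
  shows "f \<in> complete_flags" "i \<le> dimension \<Longrightarrow> stable (f ! i)"
  using assms complete_flagsD(4)[of f i] unfolding stable_flags_def stable_def by auto

lemma stable_zero: "stable {0}" and stable_UNIV: "stable UNIV"
  unfolding stable_def by (simp_all add: subspace_UNIV)

lemma cols_refl: "stable U \<Longrightarrow> cols U U k = 0"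
proof -
  assume U: "stable U"
  note sub = stable_subspace[OF U]
  have "img U U k = U" for k
    using img_antimono[OF U, of 0 k U] img_0[OF sub sub order_refl] img_supset[OF sub, of U k] by auto
  then show ?thesis unfolding cols_def by simp
qed

text \<open>The diagrams are nested because passing to a hyperplane only shortens a column. Writing
  \<open>f ! 0\<close> for the zero subspace gives the condition the form of row 0 of the
  array.\<close>

lemma r_tableau_eq_iff:
  assumes f: "f \<in> stable_flags \<eta>" and T: "T \<in> standard_tableaux (jordan_type \<eta> {0} UNIV)"
  shows "r_tableau \<eta> f = T \<longleftrightarrow> (\<forall>j\<le>dimension. cols (f ! 0) (f ! j) = column_length (dom (entries_below T j)))"
proof -
  let ?Y = "\<lambda>j. young_diagram (jordan_type \<eta> {0} (f ! j))"
  note fc = stable_flagsD(1)[OF f]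
  have st: "stable (f ! j)" "{0} \<subseteq> f ! j" if "j \<le> dimension" for j
    using stable_flagsD(2)[OF f that] subspace_0[OF complete_flagsD(4)[OF fc that]] by auto
  interpret diagram_chain ?Y dimension
  proof
    fix j assume j: "j \<le> dimension"
    show "young_set (?Y j)" by (rule jordan_type_young(1)[OF stable_zero st[OF j]])
    show "card (?Y j) = j" using jordan_type_young(3)[OF stable_zero st[OF j]] complete_flagsD(5)[OF fc j] by simp
  next
    fix j assume j: "j < dimension"
    then have j': "j \<le> dimension" "Suc j \<le> dimension" by auto
    have d: "dim (f ! Suc j) = dim (f ! j) + 1" using complete_flagsD(5)[OF fc] j' by simp
    have inc: "f ! j \<subseteq> f ! Suc j" using complete_flagsD(6)[OF fc j] by blast
    obtain c where c: "pre {0} (f ! Suc j) c \<subseteq> f ! j" "\<not> pre {0} (f ! Suc j) (Suc c) \<subseteq> f ! j"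
      by (rule cols_hyperplane_ex[OF stable_zero st(1)[OF j'(1)] st(1)[OF j'(2)] st(2)[OF j'(1)] inc d])
    have le: "cols {0} (f ! j) k \<le> cols {0} (f ! Suc j) k" for k
      using cols_hyperplane[OF stable_zero st(1)[OF j'(1)] st(1)[OF j'(2)] inc d c, of k] by simp
    show "?Y j \<subseteq> ?Y (Suc j)"
    proof
      fix s assume s: "s \<in> ?Y j"
      obtain a b where ab: "s = (a, b)" by (cases s)
      have "a < cols {0} (f ! j) b"
        using s young_set_column[OF jordan_type_young(1)[OF stable_zero st[OF j'(1)]], of a b]
        unfolding ab jordan_type_young(2)[OF stable_zero st[OF j'(1)]] by simp
      then have "a < cols {0} (f ! Suc j) b" using le[of b] by simp
      then show "s \<in> ?Y (Suc j)"
        using young_set_column[OF jordan_type_young(1)[OF stable_zero st[OF j'(2)]], of a b]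
        unfolding ab jordan_type_young(2)[OF stable_zero st[OF j'(2)]] by simp
    qed
  qed
  have last: "row_lengths (?Y dimension) = jordan_type \<eta> {0} UNIV"
    unfolding row_lengths_young_diagram complete_flagsD(3)[OF fc] ..
  have "r_tableau \<eta> f = T \<longleftrightarrow> (\<forall>j\<le>dimension. dom (entries_below T j) = ?Y j)"
    using the_tableau_eq_iff[of T] T unfolding last unfolding r_tableau_def row_lengths_young_diagram by blast
  also have "\<dots> \<longleftrightarrow> (\<forall>j\<le>dimension. cols (f ! 0) (f ! j) = column_length (dom (entries_below T j)))"
  proof -
    have "young_set (dom (entries_below T j))" for j
      using T is_filling_entries_below unfolding standard_tableaux_iff is_filling_def by blast
    then show ?thesis
      unfolding complete_flagsD(2)[OF fc] using young_diagram_eq_iff[OF stable_zero st] by simp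
  qed
  finally show ?thesis .
qed

lemma q_tableau_eq_iff:
  assumes f: "f \<in> stable_flags \<eta>" and T: "T \<in> standard_tableaux (jordan_type \<eta> {0} UNIV)"
  shows "q_tableau \<eta> f = T \<longleftrightarrow>
    (\<forall>i\<le>dimension. cols (f ! i) (f ! dimension) = column_length (dom (entries_below T (dimension - i))))"
proof -
  \<comment> \<open>Quotients by larger members have smaller diagrams; indexing by the dimension j
    of the quotient makes the chain grow.\<close>
  let ?Y = "\<lambda>j. young_diagram (jordan_type \<eta> (f ! (dimension - j)) UNIV)"
  note fc = stable_flagsD(1)[OF f]
  have st: "stable (f ! i)" if "i \<le> dimension" for i by (rule stable_flagsD(2)[OF f that])
  note young = jordan_type_young[OF st stable_UNIV subset_UNIV]
  interpret diagram_chain ?Y dimension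
  proof
    fix j assume j: "j \<le> dimension"
    show "young_set (?Y j)" by (rule young(1)) simp
    have "dim (UNIV :: 'b set) = dimension" by (simp add: dimension_def)
    then show "card (?Y j) = j" using young(3)[of "dimension - j"] complete_flagsD(5)[OF fc, of "dimension - j"] j by simp
  next
    fix j assume j: "j < dimension"
    define i where "i = dimension - Suc j"
    have i: "i < dimension" "dimension - j = Suc i" "dimension - Suc j = i" using j unfolding i_def by auto
    then have i': "i \<le> dimension" "Suc i \<le> dimension" by auto
    have d: "dim (f ! Suc i) = dim (f ! i) + 1" using complete_flagsD(5)[OF fc] i' by simp
    have inc: "f ! i \<subseteq> f ! Suc i" using complete_flagsD(6)[OF fc i(1)] by blast
    obtain c where c: "f ! Suc i \<subseteq> img (f ! i) UNIV c" "\<not> f ! Suc i \<subseteq> img (f ! i) UNIV (Suc c)"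
      by (rule cols_line_ex[OF st[OF i'(1)] st[OF i'(2)] stable_UNIV inc subset_UNIV d])
    have le: "cols (f ! Suc i) UNIV k \<le> cols (f ! i) UNIV k" for k
      using cols_line[OF st[OF i'(1)] st[OF i'(2)] stable_UNIV inc d c, of k] by simp
    show "?Y j \<subseteq> ?Y (Suc j)"
    proof
      fix s assume s: "s \<in> ?Y j"
      obtain a b where ab: "s = (a, b)" by (cases s)
      have "a < cols (f ! Suc i) UNIV b"
        using s young_set_column[OF young(1)[OF i'(2)], of a b] unfolding ab i young(2)[OF i'(2)] by simp
      then have "a < cols (f ! i) UNIV b" using le[of b] by simp
      then show "s \<in> ?Y (Suc j)"
        using young_set_column[OF young(1)[OF i'(1)], of a b] unfolding ab i young(2)[OF i'(1)] by simp
    qed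
  qed
  have last: "row_lengths (?Y dimension) = jordan_type \<eta> {0} UNIV"
    unfolding row_lengths_young_diagram diff_self_eq_0 complete_flagsD(2)[OF fc] ..
  have chain: "map (\<lambda>k. row_lengths (?Y (dimension - k))) [0..<Suc dimension] =
    map (\<lambda>i. jordan_type \<eta> (f ! i) UNIV) [0..<Suc dimension]"
    unfolding row_lengths_young_diagram by (intro map_cong refl) auto
  have "q_tableau \<eta> f = T \<longleftrightarrow> (\<forall>j\<le>dimension. dom (entries_below T j) = ?Y j)"
    using the_tableau_eq_iff[of T] T unfolding last chain unfolding q_tableau_def by blast
  also have "\<dots> \<longleftrightarrow> (\<forall>i\<le>dimension. dom (entries_below T (dimension - i)) = young_diagram (jordan_type \<eta> (f ! i) UNIV))"
    by (metis diff_diff_cancel diff_le_self)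
  also have "\<dots> \<longleftrightarrow> (\<forall>i\<le>dimension. cols (f ! i) (f ! dimension) = column_length (dom (entries_below T (dimension - i))))"
  proof -
    have "young_set (dom (entries_below T j))" for j
      using T is_filling_entries_below unfolding standard_tableaux_iff is_filling_def by blast
    then show ?thesis
      unfolding complete_flagsD(3)[OF fc] using young_diagram_eq_iff[OF st stable_UNIV subset_UNIV] by simp
  qed
  finally show ?thesis .
qed

text \<open>Only the members strictly between a and b move. So a cell keeps its type if both indices
  lie in [a, b], by the properties of \<open>deforms\<close>, or if neither lies strictly between a
  and b. The cells that may change have one index strictly between a and b and the other outside
  [a, b].\<close>

lemma deforms_move_flag:
  assumes f: "f \<in> stable_flags \<eta>" and ab: "a \<le> b" "b \<le> dimension" and n: "deforms (f ! a) (f ! b) n B" and t: "t \<notin> B"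
  shows "move_flag n t f \<in> stable_flags \<eta>"
    "k \<le> a \<Longrightarrow> move_flag n t f ! k = f ! k"
    "b \<le> k \<Longrightarrow> k \<le> dimension \<Longrightarrow> move_flag n t f ! k = f ! k"
    "a \<le> i \<Longrightarrow> i \<le> j \<Longrightarrow> j \<le> b \<Longrightarrow> cols (move_flag n t f ! i) (move_flag n t f ! j) = cols (f ! i) (f ! j)"
proof -
  note fc = stable_flagsD(1)[OF f]
  let ?g = "shear n t"
  have nth: "move_flag n t f ! k = ?g ` (f ! k)" if "k \<le> dimension" for k by (rule move_flag_nth[OF fc that])
  have lin: "Vector_Spaces.linear scale scale n" and ran: "range n \<subseteq> f ! b" and zero: "\<forall>x\<in>f ! a. n x = 0"
    and inj: "inj ?g"
    and pres: "\<And>Y X. stable Y \<Longrightarrow> stable X \<Longrightarrow> f ! a \<subseteq> Y \<Longrightarrow> Y \<subseteq> X \<Longrightarrow> X \<subseteq> f ! b \<Longrightarrow>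
       stable (?g ` X) \<and> cols (?g ` Y) (?g ` X) = cols Y X"
    using n t unfolding deforms_def by auto
  show below: "move_flag n t f ! k = f ! k" if "k \<le> a" for k
  proof -
    have "f ! k \<subseteq> f ! a" using complete_flags_mono[OF fc that] ab by simp
    then have "?g ` (f ! k) = (\<lambda>x. x) ` (f ! k)" using zero by (intro image_cong) auto
    then show ?thesis using nth[of k] that ab by simp
  qed
  show above: "move_flag n t f ! k = f ! k" if "b \<le> k" "k \<le> dimension" for k
    unfolding nth[OF that(2)]
    by (rule deform_image_above[OF lin ran complete_flags_mono[OF fc that] complete_flagsD(4)[OF fc that(2)] inj])
  have mid: "stable (move_flag n t f ! j) \<and> cols (move_flag n t f ! i) (move_flag n t f ! j) = cols (f ! i) (f ! j)"
    if ij: "a \<le> i" "i \<le> j" "j \<le> b" for i j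
  proof -
    have le: "i \<le> dimension" "j \<le> dimension" using ij ab by auto
    show ?thesis unfolding nth[OF le(1)] nth[OF le(2)]
      by (rule pres[OF stable_flagsD(2)[OF f le(1)] stable_flagsD(2)[OF f le(2)]
        complete_flags_mono[OF fc ij(1) le(1)] complete_flags_mono[OF fc ij(2) le(2)] complete_flags_mono[OF fc ij(3) ab(2)]])
  qed
  then show "a \<le> i \<Longrightarrow> i \<le> j \<Longrightarrow> j \<le> b \<Longrightarrow> cols (move_flag n t f ! i) (move_flag n t f ! j) = cols (f ! i) (f ! j)"
    by blast
  have "stable (move_flag n t f ! k)" if "k \<le> dimension" for k
  proof -
    consider "k \<le> a" | "b \<le> k" | "a \<le> k" "k \<le> b" by linarith
    then show ?thesis
    proof cases
      case 1
      then show ?thesis using below stable_flagsD(2)[OF f that] by simp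
    next
      case 2
      then show ?thesis using above[OF 2 that] stable_flagsD(2)[OF f that] by simp
    next
      case 3
      then show ?thesis using mid[of k k] by simp
    qed
  qed
  then show "move_flag n t f \<in> stable_flags \<eta>"
    using move_flag_complete[OF fc lin inj] unfolding stable_flags_def stable_def by simp
qed

lemma closure_of_deformation:
  assumes inf: "infinite (UNIV :: 'a set)" and f: "f \<in> stable_flags \<eta>" and n: "deforms (f ! a) (f ! b) n B"
    and S: "\<And>t. t \<notin> B \<Longrightarrow> move_flag n t f \<in> S" "S \<subseteq> stable_flags \<eta>"
  shows "f \<in> stable_flag_variety \<eta> closure_of S"
  using n S unfolding deforms_def by (intro closure_of_move_flag[OF inf f, of n B S]) auto

end

section \<open>Correcting the cells of the array one at a time\<close>

locale growth_flags = nilpotent_operator scale Basis \<eta>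
  for scale :: "'a::field \<Rightarrow> 'b::ab_group_add \<Rightarrow> 'b" (infixr \<open>*s\<close> 75) and Basis :: "'b set" and \<eta> :: "'b \<Rightarrow> 'b" +
  fixes T :: tableau
  assumes infinite_field: "infinite (UNIV :: 'a set)"
    and standard: "T \<in> standard_tableaux (jordan_type \<eta> {0} UNIV)"
begin

abbreviation cl :: "'b set list set \<Rightarrow> 'b set list set" where
  "cl S \<equiv> stable_flag_variety \<eta> closure_of S"

lemma card_T: "dimension = card (dom T)"
  using standard jordan_type_young(3)[OF stable_zero stable_UNIV] unfolding standard_tableaux_iff
  by (simp add: dimension_def)

definition fits :: "'b set list \<Rightarrow> nat \<Rightarrow> nat \<Rightarrow> bool" where
  "fits f i j \<longleftrightarrow> cols (f ! i) (f ! j) = column_length (growth T i j)"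

lemma fits_diagonal: "f \<in> stable_flags \<eta> \<Longrightarrow> i \<le> dimension \<Longrightarrow> fits f i i"
  unfolding fits_def growth_diagonal[OF standard card_T] using cols_refl[OF stable_flagsD(2)[of f i]]
  by (auto simp: column_length_def)

lemma flags_with_r_iff: "f \<in> flags_with_r \<eta> T \<longleftrightarrow> f \<in> stable_flags \<eta> \<and> (\<forall>j\<le>dimension. fits f 0 j)"
  unfolding flags_with_r_def fits_def growth_def using r_tableau_eq_iff[OF _ standard] by auto

lemma flags_with_q_iff:
  "f \<in> flags_with_q \<eta> (evacuation T) \<longleftrightarrow> f \<in> stable_flags \<eta> \<and> (\<forall>i\<le>dimension. fits f i dimension)"
proof -
  note ev = evacuation_props[OF standard card_T]
  have "dom (entries_below (evacuation T) (dimension - i)) = growth T i dimension" if "i \<le> dimension" for i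
    using ev that by simp
  then show ?thesis unfolding flags_with_q_def fits_def using q_tableau_eq_iff[of _ "evacuation T"] ev by auto
qed

lemma closure_trans:
  assumes "A \<subseteq> cl B" "B \<subseteq> cl C"
  shows "A \<subseteq> cl C"
  using assms closure_of_minimal[OF assms(2) closedin_closure_of] by blast

lemma closure_refl: "A \<subseteq> stable_flags \<eta> \<Longrightarrow> A \<subseteq> B \<Longrightarrow> A \<subseteq> cl B"
proof -
  assume A: "A \<subseteq> stable_flags \<eta>" "A \<subseteq> B"
  have "topspace (stable_flag_variety \<eta>) = stable_flags \<eta>"
    unfolding stable_flag_variety_def topspace_subtopology topspace_flag_variety stable_flags_def by auto
  then have "A \<subseteq> cl A" using A(1) by (simp add: closure_of_subset)
  then show ?thesis using closure_of_mono[OF A(2)] by blast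
qed

lemma cell:
  assumes f: "f \<in> stable_flags \<eta>" and ij: "i < j" "j < dimension"
  shows "stable (f ! i)" "stable (f ! Suc i)" "stable (f ! j)" "stable (f ! Suc j)"
    "f ! i \<subseteq> f ! Suc i" "f ! Suc i \<subseteq> f ! j" "f ! j \<subseteq> f ! Suc j"
    "dim (f ! Suc i) = dim (f ! i) + 1" "dim (f ! Suc j) = dim (f ! j) + 1"
  using stable_flagsD[OF f] complete_flags_mono[OF stable_flagsD(1)[OF f]]
    complete_flagsD(5)[OF stable_flagsD(1)[OF f]] ij by auto

text \<open>Column j is right, and column j + 1 is right down to row i. Of row 0 only the part from
  column j on is recorded: a deformation on f_j/f_i with i > 0 may spoil the cells (0, k) with i < k
  < j, which have served their purpose.\<close>

definition rowwise :: "nat \<Rightarrow> nat \<Rightarrow> 'b set list set" where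
  "rowwise j i = {f \<in> stable_flags \<eta>. (\<forall>i'\<le>j. fits f i' j) \<and> (\<forall>j'. j \<le> j' \<longrightarrow> j' \<le> dimension \<longrightarrow> fits f 0 j') \<and>
     (\<forall>i'\<le>i. fits f i' (Suc j))}"

text \<open>The cell corrected is (i+1, j+1), by a deformation on f_j/f_i. Members with index at
  most i or at least j do not move, which saves row 0 from column j on and column j + 1 down to row
  i. The rest of column j survives because types inside f_j/f_i are preserved.\<close>

lemma rowwise_step:
  assumes ij: "i < j" "j < dimension"
  shows "rowwise j i \<subseteq> cl (rowwise j (Suc i))"
proof
  fix f assume f: "f \<in> rowwise j i"
  then have st: "f \<in> stable_flags \<eta>" and fit: "\<And>i'. i' \<le> j \<Longrightarrow> fits f i' j"
    "\<And>j'. j \<le> j' \<Longrightarrow> j' \<le> dimension \<Longrightarrow> fits f 0 j'" "\<And>i'. i' \<le> i \<Longrightarrow> fits f i' (Suc j)"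
    unfolding rowwise_def by auto
  note c = cell[OF st ij]
  show "f \<in> cl (rowwise j (Suc i))"
  proof (cases "fits f (Suc i) (Suc j)")
    case True
    then have "f \<in> rowwise j (Suc i)" using f unfolding rowwise_def by (auto simp: le_Suc_eq)
    then show ?thesis using closure_refl[of "{f}" "rowwise j (Suc i)"] st by auto
  next
    case False
    have rule: "local_rule (cols (f ! i) (f ! Suc j)) (cols (f ! i) (f ! j)) (column_length (growth T (Suc i) (Suc j)))
      (cols (f ! Suc i) (f ! j))"
      using growth_local_rule[OF standard card_T ij] fit(3)[of i] fit(1)[of i] fit(1)[of "Suc i"] ij
      unfolding fits_def by simp
    obtain n B where n: "deforms (f ! i) (f ! j) n B"
      and \<beta>: "\<And>t. t \<notin> B \<Longrightarrow> cols (shear n t ` (f ! Suc i)) (f ! Suc j) = column_length (growth T (Suc i) (Suc j))"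
      by (rule deform_line[OF c rule False[unfolded fits_def]]) (rule that)
    show ?thesis
    proof (rule closure_of_deformation[OF infinite_field st n])
      show "rowwise j (Suc i) \<subseteq> stable_flags \<eta>" unfolding rowwise_def by blast
      fix t assume t: "t \<notin> B"
      let ?h = "move_flag n t f"
      have le: "i \<le> j" "j \<le> dimension" using ij by auto
      note mv = deforms_move_flag[OF st le n t]
      have 1: "fits ?h i' j" if "i' \<le> j" for i'
      proof (cases "i' \<le> i")
        case True
        then show ?thesis using fit(1)[OF that] mv(2)[OF True] mv(3)[of j] le unfolding fits_def by simp
      next
        case F: False
        then show ?thesis using fit(1)[OF that] mv(4)[of i' j] that unfolding fits_def by simp
      qed
      have 2: "fits ?h 0 j'" if "j \<le> j'" "j' \<le> dimension" for j'
        using fit(2)[OF that] mv(2)[of 0] mv(3)[OF that] unfolding fits_def by simp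
      have 3: "fits ?h i' (Suc j)" if "i' \<le> Suc i" for i'
      proof (cases "i' \<le> i")
        case True
        then show ?thesis using fit(3)[OF True] mv(2)[OF True] mv(3)[of "Suc j"] ij unfolding fits_def by simp
      next
        case F: False
        then have "i' = Suc i" using that by simp
        then show ?thesis
          using \<beta>[OF t] mv(3)[of "Suc j"] ij move_flag_nth[OF stable_flagsD(1)[OF st], of "Suc i" n t] unfolding fits_def by simp
      qed
      show "?h \<in> rowwise j (Suc i)" unfolding rowwise_def using mv(1) 1 2 3 by blast
    qed
  qed
qed

definition rows_done :: "nat \<Rightarrow> 'b set list set" where
  "rows_done j = {f \<in> stable_flags \<eta>. (\<forall>i'\<le>j. fits f i' j) \<and> (\<forall>j'. j \<le> j' \<longrightarrow> j' \<le> dimension \<longrightarrow> fits f 0 j')}"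

lemma rows_done_step:
  assumes "j < dimension"
  shows "rows_done j \<subseteq> cl (rows_done (Suc j))"
proof -
  have "rows_done j \<subseteq> rowwise j 0" unfolding rows_done_def rowwise_def using assms by auto
  then have start: "rows_done j \<subseteq> cl (rowwise j 0)" by (intro closure_refl) (auto simp: rows_done_def)
  have mid: "rowwise j 0 \<subseteq> cl (rowwise j i)" if "i \<le> j" for i
    using that
  proof (induction i)
    case 0
    show ?case by (rule closure_refl) (auto simp: rowwise_def)
  next
    case (Suc i)
    then have "rowwise j 0 \<subseteq> cl (rowwise j i)" "i < j" by simp_all
    then show ?case using closure_trans rowwise_step[OF _ assms] by blast
  qed
  have "rowwise j j \<subseteq> rows_done (Suc j)"
  proof
    fix f assume f: "f \<in> rowwise j j"
    then have "fits f (Suc j) (Suc j)" using assms by (intro fits_diagonal) (auto simp: rowwise_def)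
    then show "f \<in> rows_done (Suc j)" using f unfolding rowwise_def rows_done_def by (auto simp: le_Suc_eq)
  qed
  then have "rowwise j j \<subseteq> cl (rows_done (Suc j))" by (intro closure_refl) (auto simp: rowwise_def)
  then show ?thesis by (rule closure_trans[OF closure_trans[OF start mid[OF order_refl]]])
qed

lemma flags_with_r_subset_closure: "flags_with_r \<eta> T \<subseteq> cl (flags_with_q \<eta> (evacuation T))"
proof -
  have mid: "rows_done 0 \<subseteq> cl (rows_done j)" if "j \<le> dimension" for j
    using that
  proof (induction j)
    case 0
    show ?case by (rule closure_refl) (auto simp: rows_done_def)
  next
    case (Suc j)
    then have "rows_done 0 \<subseteq> cl (rows_done j)" "j < dimension" by simp_all
    then show ?case using closure_trans rows_done_step by blast
  qed
  have start: "flags_with_r \<eta> T \<subseteq> cl (rows_done 0)"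
    by (intro closure_refl) (auto simp: flags_with_r_iff rows_done_def)
  have "rows_done dimension \<subseteq> cl (flags_with_q \<eta> (evacuation T))"
    by (intro closure_refl) (auto simp: flags_with_q_iff rows_done_def)
  then show ?thesis by (rule closure_trans[OF closure_trans[OF start mid[OF order_refl]]])
qed

text \<open>Mirror image of \<open>rowwise\<close>: row i + 1 is right, and row i is right from
  column j on. Of the last column only the part down to row i + 1 is recorded, since the members
  beyond f_(i+1) may move.\<close>

definition columnwise :: "nat \<Rightarrow> nat \<Rightarrow> 'b set list set" where
  "columnwise i j = {f \<in> stable_flags \<eta>. (\<forall>j'. Suc i \<le> j' \<longrightarrow> j' \<le> dimension \<longrightarrow> fits f (Suc i) j') \<and>
     (\<forall>i'\<le>Suc i. fits f i' dimension) \<and> (\<forall>j'. j \<le> j' \<longrightarrow> j' \<le> dimension \<longrightarrow> fits f i j')}"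

text \<open>The cell corrected is (i, j), by a deformation on f_(j+1)/f_(i+1). Members with index at
  most i + 1 or at least j + 1 do not move, which saves row i beyond column j and the last column
  down to row i + 1. The part of row i + 1 up to column j survives because types inside
  f_(j+1)/f_(i+1) are preserved.\<close>

lemma columnwise_step:
  assumes ij: "i < j" "j < dimension"
  shows "columnwise i (Suc j) \<subseteq> cl (columnwise i j)"
proof
  fix f assume f: "f \<in> columnwise i (Suc j)"
  then have st: "f \<in> stable_flags \<eta>" and fit: "\<And>j'. Suc i \<le> j' \<Longrightarrow> j' \<le> dimension \<Longrightarrow> fits f (Suc i) j'"
    "\<And>i'. i' \<le> Suc i \<Longrightarrow> fits f i' dimension" "\<And>j'. Suc j \<le> j' \<Longrightarrow> j' \<le> dimension \<Longrightarrow> fits f i j'"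
    unfolding columnwise_def by auto
  note c = cell[OF st ij]
  show "f \<in> cl (columnwise i j)"
  proof (cases "fits f i j")
    case True
    have "fits f i j'" if "j \<le> j'" "j' \<le> dimension" for j'
      using True fit(3)[of j'] that by (cases "j' = j") auto
    then have "f \<in> columnwise i j" using f unfolding columnwise_def by blast
    then show ?thesis using closure_refl[of "{f}" "columnwise i j"] st by auto
  next
    case False
    have rule: "local_rule (cols (f ! i) (f ! Suc j)) (column_length (growth T i j)) (cols (f ! Suc i) (f ! Suc j))
      (cols (f ! Suc i) (f ! j))"
      using growth_local_rule[OF standard card_T ij] fit(3)[of "Suc j"] fit(1)[of j] fit(1)[of "Suc j"] ij
      unfolding fits_def by simp
    obtain n B where n: "deforms (f ! Suc i) (f ! Suc j) n B"
      and \<alpha>: "\<And>t. t \<notin> B \<Longrightarrow> cols (f ! i) (shear n t ` (f ! j)) = column_length (growth T i j)"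
      by (rule deform_hyperplane[OF c rule False[unfolded fits_def]]) (rule that)
    show ?thesis
    proof (rule closure_of_deformation[OF infinite_field st n])
      show "columnwise i j \<subseteq> stable_flags \<eta>" unfolding columnwise_def by blast
      fix t assume t: "t \<notin> B"
      let ?h = "move_flag n t f"
      have le: "Suc i \<le> Suc j" "Suc j \<le> dimension" using ij by auto
      note mv = deforms_move_flag[OF st le n t]
      have 1: "fits ?h (Suc i) j'" if "Suc i \<le> j'" "j' \<le> dimension" for j'
      proof (cases "Suc j \<le> j'")
        case True
        then show ?thesis using fit(1)[OF that] mv(2)[of "Suc i"] mv(3)[OF True that(2)] unfolding fits_def by simp
      next
        case F: False
        then show ?thesis using fit(1)[OF that] mv(4)[of "Suc i" j'] that unfolding fits_def by simp
      qed
      have 2: "fits ?h i' dimension" if "i' \<le> Suc i" for i'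
        using fit(2)[OF that] mv(2)[OF that] mv(3)[OF le(2) order_refl] unfolding fits_def by simp
      have 3: "fits ?h i j'" if "j \<le> j'" "j' \<le> dimension" for j'
      proof (cases "Suc j \<le> j'")
        case True
        then show ?thesis using fit(3)[OF True that(2)] mv(2)[of i] mv(3)[OF True that(2)] unfolding fits_def by simp
      next
        case F: False
        then have "j' = j" using that by simp
        then show ?thesis
          using \<alpha>[OF t] mv(2)[of i] ij move_flag_nth[OF stable_flagsD(1)[OF st], of j n t] unfolding fits_def by simp
      qed
      show "?h \<in> columnwise i j" unfolding columnwise_def using mv(1) 1 2 3 by blast
    qed
  qed
qed

definition columns_done :: "nat \<Rightarrow> 'b set list set" where
  "columns_done i = {f \<in> stable_flags \<eta>. (\<forall>j'. i \<le> j' \<longrightarrow> j' \<le> dimension \<longrightarrow> fits f i j') \<and> (\<forall>i'\<le>i. fits f i' dimension)}"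

lemma columns_done_step:
  assumes "i < dimension"
  shows "columns_done (Suc i) \<subseteq> cl (columns_done i)"
proof -
  have "columns_done (Suc i) \<subseteq> columnwise i dimension" unfolding columns_done_def columnwise_def using assms by auto
  then have start: "columns_done (Suc i) \<subseteq> cl (columnwise i dimension)" by (intro closure_refl) (auto simp: columns_done_def)
  have mid: "columnwise i dimension \<subseteq> cl (columnwise i j)" if "Suc i \<le> j" "j \<le> dimension" for j
    using that(2,1)
  proof (induction rule: inc_induct)
    case base
    show ?case by (rule closure_refl) (auto simp: columnwise_def)
  next
    case (step j)
    then have "columnwise i dimension \<subseteq> cl (columnwise i (Suc j))" "i < j" by simp_all
    then show ?case using closure_trans columnwise_step step.hyps(2) by blast
  qed
  have "columnwise i (Suc i) \<subseteq> columns_done i"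
  proof
    fix f assume f: "f \<in> columnwise i (Suc i)"
    then have "fits f i i" using assms by (intro fits_diagonal) (auto simp: columnwise_def)
    then have "fits f i j'" if "i \<le> j'" "j' \<le> dimension" for j'
      using f that unfolding columnwise_def by (cases "j' = i") auto
    then show "f \<in> columns_done i" using f unfolding columnwise_def columns_done_def by auto
  qed
  then have last: "columnwise i (Suc i) \<subseteq> cl (columns_done i)" by (intro closure_refl) (auto simp: columnwise_def)
  have "columnwise i dimension \<subseteq> cl (columnwise i (Suc i))" using mid[of "Suc i"] assms by simp
  then show ?thesis by (rule closure_trans[OF closure_trans[OF start] last])
qed

lemma flags_with_q_subset_closure: "flags_with_q \<eta> (evacuation T) \<subseteq> cl (flags_with_r \<eta> T)"
proof -
  have "columns_done dimension \<subseteq> cl (columns_done i)" if "i \<le> dimension" for i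
    using that
  proof (induction rule: inc_induct)
    case base
    show ?case by (rule closure_refl) (auto simp: columns_done_def)
  next
    case (step i)
    then show ?case using closure_trans columns_done_step by blast
  qed
  then have mid: "columns_done dimension \<subseteq> cl (columns_done 0)" by simp
  have start: "flags_with_q \<eta> (evacuation T) \<subseteq> cl (columns_done dimension)"
  proof (rule closure_refl)
    show "flags_with_q \<eta> (evacuation T) \<subseteq> stable_flags \<eta>" by (auto simp: flags_with_q_iff)
    show "flags_with_q \<eta> (evacuation T) \<subseteq> columns_done dimension"
      using le_antisym by (auto simp: flags_with_q_iff columns_done_def)
  qed
  have "columns_done 0 \<subseteq> cl (flags_with_r \<eta> T)"
    by (intro closure_refl) (auto simp: flags_with_r_iff columns_done_def)
  then show ?thesis by (rule closure_trans[OF closure_trans[OF start mid]])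
qed

lemma closure_eq: "cl (flags_with_r \<eta> T) = cl (flags_with_q \<eta> (evacuation T))"
  using closure_of_minimal[OF flags_with_r_subset_closure closedin_closure_of]
    closure_of_minimal[OF flags_with_q_subset_closure closedin_closure_of] by (rule subset_antisym)

end

theorem corollary3p4:
  fixes scale :: "'k::field \<Rightarrow> 'v::ab_group_add \<Rightarrow> 'v"
    and Basis :: "'v set"
    and \<eta> :: "'v \<Rightarrow> 'v"
    and lam :: "nat \<Rightarrow> nat"
  assumes "finite_dimensional_vector_space scale Basis"
    and "infinite (UNIV :: 'k set)"
    and "Vector_Spaces.linear scale scale \<eta>"
    and "\<exists>k. \<eta> ^^ k = (\<lambda>v. 0)"
    and "finite_dimensional_vector_space.jordan_type scale \<eta> {0} UNIV = lam"
  shows "\<forall>T \<in> standard_tableaux lam.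
    finite_dimensional_vector_space.stable_flag_variety scale Basis \<eta> closure_of
      finite_dimensional_vector_space.flags_with_r scale Basis \<eta> T =
    finite_dimensional_vector_space.stable_flag_variety scale Basis \<eta> closure_of
      finite_dimensional_vector_space.flags_with_q scale Basis \<eta> (evacuation T)"
proof
  fix T assume T: "T \<in> standard_tableaux lam"
  interpret nilpotent_operator scale Basis \<eta>
    by (intro nilpotent_operator.intro nilpotent_operator_axioms.intro assms)
  interpret growth_flags scale Basis \<eta> T
    by (intro growth_flags.intro growth_flags_axioms.intro nilpotent_operator_axioms assms(2)) (use T assms(5) in simp)
  show "stable_flag_variety \<eta> closure_of flags_with_r \<eta> T =
    stable_flag_variety \<eta> closure_of flags_with_q \<eta> (evacuation T)" by (rule closure_eq)
qed

end
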